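(* Let $\mu$ be the Gibbs measure on $\Sigma_A$ of a Hölder continuous potential $f:\Sigma_A\to\mathbb{R}$ that is not cohomologous to a constant. Let $\psi:\mathbb{N}\to\mathbb{N}$ be such that there exists $\varepsilon>0$ for which $$\sum_{n=1}^\infty e^{-h_\mu\psi(n)+(1+\varepsilon)\sqrt{2\rho_\mu\psi(n)\log\log\psi(n)}}<\infty.$$ Then $\mu(R_\psi)=0$.
   Context: Let $K\ge 2$ be an integer and $\Sigma=\{1,\dots,K\}^{\mathbb N}$. For sequences $\mathbf i,\mathbf j$ let $|\mathbf i\wedge\mathbf j|=\inf\{n\ge 0: i_{n+1}\neq j_{n+1}\}$, and equip $\Sigma$ with the metric $d(\mathbf i,\mathbf j)=K^{-|\mathbf i\wedge\mathbf j|}$. Let $A$ be a $K\times K$ matrix with entries in $\{0,1\}$ such that for some $M\in\mathbb N$ all entries of $A^M$ are strictly positive, let $\Sigma_A=\{\mathbf i\in\Sigma: A_{i_l,i_{l+1}}=1\text{ for all } l\in\mathbb N\}$, and let $\sigma:\Sigma_A\to\Sigma_A$ be the left shift $\sigma(i_1,i_2,\dots)=(i_2,i_3,\dots)$. Let $\Sigma_{A,n}$ be the set of words $i_1\dots i_n$ with $A_{i_l,i_{l+1}}=1$ for $1\le l\le n-1$, and for such a word $w$ let $[w]=\{\mathbf j\in\Sigma_A: j_1\dots j_n=w\}$; for $\mathbf i\in\Sigma_A$ write $\mathbf i|_1^n=i_1\dots i_n$. A function $f:\Sigma_A\to\mathbb R$ is Hölder continuous if there are $b>0$, $0<\alpha<1$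 with $|f(\mathbf i)-f(\mathbf j)|\le b\alpha^{|\mathbf i\wedge\mathbf j|}$ for all $\mathbf i,\mathbf j$. Its pressure is $P(f)=\lim_{n\to\infty}\frac1n\log\sum_{w\in\Sigma_{A,n}}\sup_{\mathbf j\in[w]}\exp(\sum_{k=0}^{n-1}f(\sigma^k\mathbf j))$. The Gibbs measure of $f$ is the unique $\sigma$-invariant ergodic Borel probability measure $\mu$ on $\Sigma_A$ for which there is $C>1$ with $C^{-1}\le \mu([\mathbf i|_1^n])\big/\exp(-nP(f)+\sum_{k=0}^{n-1}f(\sigma^k\mathbf i))\le C$ for all $\mathbf i\in\Sigma_A$, $n\in\mathbb N$. Its entropy is $h_\mu=\lim_{n\to\infty}-\frac1n\sum_{w\in\Sigma_{A,n}}\mu([w])\log\mu([w])$ and its variance is $\rho_\mu=\lim_{n\to\infty}\frac1n\int\big(\sum_{k=0}^{n-1}f(\sigma^k\mathbf i)-n\int f\,d\mu\big)^2d\mu(\mathbf i)$. The potential $f$ is cohomologous to a constant if $f=g\circ\sigma-g+c$ for some continuous $g:\Sigma_A\to\mathbb R$ and $c\in\mathbb R$. For $\psi:\mathbb N\to\mathbb N$, $R_\psi=\{\mathbf i\in\Sigma_A: d(\sigma^n\mathbf i,\mathbf i)\le K^{-\psi(n)}\text{ for infinitely many }n\in\mathbb N\}$. Convention: $\log x=0$ whenever $x\le 1$. *)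

theory Defs
  imports "HOL-Probability.Probability"
begin

text \<open>Sequences i = (i_1, i_2, ...) are represented 0-indexed as functions nat => nat,
  i.e. the Isabelle value i n is the paper's i_(n+1). The space of all such functions
  carries the product topology (nat discrete) and its Borel sigma algebra.\<close>

type_synonym seq = "nat \<Rightarrow> nat"

definition shift :: "seq \<Rightarrow> seq" where
  "shift i = (\<lambda>n. i (Suc n))"

definition mat_mult :: "nat \<Rightarrow> (nat \<Rightarrow> nat \<Rightarrow> nat) \<Rightarrow> (nat \<Rightarrow> nat \<Rightarrow> nat) \<Rightarrow> nat \<Rightarrow> nat \<Rightarrow> nat" where
  "mat_mult K A B = (\<lambda>i j. \<Sum>k\<in>{1..K}. A i k * B k j)"

fun mat_pow :: "nat \<Rightarrow> (nat \<Rightarrow> nat \<Rightarrow> nat) \<Rightarrow> nat \<Rightarrow> nat \<Rightarrow> nat \<Rightarrow> nat" where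
  "mat_pow K A 0 = (\<lambda>i j. if i = j then 1 else 0)"
| "mat_pow K A (Suc m) = mat_mult K (mat_pow K A m) A"

definition full_shift :: "nat \<Rightarrow> seq set" where
  "full_shift K = {i. \<forall>n. i n \<in> {1..K}}"

definition SFT :: "nat \<Rightarrow> (nat \<Rightarrow> nat \<Rightarrow> nat) \<Rightarrow> seq set" where
  "SFT K A = {i \<in> full_shift K. \<forall>l. A (i l) (i (Suc l)) = 1}"

definition agree_len :: "seq \<Rightarrow> seq \<Rightarrow> nat" where
  "agree_len i j = (LEAST n. i n \<noteq> j n)"

text \<open>The metric d(i,j) = K^(-|i ^ j|), with d(i,i) = 0 (|i ^ i| = infinity).\<close>
definition seq_dist :: "nat \<Rightarrow> seq \<Rightarrow> seq \<Rightarrow> real" where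
  "seq_dist K i j = (if i = j then 0 else real K powr (- real (agree_len i j)))"

definition words :: "nat \<Rightarrow> (nat \<Rightarrow> nat \<Rightarrow> nat) \<Rightarrow> nat \<Rightarrow> nat list set" where
  "words K A n = {w. length w = n \<and> set w \<subseteq> {1..K} \<and>
                     (\<forall>l. Suc l < n \<longrightarrow> A (w ! l) (w ! Suc l) = 1)}"

definition cyl :: "nat \<Rightarrow> (nat \<Rightarrow> nat \<Rightarrow> nat) \<Rightarrow> nat list \<Rightarrow> seq set" where
  "cyl K A w = {j \<in> SFT K A. \<forall>l < length w. j l = w ! l}"

definition prefix_word :: "seq \<Rightarrow> nat \<Rightarrow> nat list" where
  "prefix_word i n = map i [0..<n]"

definition birkhoff :: "(seq \<Rightarrow> real) \<Rightarrow> nat \<Rightarrow> seq \<Rightarrow> real" where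
  "birkhoff f n i = (\<Sum>k<n. f ((shift ^^ k) i))"

definition holder :: "nat \<Rightarrow> (nat \<Rightarrow> nat \<Rightarrow> nat) \<Rightarrow> (seq \<Rightarrow> real) \<Rightarrow> bool" where
  "holder K A f \<longleftrightarrow> (\<exists>b>0. \<exists>\<alpha>. 0 < \<alpha> \<and> \<alpha> < 1 \<and>
      (\<forall>i\<in>SFT K A. \<forall>j\<in>SFT K A. i \<noteq> j \<longrightarrow> \<bar>f i - f j\<bar> \<le> b * \<alpha> ^ agree_len i j))"

definition pressure :: "nat \<Rightarrow> (nat \<Rightarrow> nat \<Rightarrow> nat) \<Rightarrow> (seq \<Rightarrow> real) \<Rightarrow> real" where
  "pressure K A f = lim (\<lambda>n. (1 / real n) *
      ln (\<Sum>w\<in>words K A n. (SUP j\<in>cyl K A w. exp (birkhoff f n j))))"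

text \<open>mu is a Borel probability measure on the sequence space concentrated on Sigma_A.\<close>
definition shift_invariant :: "seq measure \<Rightarrow> bool" where
  "shift_invariant M \<longleftrightarrow> (\<forall>B\<in>sets M. measure M (shift -` B) = measure M B)"

definition ergodic :: "nat \<Rightarrow> (nat \<Rightarrow> nat \<Rightarrow> nat) \<Rightarrow> seq measure \<Rightarrow> bool" where
  "ergodic K A M \<longleftrightarrow> (\<forall>B\<in>sets M. shift -` B \<inter> SFT K A = B \<inter> SFT K A \<longrightarrow>
        measure M B = 0 \<or> measure M B = 1)"

definition gibbs_measure :: "nat \<Rightarrow> (nat \<Rightarrow> nat \<Rightarrow> nat) \<Rightarrow> (seq \<Rightarrow> real) \<Rightarrow> seq measure \<Rightarrow> bool" where
  "gibbs_measure K A f M \<longleftrightarrow>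
     sets M = sets borel \<and> prob_space M \<and> measure M (SFT K A) = 1 \<and>
     shift_invariant M \<and> ergodic K A M \<and>
     (\<exists>C>1. \<forall>i\<in>SFT K A. \<forall>n\<ge>1.
        1 / C \<le> measure M (cyl K A (prefix_word i n)) /
                    exp (- real n * pressure K A f + birkhoff f n i) \<and>
        measure M (cyl K A (prefix_word i n)) /
                    exp (- real n * pressure K A f + birkhoff f n i) \<le> C)"

definition entropy_of :: "nat \<Rightarrow> (nat \<Rightarrow> nat \<Rightarrow> nat) \<Rightarrow> seq measure \<Rightarrow> real" where
  "entropy_of K A M = lim (\<lambda>n. - (1 / real n) *
      (\<Sum>w\<in>words K A n. measure M (cyl K A w) * ln (measure M (cyl K A w))))"

text \<open>Integrals over Sigma_A (which has full measure) of functions defined on Sigma_A.\<close>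
definition variance_of :: "nat \<Rightarrow> (nat \<Rightarrow> nat \<Rightarrow> nat) \<Rightarrow> (seq \<Rightarrow> real) \<Rightarrow> seq measure \<Rightarrow> real" where
  "variance_of K A f M = lim (\<lambda>n. (1 / real n) *
      (\<integral>i. indicator (SFT K A) i *
          (birkhoff f n i - real n * (\<integral>j. indicator (SFT K A) j * f j \<partial>M))\<^sup>2 \<partial>M))"

definition cohomologous_const :: "nat \<Rightarrow> (nat \<Rightarrow> nat \<Rightarrow> nat) \<Rightarrow> (seq \<Rightarrow> real) \<Rightarrow> bool" where
  "cohomologous_const K A f \<longleftrightarrow> (\<exists>g c. continuous_on (SFT K A) g \<and>
      (\<forall>i\<in>SFT K A. f i = g (shift i) - g i + c))"

definition recurrence_set :: "nat \<Rightarrow> (nat \<Rightarrow> nat \<Rightarrow> nat) \<Rightarrow> (nat \<Rightarrow> nat) \<Rightarrow> seq set" where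
  "recurrence_set K A \<psi> = {i \<in> SFT K A.
      \<exists>\<^sub>\<infinity>n. seq_dist K ((shift ^^ n) i) i \<le> real K powr (- real (\<psi> n))}"

definition log0 :: "real \<Rightarrow> real" where
  "log0 x = (if x \<le> 1 then 0 else ln x)"

end

theory Submission
  imports Defs "HOL-Real_Asymp.Real_Asymp"
begin

text \<open>If the first \<open>m = \<psi> n\<close> letters recur at time \<open>n\<close>, then the first \<open>n\<close> letters determine the first
  \<open>n + m\<close>, so by the quasi-Bernoulli property the recurrence event has measure at most a constant
  times the largest measure of a cylinder of length \<open>m\<close> involved. Almost every point eventually
  lies only in cylinders of length \<open>m\<close> of measure at most
  \<open>exp (- h m + (1 + \<epsilon>) sqrt (2 \<rho> m log log m))\<close>, by the upper half of the law of the iterated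
  logarithm, and the theorem follows from the Borel-Cantelli lemma.

  For the law of the iterated logarithm the potential is normalised by a positive eigenfunction of
  the transfer operator \<open>L\<close>, found by contraction on a cone of functions with Hoelder logarithm.
  The normalised potential is, up to a constant and a coboundary, a function \<open>m\<close> with \<open>L m = 0\<close>.
  Perturbing \<open>L\<close> to second order gives
  \<open>E exp (t S_n m) \<le> D exp (n (t^2 \<rho> / 2 + Q |t|^3))\<close>, and Ottaviani's maximal inequality along
  geometrically growing times yields the sharp constant. If \<open>\<rho> = 0\<close> then \<open>m = 0\<close>, which is the
  excluded case of a potential cohomologous to a constant.\<close>

text \<open>The measure is known only through its invariance and the Gibbs inequality, and no
  eigenmeasure of \<open>L\<close> is constructed. Instead the limit of \<open>L^n \<phi>\<close>
  defines a functional \<open>nu\<close>, which \<open>I_eq_nu\<close> identifies with the integral: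
  the Gibbs inequality bounds second moments of martingale sums by order \<open>n\<close>, so by
  invariance their mean, which is \<open>n\<close> times a constant, must be 0. The pressure is not
  computed either; that the cylinder measures of each length sum to 1 forces it to be the logarithm
  of the eigenvalue. Entropy and variance are defined as limits, so their convergence has to be
  shown. The sharp constant leaves no room in the quadratic term of the exponential moment, hence
  the second-order correction by a Poisson equation. The Gibbs constants only multiply probabilities
  or move logarithms of cylinder measures by a bounded amount, which is negligible on the scale
  \<open>sqrt n\<close>. The random variables \<open>X n\<close> depend on finitely many letters, so
  expectations are finite sums over words, and these are bounded through \<open>L^n\<close> at
  finitely many points.\<close>

lemma geometric_null: "0 < \<gamma> \<Longrightarrow> \<gamma> < 1 \<Longrightarrow> (\<lambda>n. c * \<gamma> ^ n) \<longlonglongrightarrow> (0::real)"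
  by (intro tendsto_mult_right_zero LIMSEQ_power_zero) auto

text \<open>A relation instead of \<open>agree_len\<close>, whose value at two equal sequences is
  unspecified. Hoelder bounds in terms of it need no case distinction.\<close>

definition agree :: "nat \<Rightarrow> seq \<Rightarrow> seq \<Rightarrow> bool" where
  "agree n x y \<longleftrightarrow> (\<forall>l<n. x l = y l)"

definition scons :: "nat \<Rightarrow> seq \<Rightarrow> seq" where
  "scons a x = case_nat a x"

lemma scons_0 [simp]: "scons a x 0 = a"
  and scons_Suc [simp]: "scons a x (Suc n) = x n"
  by (simp_all add: scons_def)

lemma shift_scons [simp]: "shift (scons a x) = x"
  by (simp add: shift_def)

lemma scons_shift [simp]: "scons (x 0) (shift x) = x"
  by (auto simp: scons_def shift_def fun_eq_iff split: nat.split)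

lemma funpow_shift: "(shift ^^ n) x = (\<lambda>k. x (n + k))"
  by (induction n arbitrary: x) (auto simp: shift_def funpow_swap1)

lemma agree_0 [simp]: "agree 0 x y"
  by (simp add: agree_def)

lemma agree_sym: "agree n x y \<Longrightarrow> agree n y x"
  by (simp add: agree_def)

lemma agree_scons: "agree n x y \<Longrightarrow> agree (Suc n) (scons a x) (scons a y)"
  unfolding agree_def
proof (intro allI impI)
  fix l assume h: "\<forall>l<n. x l = y l" "l < Suc n"
  then show "scons a x l = scons a y l" by (cases l) auto
qed

lemma agree_shift: "agree (Suc n) x y \<Longrightarrow> agree n (shift x) (shift y)"
  by (auto simp: agree_def shift_def)

lemma birkhoff_0 [simp]: "birkhoff f 0 x = 0"
  by (simp add: birkhoff_def)

lemma birkhoff_Suc: "birkhoff f (Suc n) x = f x + birkhoff f n (shift x)"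
proof -
  have "birkhoff f (Suc n) x = f x + (\<Sum>k<n. f ((shift ^^ Suc k) x))"
    unfolding birkhoff_def by (subst sum.lessThan_Suc_shift) simp
  then show ?thesis by (simp add: birkhoff_def funpow_swap1)
qed

lemma birkhoff_add: "birkhoff f (n + k) x = birkhoff f n x + birkhoff f k ((shift ^^ n) x)"
  by (induction n arbitrary: x) (simp_all add: birkhoff_Suc funpow_swap1)

text \<open>The Ruelle operator: for \<open>x\<close> in Sigma_A the sequences
  \<open>scons a x\<close> in the sum are exactly the preimages of \<open>x\<close> under the
  shift.\<close>

definition transfer ::
  "nat \<Rightarrow> (nat \<Rightarrow> nat \<Rightarrow> nat) \<Rightarrow> (seq \<Rightarrow> real) \<Rightarrow> (seq \<Rightarrow> real) \<Rightarrow> seq \<Rightarrow> real" where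
  "transfer K A g \<phi> x =
     (\<Sum>a | a \<in> {1..K} \<and> A a (x 0) = 1. exp (g (scons a x)) * \<phi> (scons a x))"

section \<open>Primitive subshifts of finite type: points and preimages\<close>

locale sft =
  fixes K :: nat and A :: "nat \<Rightarrow> nat \<Rightarrow> nat" and p :: nat
  assumes K2: "K \<ge> 2"
    and A01: "\<And>i j. i \<in> {1..K} \<Longrightarrow> j \<in> {1..K} \<Longrightarrow> A i j \<in> {0, 1}"
    and primitive: "\<And>i j. i \<in> {1..K} \<Longrightarrow> j \<in> {1..K} \<Longrightarrow> mat_pow K A p i j > 0"
begin

abbreviation S :: "seq set" where "S \<equiv> SFT K A"

lemma p_pos: "p \<ge> 1"
proof (rule ccontr)
  assume "\<not> p \<ge> 1"
  then have "p = 0" by simp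
  then show False using primitive[of 1 2] K2 by auto
qed

lemma S_letter: "x \<in> S \<Longrightarrow> x n \<in> {1..K}"
  by (auto simp: SFT_def full_shift_def)

lemma shift_in_S: "x \<in> S \<Longrightarrow> shift x \<in> S"
  by (auto simp: SFT_def full_shift_def shift_def)

lemma funpow_shift_in_S: "x \<in> S \<Longrightarrow> (shift ^^ n) x \<in> S"
  by (induction n) (auto simp: shift_in_S)

lemma scons_in_S: "x \<in> S \<Longrightarrow> a \<in> {1..K} \<Longrightarrow> A a (x 0) = 1 \<Longrightarrow> scons a x \<in> S"
proof -
  assume h: "x \<in> S" "a \<in> {1..K}" "A a (x 0) = 1"
  have "scons a x n \<in> {1..K}" for n
    using h S_letter[OF h(1)] by (cases n) auto
  moreover have "A (scons a x l) (scons a x (Suc l)) = 1" for l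
    using h by (cases l) (auto simp: SFT_def)
  ultimately show ?thesis by (auto simp: SFT_def full_shift_def)
qed

lemma mat_pow_Suc_posE:
  assumes "mat_pow K A (Suc n) a j > 0"
  obtains k where "k \<in> {1..K}" "mat_pow K A n a k > 0" "A k j > 0"
proof -
  have "(\<Sum>k\<in>{1..K}. mat_pow K A n a k * A k j) \<noteq> 0"
    using assms unfolding mat_pow.simps mat_mult_def by (rule gr_implies_not0)
  then obtain k where "k \<in> {1..K}" "mat_pow K A n a k * A k j \<noteq> 0"
    by (meson sum.not_neutral_contains_not_neutral)
  then show ?thesis using that by auto
qed

lemma successor_exists:
  "mat_pow K A n a j > 0 \<Longrightarrow> n \<ge> 1 \<Longrightarrow> a \<in> {1..K} \<Longrightarrow> j \<in> {1..K} \<Longrightarrow> \<exists>b\<in>{1..K}. A a b = 1"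
proof (induction n arbitrary: j)
  case (Suc n)
  from Suc.prems(1) obtain k where k: "k \<in> {1..K}" "mat_pow K A n a k > 0" "A k j > 0"
    by (rule mat_pow_Suc_posE)
  show ?case
  proof (cases "n = 0")
    case True
    then have "a = k" "A k j > 0" using k by (auto split: if_splits)
    then have "A a j = 1" using A01[OF Suc.prems(3,4)] by auto
    then show ?thesis using Suc.prems by auto
  next
    case False
    then show ?thesis using Suc.IH[of k] k Suc.prems by auto
  qed
qed simp

definition next_letter :: "nat \<Rightarrow> nat" where
  "next_letter a = (SOME b. b \<in> {1..K} \<and> A a b = 1)"

text \<open>One sample point per letter. A function in the cone below is controlled up to a constant
  factor by its values at these \<open>K\<close> points, and every word has a continuation that ends
  in one of them.\<close>

definition base_point :: "nat \<Rightarrow> seq" where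
  "base_point a = (\<lambda>n. (next_letter ^^ n) a)"

lemma base_point_in_S: "a \<in> {1..K} \<Longrightarrow> base_point a \<in> S"
  and base_point_0 [simp]: "base_point a 0 = a"
proof -
  have nl: "next_letter c \<in> {1..K} \<and> A c (next_letter c) = 1" if "c \<in> {1..K}" for c
  proof -
    have "1 \<in> {1..K}" using K2 by simp
    then have "\<exists>b\<in>{1..K}. A c b = 1"
      using successor_exists[OF primitive[OF that, of 1] p_pos that] by blast
    then have "\<exists>b. b \<in> {1..K} \<and> A c b = 1" by blast
    from someI_ex[OF this] show ?thesis unfolding next_letter_def .
  qed
  assume a: "a \<in> {1..K}"
  have "(next_letter ^^ n) a \<in> {1..K}" for n
    using a nl by (induction n) auto
  then show "base_point a \<in> S"
    using nl by (auto simp: SFT_def full_shift_def base_point_def)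
qed (simp add: base_point_def)

definition origin :: seq where "origin = base_point 1"

lemma origin_in_S [simp]: "origin \<in> S"
  unfolding origin_def using K2 by (intro base_point_in_S) auto

lemma preimage_exists_aux:
  "mat_pow K A n a (x 0) > 0 \<Longrightarrow> a \<in> {1..K} \<Longrightarrow> x \<in> S \<Longrightarrow>
     \<exists>y\<in>S. y 0 = a \<and> (shift ^^ n) y = x"
proof (induction n arbitrary: x)
  case 0
  then show ?case by (auto split: if_splits)
next
  case (Suc n)
  from Suc.prems(1) obtain k where k: "k \<in> {1..K}" "mat_pow K A n a k > 0" "A k (x 0) > 0"
    by (rule mat_pow_Suc_posE)
  have "A k (x 0) = 1" using A01[OF k(1) S_letter[OF Suc.prems(3), of 0]] k(3) by auto
  then have "scons k x \<in> S" using Suc.prems k by (intro scons_in_S) auto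
  then obtain y where "y \<in> S" "y 0 = a" "(shift ^^ n) y = scons k x"
    using Suc.IH[of "scons k x"] k Suc.prems by auto
  then show ?case by (intro bexI[of _ y]) auto
qed

lemma preimage_exists:
  "a \<in> {1..K} \<Longrightarrow> x \<in> S \<Longrightarrow> \<exists>y\<in>S. y 0 = a \<and> (shift ^^ p) y = x"
  using preimage_exists_aux[OF primitive] S_letter by blast

lemma predecessor_exists:
  assumes "x \<in> S" shows "\<exists>a\<in>{1..K}. A a (x 0) = 1"
proof -
  obtain y where y: "y \<in> S" "(shift ^^ p) y = x"
    using preimage_exists[of 1 x] assms K2 by auto
  obtain q where q: "p = Suc q" using p_pos by (cases p) auto
  have "A (y q) (y (Suc q)) = 1" using y by (auto simp: SFT_def)
  moreover have "y (Suc q) = x 0" using y(2)[symmetric] q by (simp add: funpow_shift del: funpow.simps)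
  ultimately show ?thesis using S_letter[OF y(1)] by auto
qed

subsection \<open>Hoelder functions\<close>

text \<open>Taking \<open>n = 0\<close> bounds the oscillation over all of \<open>S\<close> by
  \<open>C\<close>, so these functions are bounded without an appeal to compactness.\<close>

definition hol :: "real \<Rightarrow> real \<Rightarrow> (seq \<Rightarrow> real) \<Rightarrow> bool" where
  "hol \<alpha> C \<phi> \<longleftrightarrow> C \<ge> 0 \<and>
     (\<forall>n. \<forall>x\<in>S. \<forall>y\<in>S. agree n x y \<longrightarrow> \<bar>\<phi> x - \<phi> y\<bar> \<le> C * \<alpha> ^ n)"

lemma holI:
  "C \<ge> 0 \<Longrightarrow> (\<And>n x y. x \<in> S \<Longrightarrow> y \<in> S \<Longrightarrow> agree n x y \<Longrightarrow> \<bar>\<phi> x - \<phi> y\<bar> \<le> C * \<alpha> ^ n) \<Longrightarrow> hol \<alpha> C \<phi>"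
  by (auto simp: hol_def)

lemma holD:
  "hol \<alpha> C \<phi> \<Longrightarrow> x \<in> S \<Longrightarrow> y \<in> S \<Longrightarrow> agree n x y \<Longrightarrow> \<bar>\<phi> x - \<phi> y\<bar> \<le> C * \<alpha> ^ n"
  by (auto simp: hol_def)

lemma hol_nonneg: "hol \<alpha> C \<phi> \<Longrightarrow> C \<ge> 0"
  by (auto simp: hol_def)

lemma hol_bounded: "hol \<alpha> C \<phi> \<Longrightarrow> x \<in> S \<Longrightarrow> \<bar>\<phi> x\<bar> \<le> \<bar>\<phi> origin\<bar> + C"
  using holD[of \<alpha> C \<phi> x origin 0] origin_in_S by auto

lemma hol_const: "hol \<alpha> 0 (\<lambda>_. c)"
  by (auto simp: hol_def)

lemma hol_add: "hol \<alpha> C \<phi> \<Longrightarrow> hol \<alpha> D \<psi> \<Longrightarrow> hol \<alpha> (C + D) (\<lambda>x. \<phi> x + \<psi> x)"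
proof (rule holI)
  assume h: "hol \<alpha> C \<phi>" "hol \<alpha> D \<psi>"
  show "C + D \<ge> 0" using hol_nonneg[OF h(1)] hol_nonneg[OF h(2)] by simp
  fix n x y assume "x \<in> S" "y \<in> S" "agree n x y"
  then show "\<bar>\<phi> x + \<psi> x - (\<phi> y + \<psi> y)\<bar> \<le> (C + D) * \<alpha> ^ n"
    using holD[OF h(1), of x y n] holD[OF h(2), of x y n] by (simp add: algebra_simps)
qed

lemma hol_cmult: "hol \<alpha> C \<phi> \<Longrightarrow> hol \<alpha> (\<bar>k\<bar> * C) (\<lambda>x. k * \<phi> x)"
proof (rule holI)
  assume h: "hol \<alpha> C \<phi>"
  show "\<bar>k\<bar> * C \<ge> 0" using hol_nonneg[OF h] by simp
  fix n x y assume "x \<in> S" "y \<in> S" "agree n x y"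
  then have "\<bar>k\<bar> * \<bar>\<phi> x - \<phi> y\<bar> \<le> \<bar>k\<bar> * (C * \<alpha> ^ n)"
    by (intro mult_left_mono holD[OF h]) auto
  then show "\<bar>k * \<phi> x - k * \<phi> y\<bar> \<le> \<bar>k\<bar> * C * \<alpha> ^ n"
    by (simp add: abs_mult right_diff_distrib[symmetric] mult.assoc)
qed

lemma hol_diff: "hol \<alpha> C \<phi> \<Longrightarrow> hol \<alpha> D \<psi> \<Longrightarrow> hol \<alpha> (C + D) (\<lambda>x. \<phi> x - \<psi> x)"
  using hol_add[of \<alpha> C \<phi> "\<bar>- 1\<bar> * D" "\<lambda>x. - 1 * \<psi> x"] hol_cmult[of \<alpha> D \<psi> "- 1"] by simp

lemma hol_mult:
  assumes "hol \<alpha> C \<phi>" "hol \<alpha> D \<psi>" and \<alpha>: "\<alpha> \<ge> 0"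
  shows "\<exists>E. hol \<alpha> E (\<lambda>x. \<phi> x * \<psi> x)"
proof -
  define P where "P = \<bar>\<phi> origin\<bar> + C"
  define Q where "Q = \<bar>\<psi> origin\<bar> + D"
  have PQ: "P \<ge> 0" "Q \<ge> 0" using hol_nonneg[OF assms(1)] hol_nonneg[OF assms(2)] by (auto simp: P_def Q_def)
  have "hol \<alpha> (P * D + C * Q) (\<lambda>x. \<phi> x * \<psi> x)"
  proof (rule holI)
    show "P * D + C * Q \<ge> 0" using PQ hol_nonneg[OF assms(1)] hol_nonneg[OF assms(2)] by auto
    fix n x y assume xy: "x \<in> S" "y \<in> S" "agree n x y"
    have "\<phi> x * \<psi> x - \<phi> y * \<psi> y = \<phi> x * (\<psi> x - \<psi> y) + (\<phi> x - \<phi> y) * \<psi> y"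
      by (simp add: algebra_simps)
    then have "\<bar>\<phi> x * \<psi> x - \<phi> y * \<psi> y\<bar> \<le> \<bar>\<phi> x\<bar> * \<bar>\<psi> x - \<psi> y\<bar> + \<bar>\<phi> x - \<phi> y\<bar> * \<bar>\<psi> y\<bar>"
      by (metis abs_mult abs_triangle_ineq)
    also have "\<dots> \<le> P * (D * \<alpha> ^ n) + (C * \<alpha> ^ n) * Q"
    proof (intro add_mono mult_mono)
      show "\<bar>\<phi> x\<bar> \<le> P" unfolding P_def by (rule hol_bounded[OF assms(1) xy(1)])
      show "\<bar>\<psi> y\<bar> \<le> Q" unfolding Q_def by (rule hol_bounded[OF assms(2) xy(2)])
      show "\<bar>\<phi> x - \<phi> y\<bar> \<le> C * \<alpha> ^ n" by (rule holD[OF assms(1) xy])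
      show "\<bar>\<psi> x - \<psi> y\<bar> \<le> D * \<alpha> ^ n" by (rule holD[OF assms(2) xy])
      show "0 \<le> C * \<alpha> ^ n" using hol_nonneg[OF assms(1)] \<alpha> by simp
    qed (use PQ in auto)
    finally show "\<bar>\<phi> x * \<psi> x - \<phi> y * \<psi> y\<bar> \<le> (P * D + C * Q) * \<alpha> ^ n"
      by (simp add: algebra_simps)
  qed
  then show ?thesis by (rule exI)
qed

text \<open>The shift consumes one letter of agreement, which costs the factor
  \<open>1 / \<alpha>\<close>; for \<open>n = 0\<close> there is no letter to lose and
  \<open>C \<le> C / \<alpha>\<close> suffices.\<close>

lemma hol_shift:
  assumes h: "hol \<alpha> C \<phi>" and \<alpha>: "0 < \<alpha>" "\<alpha> < 1"
  shows "hol \<alpha> (C / \<alpha>) (\<lambda>x. \<phi> (shift x))"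
proof (rule holI)
  show "C / \<alpha> \<ge> 0" using hol_nonneg[OF h] \<alpha> by simp
  fix n x y assume xy: "x \<in> S" "y \<in> S" "agree n x y"
  show "\<bar>\<phi> (shift x) - \<phi> (shift y)\<bar> \<le> C / \<alpha> * \<alpha> ^ n"
  proof (cases n)
    case 0
    have "\<bar>\<phi> (shift x) - \<phi> (shift y)\<bar> \<le> C * \<alpha> ^ 0"
      using xy by (intro holD[OF h] shift_in_S) auto
    also have "\<dots> \<le> C / \<alpha>" using \<alpha> hol_nonneg[OF h] by (simp add: le_divide_eq mult_left_le)
    finally show ?thesis using 0 by simp
  next
    case (Suc k)
    then have "\<bar>\<phi> (shift x) - \<phi> (shift y)\<bar> \<le> C * \<alpha> ^ k"
      using xy by (intro holD[OF h] shift_in_S) (auto intro: agree_shift)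
    then show ?thesis using Suc \<alpha> by simp
  qed
qed

lemma hol_funpow_shift:
  assumes h: "hol \<alpha> C \<phi>" and \<alpha>: "0 < \<alpha>" "\<alpha> < 1"
  shows "\<exists>D. hol \<alpha> D (\<lambda>x. \<phi> ((shift ^^ n) x))"
proof (induction n)
  case 0
  then show ?case using h by auto
next
  case (Suc n)
  then obtain D where "hol \<alpha> D (\<lambda>x. \<phi> ((shift ^^ n) x))" ..
  from hol_shift[OF this \<alpha>] show ?case by (auto simp: funpow_swap1)
qed

lemma hol_birkhoff:
  assumes h: "hol \<alpha> C \<phi>" and \<alpha>: "0 < \<alpha>" "\<alpha> < 1"
  shows "\<exists>D. hol \<alpha> D (birkhoff \<phi> n)"
proof (induction n)
  case 0
  then show ?case using hol_const[of \<alpha> 0] by (auto simp: birkhoff_def)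
next
  case (Suc n)
  then obtain D where "hol \<alpha> D (birkhoff \<phi> n)" ..
  moreover obtain E where "hol \<alpha> E (\<lambda>x. \<phi> ((shift ^^ n) x))"
    using hol_funpow_shift[OF assms] ..
  ultimately have "hol \<alpha> (D + E) (\<lambda>x. birkhoff \<phi> n x + \<phi> ((shift ^^ n) x))"
    by (rule hol_add)
  then show ?case by (auto simp: birkhoff_def)
qed

text \<open>The k-th shifts of the two points still agree on \<open>n - k\<close> letters, so the
  differences are dominated by a geometric series and the bound is uniform in \<open>n\<close>. It
  allows Birkhoff sums to be replaced by functions of the word alone.\<close>

lemma birkhoff_distortion:
  assumes h: "hol \<alpha> C \<phi>" and \<alpha>: "0 < \<alpha>" "\<alpha> < 1"
    and "x \<in> S" "y \<in> S" "agree n x y"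
  shows "\<bar>birkhoff \<phi> n x - birkhoff \<phi> n y\<bar> \<le> C / (1 - \<alpha>)"
proof -
  have "\<bar>birkhoff \<phi> n x - birkhoff \<phi> n y\<bar> \<le> C * (\<Sum>k<n. \<alpha> ^ Suc k)"
    using assms(4-6)
  proof (induction n arbitrary: x y)
    case (Suc n)
    have "\<bar>\<phi> x - \<phi> y\<bar> \<le> C * \<alpha> ^ Suc n" using Suc.prems by (intro holD[OF h])
    moreover have "\<bar>birkhoff \<phi> n (shift x) - birkhoff \<phi> n (shift y)\<bar> \<le> C * (\<Sum>k<n. \<alpha> ^ Suc k)"
      using Suc.prems by (intro Suc.IH shift_in_S agree_shift)
    ultimately show ?case by (simp add: birkhoff_Suc algebra_simps)
  qed auto
  also have "\<dots> \<le> C * (1 / (1 - \<alpha>))"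
  proof (rule mult_left_mono[OF _ hol_nonneg[OF h]])
    have "(\<Sum>k<n. \<alpha> ^ Suc k) \<le> (\<Sum>k<n. \<alpha> ^ k)"
      using \<alpha> by (intro sum_mono power_decreasing) auto
    also have "\<dots> = (1 - \<alpha> ^ n) / (1 - \<alpha>)" using \<alpha> by (subst sum_gp_strict) auto
    also have "\<dots> \<le> 1 / (1 - \<alpha>)" using \<alpha> by (intro divide_right_mono) auto
    finally show "(\<Sum>k<n. \<alpha> ^ Suc k) \<le> 1 / (1 - \<alpha>)" .
  qed
  finally show ?thesis by simp
qed

subsection \<open>The transfer operator\<close>

definition pred_letters :: "nat \<Rightarrow> nat set" where
  "pred_letters j = {a. a \<in> {1..K} \<and> A a j = 1}"

lemma finite_pred_letters [simp]: "finite (pred_letters j)"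
  by (simp add: pred_letters_def)

lemma card_pred_letters: "card (pred_letters j) \<le> K"
proof -
  have "card (pred_letters j) \<le> card {1..K}"
    unfolding pred_letters_def by (intro card_mono) auto
  then show ?thesis by simp
qed

lemma pred_letters_nonempty: "x \<in> S \<Longrightarrow> pred_letters (x 0) \<noteq> {}"
  using predecessor_exists[of x] by (auto simp: pred_letters_def)

lemma scons_pred_in_S: "x \<in> S \<Longrightarrow> a \<in> pred_letters (x 0) \<Longrightarrow> scons a x \<in> S"
  unfolding pred_letters_def by (intro scons_in_S) auto

lemma S_pred_letters: "y \<in> S \<Longrightarrow> y 0 \<in> pred_letters (shift y 0)"
  using S_letter[of y 0] by (auto simp: SFT_def shift_def pred_letters_def)

abbreviation L :: "(seq \<Rightarrow> real) \<Rightarrow> (seq \<Rightarrow> real) \<Rightarrow> seq \<Rightarrow> real" where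
  "L \<equiv> transfer K A"

lemma transfer_eq:
  "L g \<phi> x = (\<Sum>a\<in>pred_letters (x 0). exp (g (scons a x)) * \<phi> (scons a x))"
  by (simp add: transfer_def pred_letters_def)

lemma L_add: "L g (\<lambda>x. \<phi> x + \<psi> x) = (\<lambda>x. L g \<phi> x + L g \<psi> x)"
  by (simp add: fun_eq_iff transfer_eq sum.distrib algebra_simps)

lemma L_cmult: "L g (\<lambda>x. c * \<phi> x) = (\<lambda>x. c * L g \<phi> x)"
  by (simp add: fun_eq_iff transfer_eq sum_distrib_left algebra_simps)

lemma L_diff: "L g (\<lambda>x. \<phi> x - \<psi> x) = (\<lambda>x. L g \<phi> x - L g \<psi> x)"
  by (simp add: fun_eq_iff transfer_eq sum_subtractf algebra_simps)

lemma L_mono: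
  "(\<And>y. y \<in> S \<Longrightarrow> \<phi> y \<le> \<psi> y) \<Longrightarrow> x \<in> S \<Longrightarrow> L g \<phi> x \<le> L g \<psi> x"
  unfolding transfer_eq by (intro sum_mono mult_left_mono) (auto intro: scons_pred_in_S)

lemma L_cong:
  "(\<And>y. y \<in> S \<Longrightarrow> \<phi> y = \<psi> y) \<Longrightarrow> x \<in> S \<Longrightarrow> L g \<phi> x = L g \<psi> x"
  unfolding transfer_eq by (intro sum.cong) (auto intro: scons_pred_in_S)

text \<open>On the preimages of \<open>x\<close> the factor \<open>\<psi> (shift y)\<close> is
  constant. For normalised \<open>g\<close> this is the pull-out property of a conditional
  expectation given the shifted sequence.\<close>

lemma L_mult_shift: "L g (\<lambda>y. \<phi> y * \<psi> (shift y)) = (\<lambda>x. \<psi> x * L g \<phi> x)"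
  by (simp add: fun_eq_iff transfer_eq sum_distrib_left algebra_simps)

lemma Ln_add: "(L g ^^ n) (\<lambda>x. \<phi> x + \<psi> x) = (\<lambda>x. (L g ^^ n) \<phi> x + (L g ^^ n) \<psi> x)"
  by (induction n) (auto simp: L_add)

lemma Ln_cmult: "(L g ^^ n) (\<lambda>x. c * \<phi> x) = (\<lambda>x. c * (L g ^^ n) \<phi> x)"
  by (induction n) (auto simp: L_cmult)

lemma Ln_diff: "(L g ^^ n) (\<lambda>x. \<phi> x - \<psi> x) = (\<lambda>x. (L g ^^ n) \<phi> x - (L g ^^ n) \<psi> x)"
  by (induction n) (auto simp: L_diff)

lemma Ln_mono:
  "(\<And>y. y \<in> S \<Longrightarrow> \<phi> y \<le> \<psi> y) \<Longrightarrow> x \<in> S \<Longrightarrow> (L g ^^ n) \<phi> x \<le> (L g ^^ n) \<psi> x"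
  by (induction n arbitrary: x) (auto intro!: L_mono)

lemma Ln_cong:
  "(\<And>y. y \<in> S \<Longrightarrow> \<phi> y = \<psi> y) \<Longrightarrow> x \<in> S \<Longrightarrow> (L g ^^ n) \<phi> x = (L g ^^ n) \<psi> x"
  by (induction n arbitrary: x) (auto intro!: L_cong)

lemma L_ge_term:
  assumes "\<And>y. y \<in> S \<Longrightarrow> \<phi> y \<ge> 0" "y \<in> S"
  shows "exp (g y) * \<phi> y \<le> L g \<phi> (shift y)"
proof -
  have "exp (g (scons (y 0) (shift y))) * \<phi> (scons (y 0) (shift y)) \<le> L g \<phi> (shift y)"
    unfolding transfer_eq
    using S_pred_letters[OF assms(2)] assms scons_pred_in_S[OF shift_in_S[OF assms(2)]]
    by (intro member_le_sum) auto
  then show ?thesis by simp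
qed

lemma L_nonneg: "(\<And>y. y \<in> S \<Longrightarrow> \<phi> y \<ge> 0) \<Longrightarrow> x \<in> S \<Longrightarrow> L g \<phi> x \<ge> 0"
  unfolding transfer_eq by (intro sum_nonneg mult_nonneg_nonneg) (auto intro: scons_pred_in_S)

lemma Ln_nonneg: "(\<And>y. y \<in> S \<Longrightarrow> \<phi> y \<ge> 0) \<Longrightarrow> x \<in> S \<Longrightarrow> (L g ^^ n) \<phi> x \<ge> 0"
  by (induction n arbitrary: x) (auto intro!: L_nonneg)

lemma Ln_ge_term:
  assumes "\<And>y. y \<in> S \<Longrightarrow> \<phi> y \<ge> 0" "y \<in> S"
  shows "exp (birkhoff g n y) * \<phi> y \<le> (L g ^^ n) \<phi> ((shift ^^ n) y)"
  using assms
proof (induction n arbitrary: \<phi> y)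
  case (Suc n)
  have "exp (birkhoff g (Suc n) y) * \<phi> y = exp (birkhoff g n (shift y)) * (exp (g y) * \<phi> y)"
    by (simp add: birkhoff_Suc exp_add)
  also have "\<dots> \<le> exp (birkhoff g n (shift y)) * L g \<phi> (shift y)"
    using Suc.prems by (intro mult_left_mono L_ge_term) auto
  also have "\<dots> \<le> (L g ^^ n) (L g \<phi>) ((shift ^^ n) (shift y))"
    using Suc.prems by (intro Suc.IH L_nonneg shift_in_S) auto
  finally show ?case by (simp add: funpow_swap1)
qed simp

end

subsection \<open>Contraction of the transfer operator\<close>

locale potential = sft K A p for K :: nat and A :: "nat \<Rightarrow> nat \<Rightarrow> nat" and p :: nat +
  fixes g :: "seq \<Rightarrow> real" and b \<alpha> :: real
  assumes \<alpha>: "0 < \<alpha>" "\<alpha> < 1"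
    and hol_g: "hol \<alpha> b g"
begin

lemma b_nonneg: "b \<ge> 0"
  using hol_g by (rule hol_nonneg)

text \<open>Multiplicative regularity is asked only of points with the same first letter
  (\<open>n \<ge> 1\<close>), because these have the same predecessors. Points with different first
  letters become comparable after \<open>p\<close> applications of \<open>L\<close>, in
  \<open>Lp_comparable\<close>.\<close>

definition cone :: "real \<Rightarrow> (seq \<Rightarrow> real) \<Rightarrow> bool" where
  "cone B \<phi> \<longleftrightarrow> (\<forall>x\<in>S. \<phi> x \<ge> 0) \<and>
     (\<forall>n\<ge>1. \<forall>x\<in>S. \<forall>y\<in>S. agree n x y \<longrightarrow> \<phi> x \<le> exp (B * \<alpha> ^ n) * \<phi> y)"

lemma coneI:
  "(\<And>x. x \<in> S \<Longrightarrow> \<phi> x \<ge> 0) \<Longrightarrow>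
   (\<And>n x y. n \<ge> 1 \<Longrightarrow> x \<in> S \<Longrightarrow> y \<in> S \<Longrightarrow> agree n x y \<Longrightarrow> \<phi> x \<le> exp (B * \<alpha> ^ n) * \<phi> y) \<Longrightarrow>
   cone B \<phi>"
  by (auto simp: cone_def)

lemma cone_nonneg: "cone B \<phi> \<Longrightarrow> x \<in> S \<Longrightarrow> \<phi> x \<ge> 0"
  by (auto simp: cone_def)

lemma coneD:
  "cone B \<phi> \<Longrightarrow> n \<ge> 1 \<Longrightarrow> x \<in> S \<Longrightarrow> y \<in> S \<Longrightarrow> agree n x y \<Longrightarrow> \<phi> x \<le> exp (B * \<alpha> ^ n) * \<phi> y"
  by (auto simp: cone_def)

lemma cone_mono:
  assumes "cone B \<phi>" "B \<le> B'"
  shows "cone B' \<phi>"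
proof (rule coneI)
  show "\<phi> x \<ge> 0" if "x \<in> S" for x using cone_nonneg[OF assms(1) that] .
  fix n x y assume h: "1 \<le> n" "x \<in> S" "y \<in> S" "agree n x y"
  have "\<phi> x \<le> exp (B * \<alpha> ^ n) * \<phi> y" using coneD[OF assms(1) h] .
  also have "\<dots> \<le> exp (B' * \<alpha> ^ n) * \<phi> y"
    using assms \<alpha> cone_nonneg[OF assms(1) h(3)] by (intro mult_right_mono) (auto intro!: mult_right_mono)
  finally show "\<phi> x \<le> exp (B' * \<alpha> ^ n) * \<phi> y" .
qed

lemma cone_const: "c \<ge> 0 \<Longrightarrow> B \<ge> 0 \<Longrightarrow> cone B (\<lambda>_. c)"
  using \<alpha> by (intro coneI) (auto intro!: mult_le_cancel_right1[THEN iffD2])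

text \<open>Prepending a letter lengthens the agreement by one, so the variation of \<open>g\<close>
  and that of \<phi> both gain a factor \<alpha>.\<close>

lemma L_cone_aux:
  assumes "cone B \<phi>"
  shows "cone (\<alpha> * (b + B)) (L g \<phi>)"
proof (rule coneI)
  show "L g \<phi> x \<ge> 0" if "x \<in> S" for x
    using L_nonneg[of \<phi> x g] cone_nonneg[OF assms] that by auto
  fix n x y assume h: "1 \<le> n" "x \<in> S" "y \<in> S" "agree n x y"
  have xy0: "x 0 = y 0" using h by (auto simp: agree_def)
  have "exp (g (scons a x)) * \<phi> (scons a x)
      \<le> exp (\<alpha> * (b + B) * \<alpha> ^ n) * (exp (g (scons a y)) * \<phi> (scons a y))"
    if a: "a \<in> pred_letters (y 0)" for a
  proof -
    have S: "scons a x \<in> S" "scons a y \<in> S"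
      using a h xy0 by (auto intro!: scons_pred_in_S)
    have "\<bar>g (scons a x) - g (scons a y)\<bar> \<le> b * \<alpha> ^ Suc n"
      using holD[OF hol_g S agree_scons[OF h(4)]] .
    then have "exp (g (scons a x)) \<le> exp (b * \<alpha> ^ Suc n) * exp (g (scons a y))"
      by (simp add: exp_add[symmetric])
    moreover have "\<phi> (scons a x) \<le> exp (B * \<alpha> ^ Suc n) * \<phi> (scons a y)"
      using coneD[OF assms _ S agree_scons[OF h(4)]] by simp
    ultimately have "exp (g (scons a x)) * \<phi> (scons a x)
       \<le> (exp (b * \<alpha> ^ Suc n) * exp (g (scons a y))) * (exp (B * \<alpha> ^ Suc n) * \<phi> (scons a y))"
      using cone_nonneg[OF assms] S by (intro mult_mono) auto
    also have "\<dots> = (exp (b * \<alpha> ^ Suc n) * exp (B * \<alpha> ^ Suc n)) * (exp (g (scons a y)) * \<phi> (scons a y))"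
      by (simp add: mult_ac)
    also have "exp (b * \<alpha> ^ Suc n) * exp (B * \<alpha> ^ Suc n) = exp (\<alpha> * (b + B) * \<alpha> ^ n)"
      by (simp add: exp_add[symmetric] algebra_simps)
    finally show ?thesis .
  qed
  then show "L g \<phi> x \<le> exp (\<alpha> * (b + B) * \<alpha> ^ n) * L g \<phi> y"
    unfolding transfer_eq xy0 sum_distrib_left by (intro sum_mono) auto
qed

text \<open>The number \<open>\<alpha> * b / (1 - \<alpha>)\<close> is the fixed point of the change
  of cone constant in \<open>L_cone_aux\<close>. Adding 1 to it makes the image strictly smaller:
  \<open>\<alpha> * (b + B)\<close> is \<open>B1\<close>, with the gap
  \<open>1 - \<alpha>\<close>.\<close>

definition B :: real where "B = \<alpha> * b / (1 - \<alpha>) + 1"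
definition B1 :: real where "B1 = B - (1 - \<alpha>)"

lemma B_bounds: "B \<ge> 1" "B1 \<ge> 0" "B1 \<le> B"
  using b_nonneg \<alpha> by (auto simp: B_def B1_def)

lemma L_cone: "cone B \<phi> \<Longrightarrow> cone B1 (L g \<phi>)"
proof -
  have "\<alpha> * (b + B) = B1"
    using \<alpha> by (simp add: B_def B1_def field_simps)
  then show "cone B \<phi> \<Longrightarrow> cone B1 (L g \<phi>)" using L_cone_aux[of B \<phi>] by simp
qed

lemma Ln_cone: "cone B \<phi> \<Longrightarrow> n \<ge> 1 \<Longrightarrow> cone B1 ((L g ^^ n) \<phi>)"
proof (induction n)
  case (Suc n)
  then show ?case
    using L_cone[of "(L g ^^ n) \<phi>"] cone_mono[of B1 "(L g ^^ n) \<phi>" B] B_bounds by (cases "n = 0") auto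
qed simp

lemma Ln_cone': "cone B \<phi> \<Longrightarrow> cone B ((L g ^^ n) \<phi>)"
  using Ln_cone[of \<phi> n] cone_mono[of B1 _ B] B_bounds by (cases "n = 0") auto

definition G :: real where "G = \<bar>g origin\<bar> + b"

lemma g_bound: "x \<in> S \<Longrightarrow> \<bar>g x\<bar> \<le> G"
  unfolding G_def by (rule hol_bounded[OF hol_g])

lemma birkhoff_g_bound: "x \<in> S \<Longrightarrow> \<bar>birkhoff g n x\<bar> \<le> real n * G"
proof (induction n arbitrary: x)
  case (Suc n)
  have "\<bar>birkhoff g (Suc n) x\<bar> \<le> \<bar>g x\<bar> + \<bar>birkhoff g n (shift x)\<bar>"
    by (simp add: birkhoff_Suc abs_triangle_ineq)
  then show ?case using g_bound[OF Suc.prems] Suc.IH[OF shift_in_S[OF Suc.prems]]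
    by (simp add: algebra_simps)
qed simp

lemma L_upper:
  assumes "\<And>x. x \<in> S \<Longrightarrow> \<phi> x \<le> m" "m \<ge> 0" "x \<in> S"
  shows "L g \<phi> x \<le> real K * exp G * m"
proof -
  have "L g \<phi> x \<le> (\<Sum>a\<in>pred_letters (x 0). exp G * m)"
    unfolding transfer_eq
  proof (rule sum_mono)
    fix a assume "a \<in> pred_letters (x 0)"
    then have s: "scons a x \<in> S" using assms(3) scons_pred_in_S by blast
    have "exp (g (scons a x)) * \<phi> (scons a x) \<le> exp (g (scons a x)) * m"
      using assms(1)[OF s] by (intro mult_left_mono) auto
    also have "\<dots> \<le> exp G * m"
      using g_bound[OF s] assms by (intro mult_right_mono) auto
    finally show "exp (g (scons a x)) * \<phi> (scons a x) \<le> exp G * m" .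
  qed
  also have "\<dots> = real (card (pred_letters (x 0))) * (exp G * m)" by simp
  also have "\<dots> \<le> real K * (exp G * m)"
    using card_pred_letters assms by (intro mult_right_mono) auto
  finally show ?thesis by (simp add: mult_ac)
qed

lemma Ln_upper:
  assumes "\<And>x. x \<in> S \<Longrightarrow> \<phi> x \<le> m" "m \<ge> 0" "x \<in> S"
  shows "(L g ^^ n) \<phi> x \<le> (real K * exp G) ^ n * m"
  using assms(3)
proof (induction n arbitrary: x)
  case (Suc n)
  show ?case
    using L_upper[of "(L g ^^ n) \<phi>" "(real K * exp G) ^ n * m" x] Suc assms by (simp add: mult_ac)
qed (use assms in auto)

definition c0 :: real where "c0 = exp (- real p * G - 2 * B) / (real K * exp G) ^ p"

lemma c0_pos: "c0 > 0"
  using K2 by (simp add: c0_def)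

text \<open>Let \<open>F\<close> be the largest value at the base points. All values of \<phi> are
  at most \<open>exp B * F\<close>, which bounds \<open>L^p \<phi>\<close> from above, with at most
  \<open>K\<close> branches per step. By primitivity every \<open>x\<close> has a p-th preimage that
  begins with the maximising letter, where \<phi> is at least \<open>exp (-B) * F\<close>. The
  quotient of the two bounds is \<open>c0\<close>.\<close>

lemma Lp_comparable:
  assumes c: "cone B \<phi>" and "x \<in> S" "y \<in> S"
  shows "c0 * (L g ^^ p) \<phi> y \<le> (L g ^^ p) \<phi> x"
proof -
  define F where "F = Max ((\<lambda>a. \<phi> (base_point a)) ` {1..K})"
  have fin: "finite ((\<lambda>a. \<phi> (base_point a)) ` {1..K})" "(\<lambda>a. \<phi> (base_point a)) ` {1..K} \<noteq> {}"
    using K2 by auto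
  obtain a where a: "a \<in> {1..K}" "F = \<phi> (base_point a)"
    using Max_in[OF fin] unfolding F_def by blast
  have F0: "F \<ge> 0" using a cone_nonneg[OF c base_point_in_S] by auto
  have expB: "exp (B * \<alpha> ^ 1) \<le> exp B" using \<alpha> B_bounds by (simp add: mult_left_le)
  have up: "\<phi> z \<le> exp B * F" if z: "z \<in> S" for z
  proof -
    have z0: "z 0 \<in> {1..K}" using S_letter[OF z] .
    have "\<phi> z \<le> exp (B * \<alpha> ^ 1) * \<phi> (base_point (z 0))"
      using z z0 by (intro coneD[OF c] base_point_in_S) (auto simp: agree_def)
    also have "\<dots> \<le> exp B * F"
      using z0 fin expB cone_nonneg[OF c base_point_in_S[OF z0]]
      unfolding F_def by (intro mult_mono Max_ge) auto
    finally show ?thesis .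
  qed
  have "(L g ^^ p) \<phi> y \<le> (real K * exp G) ^ p * (exp B * F)"
    using up F0 assms by (intro Ln_upper) auto
  then have 1: "c0 * (L g ^^ p) \<phi> y \<le> c0 * ((real K * exp G) ^ p * (exp B * F))"
    using c0_pos by (intro mult_left_mono) auto
  also have "\<dots> = exp (- real p * G - 2 * B) * (exp B * F)"
    using K2 by (simp add: c0_def)
  also have "\<dots> = exp (- real p * G) * (exp (-B) * F)"
    by (simp add: exp_diff exp_minus field_simps power2_eq_square exp_double)
  also have "\<dots> \<le> (L g ^^ p) \<phi> x"
  proof -
    obtain z where z: "z \<in> S" "z 0 = a" "(shift ^^ p) z = x"
      using preimage_exists[OF a(1) assms(2)] by auto
    have "F \<le> exp (B * \<alpha> ^ 1) * \<phi> z"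
      unfolding a(2) using z a by (intro coneD[OF c] base_point_in_S) (auto simp: agree_def)
    also have "\<dots> \<le> exp B * \<phi> z"
      using expB cone_nonneg[OF c z(1)] by (intro mult_right_mono) auto
    finally have "exp (-B) * F \<le> \<phi> z" by (simp add: exp_minus field_simps)
    moreover have "exp (- real p * G) \<le> exp (birkhoff g p z)"
      using birkhoff_g_bound[OF z(1), of p] by auto
    ultimately have "exp (- real p * G) * (exp (-B) * F) \<le> exp (birkhoff g p z) * \<phi> z"
      using F0 by (intro mult_mono) auto
    also have "\<dots> \<le> (L g ^^ p) \<phi> ((shift ^^ p) z)"
      by (intro Ln_ge_term cone_nonneg[OF c] z)
    finally show ?thesis using z by simp
  qed
  finally show ?thesis .
qed

definition \<eta>0 :: real where "\<eta>0 = (1 - \<alpha>) / (2 * B * exp B)"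

lemma \<eta>0_bounds: "0 < \<eta>0" "\<eta>0 \<le> 1"
proof -
  show "0 < \<eta>0" using \<alpha> B_bounds by (simp add: \<eta>0_def)
  have "exp B \<ge> 1" using B_bounds by simp
  then have "2 * B * exp B \<ge> 1 * 1" using B_bounds by (intro mult_mono) auto
  then show "\<eta>0 \<le> 1" using \<alpha> by (simp add: \<eta>0_def)
qed

text \<open>Both differences are of order \<open>d\<close>: the left one is at most
  \<open>2 * B * exp B * d\<close>, the right one at least \<open>(B - B1) * d\<close>. As
  \<open>B - B1\<close> is \<open>1 - \<alpha>\<close>, the quotient of these constants is
  \<open>\<eta>0\<close>.\<close>

lemma exp_gap:
  assumes "0 < d" "d \<le> 1"
  shows "\<eta>0 * (exp (B * d) - exp (- B1 * d)) \<le> exp (B * d) - exp (B1 * d)"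
proof -
  have "exp (B * d) - exp (- B1 * d) = exp (B * d) * (1 - exp (- ((B + B1) * d)))"
    by (simp add: algebra_simps exp_add[symmetric])
  also have "\<dots> \<le> exp B * ((B + B1) * d)"
  proof (rule mult_mono)
    show "exp (B * d) \<le> exp B" using assms B_bounds by (simp add: mult_left_le)
    show "1 - exp (- ((B + B1) * d)) \<le> (B + B1) * d"
      using exp_ge_add_one_self[of "- ((B + B1) * d)"] by simp
    have "(B + B1) * d \<ge> 0" using assms B_bounds by simp
    then show "0 \<le> 1 - exp (- ((B + B1) * d))" by simp
  qed simp
  also have "\<dots> \<le> exp B * ((2 * B) * d)"
    using assms B_bounds by (intro mult_left_mono mult_right_mono) auto
  finally have "\<eta>0 * (exp (B * d) - exp (- B1 * d)) \<le> \<eta>0 * (exp B * ((2 * B) * d))"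
    using \<eta>0_bounds by (intro mult_left_mono) auto
  also have "\<dots> = (B - B1) * d"
    using B_bounds by (simp add: \<eta>0_def B1_def)
  also have "\<dots> \<le> exp (B1 * d) * ((B - B1) * d)"
  proof -
    have "(B - B1) * d \<ge> 0" "exp (B1 * d) \<ge> 1" using assms B_bounds by auto
    then show ?thesis using mult_right_mono[of 1 "exp (B1 * d)" "(B - B1) * d"] by simp
  qed
  also have "\<dots> \<le> exp (B1 * d) * (exp ((B - B1) * d) - 1)"
  proof (rule mult_left_mono)
    show "(B - B1) * d \<le> exp ((B - B1) * d) - 1"
      using exp_ge_add_one_self[of "(B - B1) * d"] by linarith
  qed simp
  also have "\<dots> = exp (B * d) - exp (B1 * d)"
    by (simp add: algebra_simps exp_add[symmetric])
  finally show ?thesis .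
qed

text \<open>The strict inclusion of the cone for \<open>B1\<close> in the cone for \<open>B\<close>
  leaves room for a subtraction. In the worst case \<open>u\<close> varies by its full factor
  upwards and \<open>v\<close> by its full factor downwards, and \<open>exp_gap\<close> covers this
  case.\<close>

lemma cone_subtract:
  assumes u: "cone B1 u" and v: "cone B1 v" and t: "t \<ge> 0"
    and le: "\<And>y. y \<in> S \<Longrightarrow> t * v y \<le> \<eta>0 * u y"
  shows "cone B (\<lambda>x. u x - t * v x)"
proof (rule coneI)
  fix x assume x: "x \<in> S"
  have "\<eta>0 * u x \<le> 1 * u x" using \<eta>0_bounds cone_nonneg[OF u x] by (intro mult_right_mono) auto
  then show "0 \<le> u x - t * v x" using le[OF x] by simp
next
  fix n x y assume h: "1 \<le> n" "x \<in> S" "y \<in> S" "agree n x y"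
  define d where "d = \<alpha> ^ n"
  have d: "0 < d" "d \<le> 1" using \<alpha> by (auto simp: d_def power_le_one)
  have ux: "u x \<le> exp (B1 * d) * u y" unfolding d_def by (rule coneD[OF u h])
  have "v y \<le> exp (B1 * d) * v x" unfolding d_def using coneD[OF v h(1,3,2) agree_sym[OF h(4)]] .
  then have vx: "exp (- B1 * d) * v y \<le> v x" by (simp add: exp_minus field_simps)
  have ineq: "t * v y * (exp (B * d) - exp (- B1 * d)) \<le> u y * (exp (B * d) - exp (B1 * d))"
  proof -
    have pos: "exp (B * d) - exp (- B1 * d) \<ge> 0"
    proof -
      have "0 \<le> B * d" "0 \<le> B1 * d" using d B_bounds by auto
      then have "- B1 * d \<le> B * d" by simp
      then show ?thesis by simp
    qed
    have "t * v y * (exp (B * d) - exp (- B1 * d)) \<le> \<eta>0 * u y * (exp (B * d) - exp (- B1 * d))"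
      using le[OF h(3)] pos by (intro mult_right_mono)
    also have "\<dots> = u y * (\<eta>0 * (exp (B * d) - exp (- B1 * d)))" by (simp add: mult_ac)
    also have "\<dots> \<le> u y * (exp (B * d) - exp (B1 * d))"
      using exp_gap[OF d] cone_nonneg[OF u h(3)] by (intro mult_left_mono) auto
    finally show ?thesis .
  qed
  have "t * (exp (- B1 * d) * v y) \<le> t * v x" using vx t by (intro mult_left_mono) auto
  then have "u x - t * v x \<le> exp (B1 * d) * u y - t * (exp (- B1 * d) * v y)" using ux by linarith
  also have "\<dots> \<le> exp (B * d) * (u y - t * v y)" using ineq by (simp add: algebra_simps)
  finally show "u x - t * v x \<le> exp (B * \<alpha> ^ n) * (u y - t * v y)" unfolding d_def .
qed

text \<open>One factor \<open>c0\<close> comes from comparing the image of \<psi> with its value at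
  the origin, the other from doing the same for the image of \<open>u\<close>, and the 2 from
  carrying half of the mass there. The cap \<open>1/2\<close> keeps \<open>1 - \<delta>\<close>
  positive.\<close>

definition \<delta> :: real where "\<delta> = min (1/2) (\<eta>0 * c0\<^sup>2 / 2)"

lemma \<delta>_bounds: "0 < \<delta>" "\<delta> \<le> 1/2" "\<delta> \<le> \<eta>0 * c0\<^sup>2 / 2"
  using \<eta>0_bounds c0_pos by (auto simp: \<delta>_def)

lemma contraction_half:
  assumes u: "cone B u" and \<psi>: "cone B \<psi>" and T: "T \<ge> 0"
    and o: "T * (L g ^^ p) \<psi> origin / 2 \<le> (L g ^^ p) u origin"
  shows "cone B (\<lambda>x. (L g ^^ p) u x - \<delta> * T * (L g ^^ p) \<psi> x)"
proof (rule cone_subtract)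
  show "cone B1 ((L g ^^ p) u)" "cone B1 ((L g ^^ p) \<psi>)"
    using Ln_cone u \<psi> p_pos by auto
  show "0 \<le> \<delta> * T" using \<delta>_bounds T by simp
  fix y assume y: "y \<in> S"
  define L\<psi> where "L\<psi> = (L g ^^ p) \<psi> y"
  define L\<psi>o where "L\<psi>o = (L g ^^ p) \<psi> origin"
  define Lu where "Lu = (L g ^^ p) u y"
  define Luo where "Luo = (L g ^^ p) u origin"
  have 1: "c0 * L\<psi> \<le> L\<psi>o" "c0 * Luo \<le> Lu"
    using Lp_comparable[OF \<psi> origin_in_S y] Lp_comparable[OF u y origin_in_S]
    by (auto simp: L\<psi>_def L\<psi>o_def Lu_def Luo_def)
  have nn: "L\<psi> \<ge> 0" "Lu \<ge> 0"
    unfolding L\<psi>_def Lu_def by (auto intro!: Ln_nonneg y cone_nonneg[OF u] cone_nonneg[OF \<psi>])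
  have "\<delta> * T * L\<psi> \<le> (\<eta>0 * c0\<^sup>2 / 2) * T * L\<psi>"
    using \<delta>_bounds T nn by (intro mult_right_mono) auto
  also have "\<dots> = \<eta>0 * c0 * (T / 2 * (c0 * L\<psi>))" by (simp add: power2_eq_square)
  also have "\<dots> \<le> \<eta>0 * c0 * (T / 2 * L\<psi>o)"
    using 1 T \<eta>0_bounds c0_pos by (intro mult_left_mono) auto
  also have "\<dots> \<le> \<eta>0 * c0 * Luo"
    using o \<eta>0_bounds c0_pos unfolding L\<psi>o_def Luo_def by (intro mult_left_mono) auto
  also have "\<dots> \<le> \<eta>0 * Lu"
    using 1 \<eta>0_bounds unfolding mult.assoc by (intro mult_left_mono) auto
  finally show "\<delta> * T * (L g ^^ p) \<psi> y \<le> \<eta>0 * (L g ^^ p) u y"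
    by (simp add: L\<psi>_def Lu_def)
qed

text \<open>Of the two differences at least one carries half of the mass at the origin, and subtracting
  a multiple of \<^term>\<open>\<psi>\<close> from that one does not leave the cone.\<close>

lemma contraction:
  assumes lo: "cone B (\<lambda>x. \<phi> x - s * \<psi> x)" and up: "cone B (\<lambda>x. r * \<psi> x - \<phi> x)"
    and \<psi>: "cone B \<psi>" and "s \<le> r"
  shows "\<exists>s' r'. s \<le> s' \<and> s' \<le> r' \<and> r' \<le> r \<and> r' - s' = (1 - \<delta>) * (r - s) \<and>
    cone B (\<lambda>x. (L g ^^ p) \<phi> x - s' * (L g ^^ p) \<psi> x) \<and>
    cone B (\<lambda>x. r' * (L g ^^ p) \<psi> x - (L g ^^ p) \<phi> x)"
proof -
  define T where "T = r - s"
  have T: "T \<ge> 0" using assms by (simp add: T_def)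
  have dT: "0 \<le> \<delta> * T" "\<delta> * T \<le> T" using T \<delta>_bounds by (auto simp: mult_left_le_one_le)
  define u where "u = (\<lambda>x. \<phi> x - s * \<psi> x)"
  define v where "v = (\<lambda>x. r * \<psi> x - \<phi> x)"
  have Lu: "(L g ^^ p) u = (\<lambda>x. (L g ^^ p) \<phi> x - s * (L g ^^ p) \<psi> x)"
    and Lv: "(L g ^^ p) v = (\<lambda>x. r * (L g ^^ p) \<psi> x - (L g ^^ p) \<phi> x)"
    by (simp_all add: u_def v_def Ln_diff Ln_cmult)
  have cu: "cone B ((L g ^^ p) u)" and cv: "cone B ((L g ^^ p) v)"
    using lo up Ln_cone' by (auto simp: u_def v_def)
  have "(L g ^^ p) u origin + (L g ^^ p) v origin = T * (L g ^^ p) \<psi> origin"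
    by (simp add: Lu Lv T_def algebra_simps)
  then consider "T * (L g ^^ p) \<psi> origin / 2 \<le> (L g ^^ p) u origin"
    | "T * (L g ^^ p) \<psi> origin / 2 \<le> (L g ^^ p) v origin" by linarith
  then show ?thesis
  proof cases
    case 1
    have "cone B (\<lambda>x. (L g ^^ p) u x - \<delta> * T * (L g ^^ p) \<psi> x)"
      using lo by (intro contraction_half[OF _ \<psi> T 1]) (simp add: u_def)
    then have "cone B (\<lambda>x. (L g ^^ p) \<phi> x - (s + \<delta> * T) * (L g ^^ p) \<psi> x)"
      by (simp add: Lu algebra_simps)
    then show ?thesis using cv dT
      by (rule_tac exI[of _ "s + \<delta> * T"], rule_tac exI[of _ r]) (auto simp: Lv T_def algebra_simps)
  next
    case 2
    have "cone B (\<lambda>x. (L g ^^ p) v x - \<delta> * T * (L g ^^ p) \<psi> x)"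
      using up by (intro contraction_half[OF _ \<psi> T 2]) (simp add: v_def)
    then have "cone B (\<lambda>x. (r - \<delta> * T) * (L g ^^ p) \<psi> x - (L g ^^ p) \<phi> x)"
      by (simp add: Lv algebra_simps)
    then show ?thesis using cu dT
      by (rule_tac exI[of _ s], rule_tac exI[of _ "r - \<delta> * T"]) (auto simp: Lu T_def algebra_simps)
  qed
qed

lemma contraction_iterate:
  assumes lo: "cone B (\<lambda>x. \<phi> x - s * \<psi> x)" and up: "cone B (\<lambda>x. r * \<psi> x - \<phi> x)"
    and \<psi>: "cone B \<psi>" and "s \<le> r"
  shows "\<exists>s' r'. s \<le> s' \<and> s' \<le> r' \<and> r' \<le> r \<and> r' - s' = (1 - \<delta>) ^ k * (r - s) \<and>
    cone B (\<lambda>x. (L g ^^ (k * p)) \<phi> x - s' * (L g ^^ (k * p)) \<psi> x) \<and>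
    cone B (\<lambda>x. r' * (L g ^^ (k * p)) \<psi> x - (L g ^^ (k * p)) \<phi> x)"
proof (induction k)
  case 0
  then show ?case using assms by auto
next
  case (Suc k)
  then obtain s' r' where h: "s \<le> s'" "s' \<le> r'" "r' \<le> r" "r' - s' = (1 - \<delta>) ^ k * (r - s)"
    and c: "cone B (\<lambda>x. (L g ^^ (k * p)) \<phi> x - s' * (L g ^^ (k * p)) \<psi> x)"
    "cone B (\<lambda>x. r' * (L g ^^ (k * p)) \<psi> x - (L g ^^ (k * p)) \<phi> x)" by blast
  from contraction[OF c Ln_cone'[OF \<psi>] h(2)] obtain s2 r2 where
    h': "s' \<le> s2" "s2 \<le> r2" "r2 \<le> r'" "r2 - s2 = (1 - \<delta>) * (r' - s')"
    and c': "cone B (\<lambda>x. (L g ^^ p) ((L g ^^ (k * p)) \<phi>) x - s2 * (L g ^^ p) ((L g ^^ (k * p)) \<psi>) x)"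
    "cone B (\<lambda>x. r2 * (L g ^^ p) ((L g ^^ (k * p)) \<psi>) x - (L g ^^ p) ((L g ^^ (k * p)) \<phi>) x)"
    by blast
  have e: "(L g ^^ p) ((L g ^^ (k * p)) \<xi>) = (L g ^^ (Suc k * p)) \<xi>" for \<xi>
    by (simp add: funpow_add)
  show ?case
  proof (rule exI[of _ s2], rule exI[of _ r2], intro conjI)
    show "s \<le> s2" "s2 \<le> r2" "r2 \<le> r" using h h' by linarith+
    show "r2 - s2 = (1 - \<delta>) ^ Suc k * (r - s)" using h h' by simp
    show "cone B (\<lambda>x. (L g ^^ (Suc k * p)) \<phi> x - s2 * (L g ^^ (Suc k * p)) \<psi> x)"
      "cone B (\<lambda>x. r2 * (L g ^^ (Suc k * p)) \<psi> x - (L g ^^ (Suc k * p)) \<phi> x)"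
      using c' unfolding e by auto
  qed
qed

text \<open>Once a Hoelder function is raised above \<open>C / B\<close>, its additive modulus
  \<open>C * \<alpha> ^ n\<close> is at most \<open>B * \<alpha> ^ n\<close> times its value, and
  \<open>1 + t \<le> exp t\<close> turns this into the cone inequality.\<close>

lemma hol_sandwich:
  assumes h: "hol \<alpha> C \<phi>"
  shows "\<exists>R\<ge>0. cone B (\<lambda>x. \<phi> x - (- R)) \<and> cone B (\<lambda>x. R - \<phi> x)"
proof -
  have C: "C \<ge> 0" using hol_nonneg[OF h] .
  define R where "R = \<bar>\<phi> origin\<bar> + C + C / B"
  have R0: "R \<ge> 0" using C B_bounds by (simp add: R_def)
  have key: "cone B \<xi>" if c: "\<And>n x y. x \<in> S \<Longrightarrow> y \<in> S \<Longrightarrow> agree n x y \<Longrightarrow> \<xi> x \<le> \<xi> y + C * \<alpha> ^ n"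
    and lb: "\<And>x. x \<in> S \<Longrightarrow> C / B \<le> \<xi> x" for \<xi>
  proof (rule coneI)
    show "0 \<le> \<xi> x" if "x \<in> S" for x
      using lb[OF that] C B_bounds by (smt (verit) divide_nonneg_nonneg)
    fix n x y assume xy: "1 \<le> n" "x \<in> S" "y \<in> S" "agree n x y"
    have "C \<le> B * \<xi> y" using lb[OF xy(3)] B_bounds by (simp add: field_simps)
    then have "C * \<alpha> ^ n \<le> B * \<xi> y * \<alpha> ^ n" using \<alpha> by (intro mult_right_mono) auto
    then have "\<xi> x \<le> (1 + B * \<alpha> ^ n) * \<xi> y" using c[OF xy(2-4)] by (simp add: algebra_simps)
    also have "\<dots> \<le> exp (B * \<alpha> ^ n) * \<xi> y"
    proof (rule mult_right_mono)
      have "0 \<le> C / B" using C B_bounds by simp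
      then show "0 \<le> \<xi> y" using lb[OF xy(3)] by linarith
    qed (rule exp_ge_add_one_self)
    finally show "\<xi> x \<le> exp (B * \<alpha> ^ n) * \<xi> y" .
  qed
  have "cone B (\<lambda>x. \<phi> x - (- R))"
  proof (rule key)
    fix x assume "x \<in> S"
    then show "C / B \<le> \<phi> x - (- R)" using hol_bounded[OF h, of x] by (auto simp: R_def)
  next
    fix n x y assume "x \<in> S" "y \<in> S" "agree n x y"
    then show "\<phi> x - (- R) \<le> \<phi> y - (- R) + C * \<alpha> ^ n" using holD[OF h, of x y n] by auto
  qed
  moreover have "cone B (\<lambda>x. R - \<phi> x)"
  proof (rule key)
    fix x assume "x \<in> S"
    then show "C / B \<le> R - \<phi> x" using hol_bounded[OF h, of x] by (auto simp: R_def)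
  next
    fix n x y assume "x \<in> S" "y \<in> S" "agree n x y"
    then show "R - \<phi> x \<le> R - \<phi> y + C * \<alpha> ^ n" using holD[OF h, of x y n] by auto
  qed
  ultimately show ?thesis using R0 by blast
qed

text \<open>The way back from the multiplicative to the additive modulus. For \<open>n = 0\<close>,
  where the cone imposes nothing, \<open>0 \<le> \<phi> \<le> m\<close> suffices.\<close>

lemma cone_oscillation:
  assumes c: "cone B \<phi>" and m: "\<And>x. x \<in> S \<Longrightarrow> \<phi> x \<le> m" and "m \<ge> 0"
    and "x \<in> S" "y \<in> S" "agree n x y"
  shows "\<bar>\<phi> x - \<phi> y\<bar> \<le> m * exp B * B * \<alpha> ^ n"
proof -
  have main: "\<phi> x - \<phi> y \<le> m * exp B * B * \<alpha> ^ n" if xy: "x \<in> S" "y \<in> S" "agree n x y" for x y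
  proof (cases "n = 0")
    case True
    have "\<phi> x - \<phi> y \<le> m" using m[OF xy(1)] cone_nonneg[OF c xy(2)] by simp
    also have "m * 1 \<le> m * (exp B * B)"
      using \<open>m \<ge> 0\<close> B_bounds mult_mono[of 1 "exp B" 1 B] by (intro mult_left_mono) auto
    finally show ?thesis using True by (simp add: mult.assoc)
  next
    case False
    define d where "d = B * \<alpha> ^ n"
    have d: "0 \<le> d" "d \<le> B" using \<alpha> B_bounds by (auto simp: d_def mult_left_le power_le_one)
    have "exp d - 1 = exp d * (1 - exp (- d))" by (simp add: algebra_simps exp_minus_inverse)
    also have "\<dots> \<le> exp B * d"
      using d exp_ge_add_one_self[of "- d"] by (intro mult_mono) auto
    finally have e: "exp d - 1 \<le> exp B * d" .
    have "\<phi> x - \<phi> y \<le> exp d * \<phi> y - \<phi> y"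
      using coneD[OF c _ xy] False by (simp add: d_def)
    also have "\<dots> = (exp d - 1) * \<phi> y" by (simp add: algebra_simps)
    also have "\<dots> \<le> (exp B * d) * m"
      using e m[OF xy(2)] cone_nonneg[OF c xy(2)] d by (intro mult_mono) auto
    finally show ?thesis by (simp add: d_def mult_ac)
  qed
  show ?thesis
    using main[OF assms(4,5,6)] main[OF assms(5,4) agree_sym[OF assms(6)]] by (simp add: abs_le_iff)
qed

end

subsection \<open>The positive eigenfunction\<close>

text \<open>One interval serves all later times and all points at once; hence the limit does not
  depend on the point.\<close>

lemma limit_of_shrinking_intervals:
  fixes q :: "nat \<Rightarrow> 'a \<Rightarrow> real"
  assumes \<gamma>: "0 < \<gamma>" "\<gamma> < 1" and "z \<in> X"
    and int: "\<And>n. \<exists>s r. r - s \<le> D * \<gamma> ^ n \<and> (\<forall>m\<ge>n. \<forall>x\<in>X. s \<le> q m x \<and> q m x \<le> r)"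
  shows "\<exists>c. \<forall>n. \<forall>x\<in>X. \<bar>q n x - c\<bar> \<le> D * \<gamma> ^ n"
proof -
  have lim0: "(\<lambda>n. D * \<gamma> ^ n) \<longlonglongrightarrow> 0"
    using \<gamma>(1,2) by (rule geometric_null)
  have close: "\<bar>q m x - q m' y\<bar> \<le> D * \<gamma> ^ n"
    if h: "n \<le> m" "n \<le> m'" "x \<in> X" "y \<in> X" for n m m' x y
  proof -
    obtain s r where "r - s \<le> D * \<gamma> ^ n" "s \<le> q m x" "q m x \<le> r" "s \<le> q m' y" "q m' y \<le> r"
      using int[of n] h by blast
    then show ?thesis by linarith
  qed
  have "Cauchy (\<lambda>n. q n z)"
  proof (rule CauchyI)
    fix e :: real assume "e > 0"
    then have "eventually (\<lambda>n. D * \<gamma> ^ n < e) sequentially"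
      using lim0 by (intro order_tendstoD(2)) auto
    then obtain N where "D * \<gamma> ^ N < e" by (auto simp: eventually_sequentially)
    then have "\<forall>m\<ge>N. \<forall>n\<ge>N. norm (q m z - q n z) < e"
      using close[of N _ _ z z] \<open>z \<in> X\<close> by (auto intro: le_less_trans)
    then show "\<exists>M. \<forall>m\<ge>M. \<forall>n\<ge>M. norm (q m z - q n z) < e" by blast
  qed
  then obtain c where c: "(\<lambda>n. q n z) \<longlonglongrightarrow> c"
    using Cauchy_convergent convergent_def by blast
  have "\<bar>q n x - c\<bar> \<le> D * \<gamma> ^ n" if "x \<in> X" for n x
  proof -
    have "(\<lambda>m. \<bar>q n x - q m z\<bar>) \<longlonglongrightarrow> \<bar>q n x - c\<bar>"
      by (intro tendsto_intros c)
    then show ?thesis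
      using close[of n n _ x z] that \<open>z \<in> X\<close> by (intro LIMSEQ_le_const2) auto
  qed
  then show ?thesis by blast
qed

text \<open>Contraction once in \<open>p\<close> steps is geometric in the single step, at the rate
  of the p-th root; \<open>1 / \<beta>\<close> pays for the incomplete last block.\<close>

lemma power_div_le_geometric:
  fixes \<beta> :: real and p :: nat
  assumes "0 < \<beta>" "\<beta> < 1" "p \<ge> 1"
  shows "\<exists>\<gamma> D. 0 < \<gamma> \<and> \<gamma> < 1 \<and> D \<ge> 0 \<and> (\<forall>n. \<beta> ^ (n div p) \<le> D * \<gamma> ^ n)"
proof -
  define \<gamma> where "\<gamma> = root p \<beta>"
  have \<gamma>: "0 < \<gamma>" "\<gamma> < 1" "\<gamma> ^ p = \<beta>"
    using assms by (auto simp: \<gamma>_def real_root_pow_pos2)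
  have "\<beta> ^ (n div p) \<le> (1 / \<beta>) * \<gamma> ^ n" for n
  proof -
    have "n < p * (n div p) + p" using assms by (metis add.commute dividend_less_times_div gr0I mult.commute not_one_le_zero)
    then have "\<gamma> ^ (p * (n div p) + p) \<le> \<gamma> ^ n" using \<gamma> by (intro power_decreasing) auto
    then have "\<beta> ^ (n div p) * \<beta> \<le> \<gamma> ^ n" using \<gamma> by (simp add: power_add power_mult)
    then show ?thesis using assms by (simp add: field_simps)
  qed
  then show ?thesis using \<gamma> assms by (intro exI[of _ \<gamma>] exI[of _ "1 / \<beta>"]) auto
qed

context potential
begin

definition ones :: "nat \<Rightarrow> seq \<Rightarrow> real" where
  "ones n = (L g ^^ n) (\<lambda>_. 1)"

lemma ones_0 [simp]: "ones 0 x = 1"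
  by (simp add: ones_def)

lemma ones_Suc: "ones (Suc n) = L g (ones n)"
  by (simp add: ones_def)

lemma Ln_ones: "(L g ^^ n) (ones m) = ones (n + m)"
  by (simp add: ones_def funpow_add)

lemma cone_ones: "cone B (ones n)"
  unfolding ones_def using B_bounds by (intro Ln_cone' cone_const) auto

lemma L_lower:
  assumes "\<And>y. y \<in> S \<Longrightarrow> m \<le> \<phi> y" "m \<ge> 0" "x \<in> S"
  shows "exp (- G) * m \<le> L g \<phi> x"
proof -
  obtain a where a: "a \<in> pred_letters (x 0)" using pred_letters_nonempty[OF assms(3)] by blast
  define y where "y = scons a x"
  have y: "y \<in> S" "shift y = x" unfolding y_def using scons_pred_in_S[OF assms(3) a] by auto
  have "exp (- G) * m \<le> exp (g y) * \<phi> y"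
    using g_bound[OF y(1)] assms y by (intro mult_mono) auto
  also have "\<dots> \<le> L g \<phi> (shift y)"
    using assms y by (intro L_ge_term) (auto intro: order_trans)
  finally show ?thesis using y by simp
qed

lemma ones_pos: "x \<in> S \<Longrightarrow> ones n x > 0"
proof -
  have "x \<in> S \<Longrightarrow> exp (- G) ^ n \<le> ones n x"
  proof (induction n arbitrary: x)
    case (Suc n)
    then show ?case using L_lower[of "exp (- G) ^ n" "ones n" x] by (simp add: ones_Suc)
  qed simp
  moreover have "0 < exp (- G) ^ n" by simp
  ultimately show "x \<in> S \<Longrightarrow> ones n x > 0" by linarith
qed

lemma ratio_lower: "x \<in> S \<Longrightarrow> exp (- G) * ones n x \<le> ones (Suc n) x"
proof (induction n arbitrary: x)
  case 0
  then show ?case using L_lower[of 1 "ones 0" x] by (simp add: ones_Suc)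
next
  case (Suc n)
  have "exp (- G) * ones (Suc n) x = L g (\<lambda>x. exp (- G) * ones n x) x"
    by (simp add: L_cmult ones_Suc)
  also have "\<dots> \<le> L g (ones (Suc n)) x"
    using Suc by (intro L_mono) auto
  finally show ?case by (simp add: ones_Suc)
qed

text \<open>The numbers \<open>s\<close> and \<open>r\<close> bracket the quotient of
  \<open>L^m \<phi>\<close> and \<open>ones m\<close>. A bracket found at time \<open>n\<close>
  holds at all later times because \<open>L\<close> preserves the cone, and the contraction shortens
  it once in every \<open>p\<close> steps.\<close>

lemma shrinking_cone_intervals:
  assumes h: "hol \<alpha> C \<phi>"
  shows "\<exists>R\<ge>0. \<forall>n. \<exists>s r. s \<le> r \<and> r - s \<le> R * (1 - \<delta>) ^ (n div p) \<and>
    (\<forall>m\<ge>n. cone B (\<lambda>x. (L g ^^ m) \<phi> x - s * ones m x) \<and>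
            cone B (\<lambda>x. r * ones m x - (L g ^^ m) \<phi> x))"
proof -
  obtain R where R: "R \<ge> 0" "cone B (\<lambda>x. \<phi> x - (- R))" "cone B (\<lambda>x. R - \<phi> x)"
    using hol_sandwich[OF h] by blast
  have R': "cone B (\<lambda>x. \<phi> x - (- R) * ones 0 x)" "cone B (\<lambda>x. R * ones 0 x - \<phi> x)"
    using R by simp_all
  have "\<exists>s r. s \<le> r \<and> r - s \<le> 2 * R * (1 - \<delta>) ^ (n div p) \<and>
    (\<forall>m\<ge>n. cone B (\<lambda>x. (L g ^^ m) \<phi> x - s * ones m x) \<and>
            cone B (\<lambda>x. r * ones m x - (L g ^^ m) \<phi> x))" for n
  proof -
    define k where "k = n div p"
    obtain s r where sr: "s \<le> r" "r - s = (1 - \<delta>) ^ k * (R - (- R))"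
      and c: "cone B (\<lambda>x. (L g ^^ (k * p)) \<phi> x - s * (L g ^^ (k * p)) (ones 0) x)"
      "cone B (\<lambda>x. r * (L g ^^ (k * p)) (ones 0) x - (L g ^^ (k * p)) \<phi> x)"
      using contraction_iterate[OF R' cone_ones, of k] R(1) by auto
    have "cone B (\<lambda>x. (L g ^^ m) \<phi> x - s * ones m x) \<and>
          cone B (\<lambda>x. r * ones m x - (L g ^^ m) \<phi> x)" if m: "m \<ge> n" for m
    proof -
      have "k * p \<le> m" using m unfolding k_def
        by (metis div_times_less_eq_dividend order_trans)
      then obtain j where j: "m = j + k * p" by (metis le_add_diff_inverse2)
      show ?thesis
        using Ln_cone'[OF c(1), of j] Ln_cone'[OF c(2), of j]
        by (simp add: j funpow_add Ln_diff Ln_cmult Ln_ones)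
    qed
    moreover have "r - s \<le> 2 * R * (1 - \<delta>) ^ k" using sr by (simp add: mult_ac)
    ultimately show ?thesis using sr unfolding k_def by blast
  qed
  then show ?thesis using R(1) by (intro exI[of _ "2 * R"]) auto
qed

lemma \<delta>_geometric:
  "\<exists>\<gamma> D. 0 < \<gamma> \<and> \<gamma> < 1 \<and> D \<ge> 0 \<and> (\<forall>n. (1 - \<delta>) ^ (n div p) \<le> D * \<gamma> ^ n)"
  using \<delta>_bounds p_pos by (intro power_div_le_geometric) auto

text \<open>Obtained through the cone: \<phi> raised by a constant lies in it, \<open>L\<close>
  keeps it there, and bounded members of the cone are Hoelder. The constant is removed again by
  linearity.\<close>

lemma hol_L:
  assumes h: "hol \<alpha> C \<phi>"
  shows "\<exists>D. hol \<alpha> D (L g \<phi>)"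
proof -
  obtain R where R: "R \<ge> 0" "cone B (\<lambda>x. \<phi> x - (- R))" "cone B (\<lambda>x. R - \<phi> x)"
    using hol_sandwich[OF h] by blast
  have hol1: "\<exists>D. hol \<alpha> D (L g \<psi>)" if c: "cone B \<psi>" and m: "\<And>x. x \<in> S \<Longrightarrow> \<psi> x \<le> m" "m \<ge> 0" for \<psi> m
  proof -
    have cL: "cone B (L g \<psi>)" using Ln_cone'[OF c, of 1] by simp
    have "hol \<alpha> (real K * exp G * m * exp B * B) (L g \<psi>)"
    proof (rule holI)
      show "0 \<le> real K * exp G * m * exp B * B" using m B_bounds by simp
      fix n x y assume "x \<in> S" "y \<in> S" "agree n x y"
      then show "\<bar>L g \<psi> x - L g \<psi> y\<bar> \<le> real K * exp G * m * exp B * B * \<alpha> ^ n"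
        using m by (intro cone_oscillation[OF cL]) (auto intro: L_upper)
    qed
    then show ?thesis by (rule exI)
  qed
  have "\<phi> x \<le> R" if "x \<in> S" for x using cone_nonneg[OF R(3) that] by simp
  then obtain D1 where 1: "hol \<alpha> D1 (L g (\<lambda>x. \<phi> x - (- R)))"
    using hol1[OF R(2), of "2 * R"] R(1) by force
  obtain D2 where 2: "hol \<alpha> D2 (L g (\<lambda>_. R))"
    using hol1[OF cone_const[of R B], of R] R(1) B_bounds by auto
  have "L g (\<lambda>x. \<phi> x - (- R)) = (\<lambda>x. L g \<phi> x + L g (\<lambda>_. R) x)"
    using L_add[of g \<phi> "\<lambda>_. R"] by simp
  then have "L g \<phi> = (\<lambda>x. L g (\<lambda>x. \<phi> x - (- R)) x - L g (\<lambda>_. R) x)" by auto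
  then show ?thesis using hol_diff[OF 1 2] by (intro exI) simp
qed

text \<open>The brackets are applied to \<open>ones 1\<close>, whose iterates are
  \<open>ones (Suc n)\<close>. The lower bound on \<kappa> is needed to take its logarithm.\<close>

lemma ratio_limit:
  "\<exists>\<kappa> D \<gamma>. \<kappa> \<ge> exp (- G) \<and> 0 < \<gamma> \<and> \<gamma> < 1 \<and>
     (\<forall>n. \<forall>x\<in>S. \<bar>ones (Suc n) x / ones n x - \<kappa>\<bar> \<le> D * \<gamma> ^ n)"
proof -
  obtain C where h: "hol \<alpha> C (ones 1)"
    using hol_L[OF hol_const, of 1] by (auto simp: ones_def)
  obtain R where R: "R \<ge> 0" and int: "\<And>n. \<exists>s r. s \<le> r \<and> r - s \<le> R * (1 - \<delta>) ^ (n div p) \<and>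
    (\<forall>m\<ge>n. cone B (\<lambda>x. (L g ^^ m) (ones 1) x - s * ones m x) \<and>
            cone B (\<lambda>x. r * ones m x - (L g ^^ m) (ones 1) x))"
    using shrinking_cone_intervals[OF h] by blast
  obtain \<gamma> D where \<gamma>: "0 < \<gamma>" "\<gamma> < 1" "D \<ge> 0" "\<And>n. (1 - \<delta>) ^ (n div p) \<le> D * \<gamma> ^ n"
    using \<delta>_geometric by blast
  have "\<exists>c. \<forall>n. \<forall>x\<in>S. \<bar>ones (Suc n) x / ones n x - c\<bar> \<le> (R * D) * \<gamma> ^ n"
  proof (rule limit_of_shrinking_intervals[OF \<gamma>(1,2) origin_in_S])
    fix n
    obtain s r where sr: "r - s \<le> R * (1 - \<delta>) ^ (n div p)"
      and c: "\<And>m. m \<ge> n \<Longrightarrow> cone B (\<lambda>x. (L g ^^ m) (ones 1) x - s * ones m x)"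
        "\<And>m. m \<ge> n \<Longrightarrow> cone B (\<lambda>x. r * ones m x - (L g ^^ m) (ones 1) x)"
      using int[of n] by blast
    have "s \<le> ones (Suc m) x / ones m x \<and> ones (Suc m) x / ones m x \<le> r"
      if "m \<ge> n" "x \<in> S" for m x
      using cone_nonneg[OF c(1)[OF that(1)] that(2)] cone_nonneg[OF c(2)[OF that(1)] that(2)]
        ones_pos[OF that(2), of m]
      by (simp add: Ln_ones field_simps)
    moreover have "R * (1 - \<delta>) ^ (n div p) \<le> R * (D * \<gamma> ^ n)"
      using R \<gamma>(4) by (intro mult_left_mono) auto
    ultimately show "\<exists>s r. r - s \<le> R * D * \<gamma> ^ n \<and>
        (\<forall>m\<ge>n. \<forall>x\<in>S. s \<le> ones (Suc m) x / ones m x \<and> ones (Suc m) x / ones m x \<le> r)"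
      using sr by (intro exI[of _ s] exI[of _ r]) (auto simp: mult.assoc)
  qed
  then obtain \<kappa> where \<kappa>: "\<And>n x. x \<in> S \<Longrightarrow> \<bar>ones (Suc n) x / ones n x - \<kappa>\<bar> \<le> (R * D) * \<gamma> ^ n"
    by blast
  have "(\<lambda>n. (R * D) * \<gamma> ^ n) \<longlonglongrightarrow> 0"
    using \<gamma>(1,2) by (rule geometric_null)
  then have "(\<lambda>n. ones (Suc n) origin / ones n origin - \<kappa>) \<longlonglongrightarrow> 0"
    by (rule Lim_null_comparison[rotated]) (use \<kappa>[OF origin_in_S] in auto)
  then have "(\<lambda>n. ones (Suc n) origin / ones n origin) \<longlonglongrightarrow> \<kappa>"
    by (simp add: LIM_zero_iff)
  moreover have "exp (- G) \<le> ones (Suc n) origin / ones n origin" for n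
    using ratio_lower[OF origin_in_S, of n] ones_pos[OF origin_in_S, of n] by (simp add: field_simps)
  ultimately have "exp (- G) \<le> \<kappa>" by (intro LIMSEQ_le_const) auto
  then show ?thesis using \<kappa> \<gamma> by blast
qed

text \<open>The eigenfunction is \<open>exp a\<close>, with eigenvalue \<kappa>. It is the limit of
  \<open>ones n / \<kappa> ^ n\<close>: by \<open>ratio_limit\<close> the increments of the
  logarithms are summable. For logarithms the cone inequality is already a Hoelder estimate.\<close>

theorem eigenfunction:
  "\<exists>a \<kappa> C. \<kappa> > 0 \<and> hol \<alpha> C a \<and>
     (\<forall>x\<in>S. L (\<lambda>y. g y + a y - a (shift y) - ln \<kappa>) (\<lambda>_. 1) x = 1)"
proof -
  obtain \<kappa> D \<gamma> where \<kappa>: "\<kappa> \<ge> exp (- G)" and \<gamma>: "0 < \<gamma>" "\<gamma> < 1"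
    and q: "\<And>n x. x \<in> S \<Longrightarrow> \<bar>ones (Suc n) x / ones n x - \<kappa>\<bar> \<le> D * \<gamma> ^ n"
    using ratio_limit by blast
  have \<kappa>0: "\<kappa> > 0" using \<kappa> by (smt (verit) exp_gt_zero)
  define a where "a = (\<lambda>n x. ln (ones n x) - real n * ln \<kappa>)"
  have step: "\<bar>a (Suc n) x - a n x\<bar> \<le> exp G * D * \<gamma> ^ n" if x: "x \<in> S" for n x
  proof -
    define t where "t = ones (Suc n) x / ones n x"
    have t: "exp (- G) \<le> t" "t > 0"
      using ratio_lower[OF x, of n] ones_pos[OF x] by (auto simp: t_def field_simps)
    have e: "a (Suc n) x - a n x = ln t - ln \<kappa>"
      using ones_pos[OF x, of n] ones_pos[OF x, of "Suc n"] by (simp add: a_def t_def ln_div algebra_simps)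
    \<comment> \<open>The logarithm has Lipschitz constant \<open>exp G\<close> above
      \<open>exp (- G)\<close>, a common lower bound of the quotients and of their limit.\<close>
    have bnd: "ln u - ln v \<le> exp G * \<bar>u - v\<bar>" if "exp (- G) \<le> v" "u > 0" for u v :: real
    proof -
      have v: "v > 0" using that by (smt (verit) exp_gt_zero)
      have "ln u - ln v = ln (u / v)" using v that by (simp add: ln_div)
      also have "\<dots> \<le> u / v - 1" using v that by (intro ln_le_minus_one) simp
      also have "\<dots> = (1 / v) * (u - v)" using v by (simp add: field_simps)
      also have "\<dots> \<le> (1 / v) * \<bar>u - v\<bar>" using v by (intro mult_left_mono) auto
      also have "\<dots> \<le> exp G * \<bar>u - v\<bar>"
        using that v by (intro mult_right_mono) (auto simp: exp_minus field_simps)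
      finally show ?thesis .
    qed
    have "\<bar>ln t - ln \<kappa>\<bar> \<le> exp G * \<bar>t - \<kappa>\<bar>"
      using bnd[of \<kappa> t] bnd[of t \<kappa>] \<kappa> t \<kappa>0 by (simp add: abs_le_iff abs_minus_commute)
    also have "\<dots> \<le> exp G * (D * \<gamma> ^ n)"
      using q[OF x, of n] by (intro mult_left_mono) (auto simp: t_def)
    finally show ?thesis by (simp add: e mult_ac)
  qed
  have conv: "\<exists>l. (\<lambda>n. a n x) \<longlonglongrightarrow> l" if x: "x \<in> S" for x
  proof -
    have "summable (\<lambda>n. exp G * D * \<gamma> ^ n)" using \<gamma> by (intro summable_mult summable_geometric) auto
    then have "summable (\<lambda>n. a (Suc n) x - a n x)"
      by (rule summable_comparison_test') (use step[OF x] in auto)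
    then have "convergent (\<lambda>n. \<Sum>k<n. a (Suc k) x - a k x)"
      by (simp add: summable_iff_convergent)
    moreover have "(\<lambda>n. \<Sum>k<n. a (Suc k) x - a k x) = (\<lambda>n. a n x)"
      by (simp add: sum_lessThan_telescope[of "\<lambda>n. a n x" for x]) (simp add: a_def)
    ultimately show ?thesis by (simp add: convergent_def)
  qed
  define l where "l = (\<lambda>x. lim (\<lambda>n. a n x))"
  have l: "(\<lambda>n. a n x) \<longlonglongrightarrow> l x" if "x \<in> S" for x
    using conv[OF that] unfolding l_def by (auto simp: limI)
  have hol_l: "hol \<alpha> (B + \<bar>ln c0\<bar>) l"
  proof (rule holI)
    show "0 \<le> B + \<bar>ln c0\<bar>" using B_bounds by simp
    fix j x y assume h: "x \<in> S" "y \<in> S" "agree j x y"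
    have ub: "a n x - a n y \<le> (B + \<bar>ln c0\<bar>) * \<alpha> ^ j"
      if n: "n \<ge> p" and h: "x \<in> S" "y \<in> S" "agree j x y" for n x y
    proof (cases "j = 0")
      \<comment> \<open>Without a common first letter the cone says nothing and
        \<open>Lp_comparable\<close> takes its place, hence the restriction to
        \<open>n \<ge> p\<close>.\<close>
      case True
      obtain k where k: "n = p + k" using n by (metis le_add_diff_inverse)
      have "c0 * ones n x \<le> ones n y"
        using Lp_comparable[OF cone_ones h(2,1), of k] by (simp add: k Ln_ones)
      then have "ln (c0 * ones n x) \<le> ln (ones n y)"
        using ones_pos h c0_pos by (subst ln_le_cancel_iff) auto
      then have "ln c0 + ln (ones n x) \<le> ln (ones n y)"
        using ones_pos[OF h(1), of n] c0_pos by (simp add: ln_mult)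
      then show ?thesis using B_bounds True by (simp add: a_def)
    next
      case False
      have "ones n x \<le> exp (B * \<alpha> ^ j) * ones n y"
        using False h by (intro coneD[OF cone_ones]) auto
      then have "ln (ones n x) \<le> ln (exp (B * \<alpha> ^ j) * ones n y)"
        using ones_pos h by (subst ln_le_cancel_iff) auto
      also have "\<dots> = B * \<alpha> ^ j + ln (ones n y)"
        using ones_pos[OF h(2), of n] by (simp add: ln_mult)
      also have "B * \<alpha> ^ j \<le> (B + \<bar>ln c0\<bar>) * \<alpha> ^ j"
        using \<alpha> by (intro mult_right_mono) auto
      finally show ?thesis by (simp add: a_def)
    qed
    have "(\<lambda>n. \<bar>a n x - a n y\<bar>) \<longlonglongrightarrow> \<bar>l x - l y\<bar>"
      by (intro tendsto_intros l h)
    moreover have "\<forall>n\<ge>p. \<bar>a n x - a n y\<bar> \<le> (B + \<bar>ln c0\<bar>) * \<alpha> ^ j"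
      using ub[OF _ h] ub[OF _ h(2,1) agree_sym[OF h(3)]] by (auto simp: abs_le_iff)
    ultimately show "\<bar>l x - l y\<bar> \<le> (B + \<bar>ln c0\<bar>) * \<alpha> ^ j"
      by (intro LIMSEQ_le_const2) auto
  qed
  have "L (\<lambda>y. g y + l y - l (shift y) - ln \<kappa>) (\<lambda>_. 1) x = 1" if x: "x \<in> S" for x
  proof -
    have expa: "exp (a n y) = ones n y / \<kappa> ^ n" if "y \<in> S" for n y
      using ones_pos[OF that] \<kappa>0 by (simp add: a_def exp_diff exp_of_nat_mult)
    have eq: "(\<Sum>c\<in>pred_letters (x 0). exp (g (scons c x)) * exp (a n (scons c x))) = \<kappa> * exp (a (Suc n) x)" for n
    proof -
      have "(\<Sum>c\<in>pred_letters (x 0). exp (g (scons c x)) * exp (a n (scons c x)))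
          = (\<Sum>c\<in>pred_letters (x 0). exp (g (scons c x)) * ones n (scons c x)) / \<kappa> ^ n"
        using x by (simp add: expa scons_pred_in_S sum_divide_distrib)
      also have "\<dots> = ones (Suc n) x / \<kappa> ^ n" by (simp add: ones_Suc transfer_eq)
      also have "\<dots> = \<kappa> * exp (a (Suc n) x)" using \<kappa>0 by (simp add: expa x)
      finally show ?thesis .
    qed
    have "(\<lambda>n. \<Sum>c\<in>pred_letters (x 0). exp (g (scons c x)) * exp (a n (scons c x)))
        \<longlonglongrightarrow> (\<Sum>c\<in>pred_letters (x 0). exp (g (scons c x)) * exp (l (scons c x)))"
      by (intro tendsto_intros l scons_pred_in_S x)
    moreover have "(\<lambda>n. \<kappa> * exp (a (Suc n) x)) \<longlonglongrightarrow> \<kappa> * exp (l x)"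
      using l[OF x] by (intro tendsto_intros) (rule LIMSEQ_Suc)
    ultimately have "(\<Sum>c\<in>pred_letters (x 0). exp (g (scons c x)) * exp (l (scons c x))) = \<kappa> * exp (l x)"
      unfolding eq using LIMSEQ_unique by blast
    moreover have "L (\<lambda>y. g y + l y - l (shift y) - ln \<kappa>) (\<lambda>_. 1) x
       = (\<Sum>c\<in>pred_letters (x 0). exp (g (scons c x)) * exp (l (scons c x))) / (\<kappa> * exp (l x))"
      using \<kappa>0 by (simp add: transfer_eq exp_diff exp_add sum_divide_distrib field_simps)
    ultimately show ?thesis using \<kappa>0 by simp
  qed
  then show ?thesis using hol_l \<kappa>0 by blast
qed

end

subsection \<open>Spectral gap and exponential moments\<close>

text \<open>A crude cubic remainder suffices: only the coefficient 1/2 of the square has to be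
  exact, since it is the one that multiplies the variance.\<close>

lemma exp_le_cubic:
  fixes t :: real
  shows "exp t \<le> 1 + t + t\<^sup>2 / 2 + \<bar>t\<bar> ^ 3 * exp \<bar>t\<bar>"
proof -
  obtain s where s: "\<bar>s\<bar> \<le> \<bar>t\<bar>" "exp t = (\<Sum>k<3. t ^ k / fact k) + exp s / fact 3 * t ^ 3"
    using Maclaurin_exp_le[of t 3] by blast
  have "exp s / fact 3 * t ^ 3 \<le> exp s / fact 3 * \<bar>t\<bar> ^ 3"
    by (intro mult_left_mono) (auto simp: power_abs[symmetric])
  also have "\<dots> \<le> exp \<bar>t\<bar> * \<bar>t\<bar> ^ 3"
  proof (intro mult_right_mono)
    have "exp s / fact 3 \<le> exp s / 1" by (intro divide_left_mono) (auto simp: fact_numeral)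
    also have "\<dots> \<le> exp \<bar>t\<bar>" using s by auto
    finally show "exp s / fact 3 \<le> exp \<bar>t\<bar>" .
  qed simp
  finally show ?thesis
    unfolding s(2) by (simp add: numeral_3_eq_3 power2_eq_square mult_ac)
qed

locale normalised = potential K A p g b \<alpha>
  for K :: nat and A :: "nat \<Rightarrow> nat \<Rightarrow> nat" and p :: nat and g :: "seq \<Rightarrow> real" and b \<alpha> :: real +
  assumes L_one: "\<And>x. x \<in> S \<Longrightarrow> L g (\<lambda>_. 1) x = 1"
begin

lemma Ln_const: "x \<in> S \<Longrightarrow> (L g ^^ n) (\<lambda>_. c) x = c"
proof (induction n arbitrary: x)
  case (Suc n)
  have "(L g ^^ Suc n) (\<lambda>_. c) x = L g (\<lambda>_. c * 1) x"
    using Suc by (auto intro!: L_cong)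
  then show ?case unfolding L_cmult using L_one[OF Suc.prems] by simp
qed simp

lemma ones_eq: "x \<in> S \<Longrightarrow> ones n x = 1"
  by (simp add: ones_def Ln_const)

lemma cone_cong: "cone B \<phi> \<Longrightarrow> (\<And>x. x \<in> S \<Longrightarrow> \<phi> x = \<psi> x) \<Longrightarrow> cone B \<psi>"
  by (auto simp: cone_def)

text \<open>After normalisation \<open>ones n\<close> is 1 on \<open>S\<close>, so the brackets are
  intervals of constants. Their length also bounds the Hoelder constants, because
  \<open>L^n \<phi> - s\<close> is a member of the cone bounded by it. This second decay makes
  series of iterates Hoelder.\<close>

lemma spectral_gap_aux:
  assumes h: "hol \<alpha> C \<phi>"
  shows "\<exists>c D \<gamma>. 0 < \<gamma> \<and> \<gamma> < 1 \<and> (\<forall>n. \<forall>x\<in>S. \<bar>(L g ^^ n) \<phi> x - c\<bar> \<le> D * \<gamma> ^ n) \<and>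
     (\<forall>n. hol \<alpha> (D * \<gamma> ^ n) ((L g ^^ n) \<phi>))"
proof -
  obtain R where R: "R \<ge> 0" and int: "\<And>n. \<exists>s r. s \<le> r \<and> r - s \<le> R * (1 - \<delta>) ^ (n div p) \<and>
    (\<forall>m\<ge>n. cone B (\<lambda>x. (L g ^^ m) \<phi> x - s * ones m x) \<and>
            cone B (\<lambda>x. r * ones m x - (L g ^^ m) \<phi> x))"
    using shrinking_cone_intervals[OF h] by blast
  obtain \<gamma> D where \<gamma>: "0 < \<gamma>" "\<gamma> < 1" "D \<ge> 0" "\<And>n. (1 - \<delta>) ^ (n div p) \<le> D * \<gamma> ^ n"
    using \<delta>_geometric by blast
  have int': "\<exists>s r. s \<le> r \<and> r - s \<le> R * D * \<gamma> ^ n \<and>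
    (\<forall>m\<ge>n. cone B (\<lambda>x. (L g ^^ m) \<phi> x - s) \<and> cone B (\<lambda>x. r - (L g ^^ m) \<phi> x))" for n
  proof -
    obtain s r where sr: "s \<le> r" "r - s \<le> R * (1 - \<delta>) ^ (n div p)"
      and c: "\<And>m. m \<ge> n \<Longrightarrow> cone B (\<lambda>x. (L g ^^ m) \<phi> x - s * ones m x)"
        "\<And>m. m \<ge> n \<Longrightarrow> cone B (\<lambda>x. r * ones m x - (L g ^^ m) \<phi> x)"
      using int[of n] by blast
    have "R * (1 - \<delta>) ^ (n div p) \<le> R * (D * \<gamma> ^ n)"
      using R \<gamma>(4) by (intro mult_left_mono) auto
    moreover have "cone B (\<lambda>x. (L g ^^ m) \<phi> x - s)" "cone B (\<lambda>x. r - (L g ^^ m) \<phi> x)"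
      if "m \<ge> n" for m
      by (rule cone_cong[OF c(1)[OF that]], simp add: ones_eq)
         (rule cone_cong[OF c(2)[OF that]], simp add: ones_eq)
    ultimately show ?thesis using sr by (intro exI[of _ s] exI[of _ r]) (auto simp: mult.assoc)
  qed
  have "\<exists>c. \<forall>n. \<forall>x\<in>S. \<bar>(L g ^^ n) \<phi> x - c\<bar> \<le> (R * D) * \<gamma> ^ n"
  proof (rule limit_of_shrinking_intervals[OF \<gamma>(1,2) origin_in_S])
    fix n
    obtain s r where sr: "r - s \<le> R * D * \<gamma> ^ n"
      and c: "\<And>m. m \<ge> n \<Longrightarrow> cone B (\<lambda>x. (L g ^^ m) \<phi> x - s) \<and> cone B (\<lambda>x. r - (L g ^^ m) \<phi> x)"
      using int'[of n] by blast
    have "s \<le> (L g ^^ m) \<phi> x \<and> (L g ^^ m) \<phi> x \<le> r" if "m \<ge> n" "x \<in> S" for m x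
      using cone_nonneg[of B "\<lambda>x. (L g ^^ m) \<phi> x - s" x] cone_nonneg[of B "\<lambda>x. r - (L g ^^ m) \<phi> x" x]
        c[OF that(1)] that(2) by simp
    then show "\<exists>s r. r - s \<le> R * D * \<gamma> ^ n \<and>
        (\<forall>m\<ge>n. \<forall>x\<in>S. s \<le> (L g ^^ m) \<phi> x \<and> (L g ^^ m) \<phi> x \<le> r)"
      using sr by blast
  qed
  then obtain c where c: "\<And>n x. x \<in> S \<Longrightarrow> \<bar>(L g ^^ n) \<phi> x - c\<bar> \<le> (R * D) * \<gamma> ^ n" by blast
  define E where "E = R * D * (exp B * B)"
  have B: "exp B * B \<ge> 1" using B_bounds mult_mono[of 1 "exp B" 1 B] by simp
  have RD: "R * D \<ge> 0" using R \<gamma> by simp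
  have RDE: "R * D \<le> E" unfolding E_def using mult_left_mono[OF B RD] by simp
  have "\<bar>(L g ^^ n) \<phi> x - c\<bar> \<le> E * \<gamma> ^ n" if "x \<in> S" for n x
  proof -
    have "R * D * \<gamma> ^ n \<le> E * \<gamma> ^ n" using \<gamma> by (intro mult_right_mono RDE) auto
    then show ?thesis using c[OF that, of n] by linarith
  qed
  moreover have "hol \<alpha> (E * \<gamma> ^ n) ((L g ^^ n) \<phi>)" for n
  proof (rule holI)
    show "0 \<le> E * \<gamma> ^ n" using RD RDE \<gamma> by simp
    fix j x y assume xy: "x \<in> S" "y \<in> S" "agree j x y"
    obtain s r where sr: "s \<le> r" "r - s \<le> R * D * \<gamma> ^ n"
      and cc: "cone B (\<lambda>x. (L g ^^ n) \<phi> x - s)" "cone B (\<lambda>x. r - (L g ^^ n) \<phi> x)"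
      using int'[of n] by blast
    have "\<bar>((L g ^^ n) \<phi> x - s) - ((L g ^^ n) \<phi> y - s)\<bar> \<le> (R * D * \<gamma> ^ n) * exp B * B * \<alpha> ^ j"
    proof (rule cone_oscillation[OF cc(1) _ _ xy])
      show "(L g ^^ n) \<phi> x - s \<le> R * D * \<gamma> ^ n" if "x \<in> S" for x
        using cone_nonneg[OF cc(2) that] sr by linarith
      show "0 \<le> R * D * \<gamma> ^ n" using sr by linarith
    qed
    then show "\<bar>(L g ^^ n) \<phi> x - (L g ^^ n) \<phi> y\<bar> \<le> E * \<gamma> ^ n * \<alpha> ^ j"
      by (simp add: E_def mult_ac)
  qed
  ultimately show ?thesis using \<gamma> by blast
qed

text \<open>For Hoelder functions the limit is the same at every point of \<open>S\<close>, and
  \<open>I_eq_nu\<close> shows that it is the integral against the Gibbs measure.\<close>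

definition nu :: "(seq \<Rightarrow> real) \<Rightarrow> real" where
  "nu \<phi> = lim (\<lambda>n. (L g ^^ n) \<phi> origin)"

lemma spectral_gap:
  assumes h: "hol \<alpha> C \<phi>"
  obtains D \<gamma> where "0 < \<gamma>" "\<gamma> < 1" "\<And>n x. x \<in> S \<Longrightarrow> \<bar>(L g ^^ n) \<phi> x - nu \<phi>\<bar> \<le> D * \<gamma> ^ n"
    "\<And>n. hol \<alpha> (D * \<gamma> ^ n) ((L g ^^ n) \<phi>)"
proof -
  obtain c D \<gamma> where \<gamma>: "0 < \<gamma>" "\<gamma> < 1" and
    c: "\<And>n x. x \<in> S \<Longrightarrow> \<bar>(L g ^^ n) \<phi> x - c\<bar> \<le> D * \<gamma> ^ n"
    and D: "\<And>n. hol \<alpha> (D * \<gamma> ^ n) ((L g ^^ n) \<phi>)"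
    using spectral_gap_aux[OF h] by blast
  have "(\<lambda>n. D * \<gamma> ^ n) \<longlonglongrightarrow> 0"
    using \<gamma>(1,2) by (rule geometric_null)
  then have "(\<lambda>n. (L g ^^ n) \<phi> origin - c) \<longlonglongrightarrow> 0"
    by (rule Lim_null_comparison[rotated]) (use c[OF origin_in_S] in auto)
  then have "(\<lambda>n. (L g ^^ n) \<phi> origin) \<longlonglongrightarrow> c"
    by (simp add: LIM_zero_iff)
  then have "nu \<phi> = c" unfolding nu_def by (rule limI)
  then show ?thesis using that[of \<gamma> D] \<gamma> c D by blast
qed

lemma nu_tendsto:
  assumes h: "hol \<alpha> C \<phi>" and x: "x \<in> S"
  shows "(\<lambda>n. (L g ^^ n) \<phi> x) \<longlonglongrightarrow> nu \<phi>"
proof -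
  obtain D \<gamma> where \<gamma>: "0 < \<gamma>" "\<gamma> < 1" and D: "\<And>n x. x \<in> S \<Longrightarrow> \<bar>(L g ^^ n) \<phi> x - nu \<phi>\<bar> \<le> D * \<gamma> ^ n"
    using spectral_gap[OF h] by metis
  have "(\<lambda>n. D * \<gamma> ^ n) \<longlonglongrightarrow> 0"
    using \<gamma>(1,2) by (rule geometric_null)
  then have "(\<lambda>n. (L g ^^ n) \<phi> x - nu \<phi>) \<longlonglongrightarrow> 0"
    by (rule Lim_null_comparison[rotated]) (use D[OF x] in auto)
  then show ?thesis by (simp add: LIM_zero_iff)
qed

lemma nu_eqI:
  assumes "hol \<alpha> C \<phi>" "(\<lambda>n. (L g ^^ n) \<phi> origin) \<longlonglongrightarrow> c"
  shows "nu \<phi> = c"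
  using LIMSEQ_unique[OF nu_tendsto[OF assms(1) origin_in_S] assms(2)] .

lemma nu_const: "nu (\<lambda>_. c) = c"
  by (rule nu_eqI[OF hol_const]) (simp add: Ln_const origin_in_S)

lemma nu_diff: "hol \<alpha> C \<phi> \<Longrightarrow> hol \<alpha> D \<psi> \<Longrightarrow> nu (\<lambda>x. \<phi> x - \<psi> x) = nu \<phi> - nu \<psi>"
  by (rule nu_eqI[OF hol_diff]) (auto simp: Ln_diff intro!: tendsto_diff nu_tendsto origin_in_S)

lemma nu_cmult: "hol \<alpha> C \<phi> \<Longrightarrow> nu (\<lambda>x. c * \<phi> x) = c * nu \<phi>"
  by (rule nu_eqI[OF hol_cmult]) (auto simp: Ln_cmult intro!: tendsto_intros nu_tendsto origin_in_S)

lemma nu_L: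
  assumes "hol \<alpha> C \<phi>" shows "nu (L g \<phi>) = nu \<phi>"
proof -
  obtain D where D: "hol \<alpha> D (L g \<phi>)" using hol_L[OF assms] by blast
  have "(L g ^^ n) (L g \<phi>) = (L g ^^ Suc n) \<phi>" for n by (simp add: funpow_swap1)
  then have "(\<lambda>n. (L g ^^ n) (L g \<phi>) origin) \<longlonglongrightarrow> nu \<phi>"
    using LIMSEQ_Suc[OF nu_tendsto[OF assms origin_in_S]] by simp
  then show ?thesis by (rule nu_eqI[OF D])
qed

text \<open>The solution is the Neumann series of the iterates \<open>L^n \<phi>\<close>. With
  \<open>nu \<phi> = 0\<close> their values decay geometrically, as their Hoelder constants do in
  any case.\<close>

lemma poisson_equation:
  assumes h: "hol \<alpha> C \<phi>" and 0: "nu \<phi> = 0"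
  shows "\<exists>w E. hol \<alpha> E w \<and> (\<forall>x\<in>S. w x - L g w x = \<phi> x)"
proof -
  obtain D \<gamma> where \<gamma>: "0 < \<gamma>" "\<gamma> < 1"
    and D: "\<And>n x. x \<in> S \<Longrightarrow> \<bar>(L g ^^ n) \<phi> x\<bar> \<le> D * \<gamma> ^ n"
    and hD: "\<And>n. hol \<alpha> (D * \<gamma> ^ n) ((L g ^^ n) \<phi>)"
    using spectral_gap[OF h] unfolding 0 diff_0_right by metis
  have geo: "(\<lambda>n. D * \<gamma> ^ n) sums (D * (1 / (1 - \<gamma>)))"
    using \<gamma> by (intro sums_mult geometric_sums) auto
  have sm: "summable (\<lambda>n. (L g ^^ n) \<phi> x)" if "x \<in> S" for x
    by (rule summable_comparison_test'[OF sums_summable[OF geo]]) (use D[OF that] in auto)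
  define w where "w = (\<lambda>x. \<Sum>n. (L g ^^ n) \<phi> x)"
  have w: "(\<lambda>n. (L g ^^ n) \<phi> x) sums w x" if "x \<in> S" for x
    unfolding w_def using sm[OF that] by (rule summable_sums)
  have D0: "D \<ge> 0" using hol_nonneg[OF hD[of 0]] by simp
  have "hol \<alpha> (D * (1 / (1 - \<gamma>))) w"
  proof (rule holI)
    show "0 \<le> D * (1 / (1 - \<gamma>))" using D0 \<gamma> by simp
    fix j x y assume xy: "x \<in> S" "y \<in> S" "agree j x y"
    have "(\<lambda>n. (L g ^^ n) \<phi> x - (L g ^^ n) \<phi> y) sums (w x - w y)"
      by (intro sums_diff w xy)
    moreover have dom: "\<bar>(L g ^^ n) \<phi> x - (L g ^^ n) \<phi> y\<bar> \<le> (D * \<gamma> ^ n) * \<alpha> ^ j" for n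
      by (rule holD[OF hD xy])
    moreover have g2: "(\<lambda>n. (D * \<gamma> ^ n) * \<alpha> ^ j) sums (D * (1 / (1 - \<gamma>)) * \<alpha> ^ j)"
      by (intro sums_mult2 geo)
    moreover have "summable (\<lambda>n. \<bar>(L g ^^ n) \<phi> x - (L g ^^ n) \<phi> y\<bar>)"
      by (rule summable_comparison_test'[OF sums_summable[OF g2]]) (use dom in auto)
    ultimately show "\<bar>w x - w y\<bar> \<le> D * (1 / (1 - \<gamma>)) * \<alpha> ^ j"
      using summable_rabs[of "\<lambda>n. (L g ^^ n) \<phi> x - (L g ^^ n) \<phi> y"]
        suminf_le[of "\<lambda>n. \<bar>(L g ^^ n) \<phi> x - (L g ^^ n) \<phi> y\<bar>" "\<lambda>n. (D * \<gamma> ^ n) * \<alpha> ^ j"]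
      by (auto simp: sums_iff)
  qed
  moreover have "w x - L g w x = \<phi> x" if x: "x \<in> S" for x
  proof -
    have "(\<lambda>n. \<Sum>a\<in>pred_letters (x 0). exp (g (scons a x)) * (L g ^^ n) \<phi> (scons a x))
        sums (\<Sum>a\<in>pred_letters (x 0). exp (g (scons a x)) * w (scons a x))"
      by (intro sums_sum sums_mult w scons_pred_in_S x)
    then have "(\<lambda>n. (L g ^^ Suc n) \<phi> x) sums L g w x"
      by (simp add: transfer_eq)
    moreover have "(\<lambda>n. (L g ^^ Suc n) \<phi> x) sums (w x - (L g ^^ 0) \<phi> x)"
      using w[OF x] by (subst sums_Suc_iff) simp
    ultimately show ?thesis using sums_unique2 by fastforce
  qed
  ultimately show ?thesis by blast
qed

text \<open>Gordin's construction: if \<open>w\<close> solves the Poisson equation and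
  \<open>v = L w\<close>, then subtracting \<open>v (shift x)\<close> from \<open>w x\<close> leaves
  a function \<open>m\<close> with \<open>L m = L w - v * L 1 = 0\<close>. With \<open>L\<close>
  read as a conditional expectation given the shifted sequence, the Birkhoff sums of
  \<open>m\<close> have orthogonal increments.\<close>

theorem martingale_decomposition:
  assumes h: "hol \<alpha> C \<phi>"
  shows "\<exists>m v Cm Cv. hol \<alpha> Cm m \<and> hol \<alpha> Cv v \<and> (\<forall>x\<in>S. L g m x = 0) \<and>
    (\<forall>x\<in>S. \<phi> x - nu \<phi> = m x + v (shift x) - v x)"
proof -
  have h': "hol \<alpha> (C + 0) (\<lambda>x. \<phi> x - nu \<phi>)" by (rule hol_diff[OF h hol_const])
  have "nu (\<lambda>x. \<phi> x - nu \<phi>) = 0"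
    using nu_diff[OF h hol_const, of "nu \<phi>"] by (simp add: nu_const)
  then obtain w E where w: "hol \<alpha> E w" "\<And>x. x \<in> S \<Longrightarrow> w x - L g w x = \<phi> x - nu \<phi>"
    using poisson_equation[OF h'] by auto
  define v where "v = L g w"
  obtain Cv where Cv: "hol \<alpha> Cv v" unfolding v_def using hol_L[OF w(1)] by blast
  define m where "m = (\<lambda>x. w x - v (shift x))"
  have Cm: "hol \<alpha> (E + Cv / \<alpha>) m"
    unfolding m_def by (intro hol_diff w hol_shift[OF Cv] \<alpha>)
  have "L g m x = 0" if x: "x \<in> S" for x
  proof -
    have "L g (\<lambda>y. 1 * v (shift y)) x = v x * L g (\<lambda>_. 1) x"
      by (simp only: L_mult_shift[of g "\<lambda>_. 1" v])
    then show ?thesis using L_one[OF x] by (simp add: m_def L_diff v_def)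
  qed
  moreover have "\<phi> x - nu \<phi> = m x + v (shift x) - v x" if "x \<in> S" for x
    using w(2)[OF that] by (simp add: m_def v_def)
  ultimately show ?thesis using Cm Cv by blast
qed

lemma birkhoff_coboundary:
  assumes "\<And>x. x \<in> S \<Longrightarrow> \<phi> x - c = m x + v (shift x) - v x" "x \<in> S"
  shows "birkhoff \<phi> n x - real n * c = birkhoff m n x + v ((shift ^^ n) x) - v x"
  using assms(2)
proof (induction n arbitrary: x)
  case (Suc n)
  show ?case
    using Suc.IH[OF shift_in_S[OF Suc.prems]] assms(1)[OF Suc.prems]
    by (simp add: birkhoff_Suc funpow_swap1 algebra_simps)
qed simp

text \<open>The first application of \<open>L\<close> kills the cross term of the square: the factor
  that depends on the shifted sequence comes out, and \<open>L m = 0\<close> remains.\<close>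

lemma birkhoff_second_moment:
  assumes m0: "\<And>x. x \<in> S \<Longrightarrow> L g m x = 0" and R: "\<And>x. x \<in> S \<Longrightarrow> \<bar>m x\<bar> \<le> R"
    and x: "x \<in> S"
  shows "(L g ^^ n) (\<lambda>y. (birkhoff m n y)\<^sup>2) x \<le> real n * R\<^sup>2"
  using x
proof (induction n arbitrary: x)
  case (Suc n)
  have e: "(\<lambda>y. (birkhoff m (Suc n) y)\<^sup>2) = (\<lambda>y. ((m y)\<^sup>2 + m y * (2 * birkhoff m n (shift y)))
        + 1 * (birkhoff m n (shift y))\<^sup>2)"
    by (auto simp: birkhoff_Suc power2_sum algebra_simps)
  have L: "L g (\<lambda>y. (birkhoff m (Suc n) y)\<^sup>2) x = L g (\<lambda>y. (m y)\<^sup>2) x + (birkhoff m n x)\<^sup>2"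
    if "x \<in> S" for x
    unfolding e L_add L_mult_shift[of g m "\<lambda>y. 2 * birkhoff m n y"]
      L_mult_shift[of g "\<lambda>_. 1" "\<lambda>y. (birkhoff m n y)\<^sup>2"]
    using m0[OF that] L_one[OF that] by simp
  have Lm: "L g (\<lambda>y. (m y)\<^sup>2) x \<le> R\<^sup>2" if "x \<in> S" for x
  proof -
    have "L g (\<lambda>y. (m y)\<^sup>2) x \<le> L g (\<lambda>_. R\<^sup>2) x"
      using R by (intro L_mono that abs_le_square_iff[THEN iffD1]) (auto intro: order_trans abs_ge_self)
    also have "\<dots> = R\<^sup>2" using Ln_const[OF that, of 1] by simp
    finally show ?thesis .
  qed
  have "(L g ^^ Suc n) (\<lambda>y. (birkhoff m (Suc n) y)\<^sup>2) x
      = (L g ^^ n) (L g (\<lambda>y. (birkhoff m (Suc n) y)\<^sup>2)) x"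
    by (simp add: funpow_swap1)
  also have "\<dots> \<le> (L g ^^ n) (\<lambda>x. R\<^sup>2 + (birkhoff m n x)\<^sup>2) x"
    using L Lm Suc.prems by (intro Ln_mono) auto
  also have "\<dots> = R\<^sup>2 + (L g ^^ n) (\<lambda>x. (birkhoff m n x)\<^sup>2) x"
    by (simp add: Ln_add Ln_const Suc.prems)
  also have "\<dots> \<le> R\<^sup>2 + real n * R\<^sup>2" using Suc by simp
  finally show ?case by (simp add: algebra_simps)
qed simp

lemma L_le_add_const:
  assumes "\<And>y. y \<in> S \<Longrightarrow> \<phi> y \<le> \<psi> y + c" "x \<in> S"
  shows "L g \<phi> x \<le> L g \<psi> x + c"
proof -
  have "L g \<phi> x \<le> L g (\<lambda>y. \<psi> y + c) x" using assms by (intro L_mono)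
  also have "\<dots> = L g \<psi> x + c" using Ln_const[OF assms(2), of 1 c] by (simp add: L_add)
  finally show ?thesis .
qed

text \<open>Second-order perturbation theory: \<^term>\<open>1 + t\<^sup>2 * w\<close> is an approximate eigenfunction of the
  tilted transfer operator, where \<^term>\<open>w\<close> solves a Poisson equation.\<close>

theorem birkhoff_exponential_moment:
  assumes hm: "hol \<alpha> Cm m" and m0: "\<And>x. x \<in> S \<Longrightarrow> L g m x = 0"
  defines "\<rho> \<equiv> nu (\<lambda>x. (m x)\<^sup>2)"
  shows "\<exists>C D. C \<ge> 0 \<and> (\<forall>t n. \<forall>x\<in>S. \<bar>t\<bar> \<le> 1 \<longrightarrow>
     (L g ^^ n) (\<lambda>y. exp (t * birkhoff m n y)) x \<le> D * exp (real n * (t\<^sup>2 * \<rho> / 2 + C * \<bar>t\<bar> ^ 3)))"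
proof -
  obtain E0 where hm2: "hol \<alpha> E0 (\<lambda>x. (m x)\<^sup>2)"
    using hol_mult[OF hm hm] \<alpha> by (auto simp: power2_eq_square)
  obtain E1 where hLm2: "hol \<alpha> E1 (L g (\<lambda>x. (m x)\<^sup>2))" using hol_L[OF hm2] by blast
  \<comment> \<open>Half of the deviation of \<open>L (m^2)\<close> from its mean: the fluctuation
    of the second-order term, which \<open>w\<close> has to cancel.\<close>
  define \<phi> where "\<phi> = (\<lambda>x. (1/2) * (L g (\<lambda>x. (m x)\<^sup>2) x - \<rho>))"
  have h1: "hol \<alpha> (E1 + 0) (\<lambda>x. L g (\<lambda>x. (m x)\<^sup>2) x - \<rho>)" by (intro hol_diff hLm2 hol_const)
  have h\<phi>: "hol \<alpha> (\<bar>1/2\<bar> * (E1 + 0)) \<phi>" unfolding \<phi>_def by (intro hol_cmult h1)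
  have "nu (\<lambda>x. L g (\<lambda>x. (m x)\<^sup>2) x - \<rho>) = 0"
    using nu_diff[OF hLm2 hol_const, of \<rho>] nu_L[OF hm2] by (simp add: nu_const \<rho>_def)
  then have "nu \<phi> = 0" unfolding \<phi>_def by (subst nu_cmult[OF h1]) simp
  then obtain w0 E2 where w0: "hol \<alpha> E2 w0" "\<And>x. x \<in> S \<Longrightarrow> w0 x - L g w0 x = \<phi> x"
    using poisson_equation[OF h\<phi>] by blast
  define R0 where "R0 = \<bar>w0 origin\<bar> + E2"
  \<comment> \<open>Adding a constant to a solution gives a solution; this constant makes
    \<open>w\<close> nonnegative and so the weight \<open>1 + t^2 * w\<close> at least 1.\<close>
  define w where "w = (\<lambda>x. w0 x + R0)"
  have w_bd: "0 \<le> w x" "w x \<le> 2 * R0" if "x \<in> S" for x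
    using hol_bounded[OF w0(1) that] by (auto simp: w_def R0_def)
  \<comment> \<open>The left side is the coefficient of \<open>t^2\<close> when the tilted operator
    acts on the weight. It exceeds the coefficient \<open>w\<close> of the weight itself by a
    constant, which is what an approximate eigenfunction requires.\<close>
  have w_eq: "L g w x + L g (\<lambda>x. (m x)\<^sup>2) x / 2 = w x + \<rho> / 2" if "x \<in> S" for x
    using w0(2)[OF that] Ln_const[OF that, of 1 R0]
    by (simp add: w_def L_add \<phi>_def field_simps)
  define R where "R = \<bar>m origin\<bar> + Cm"
  have R: "\<bar>m x\<bar> \<le> R" if "x \<in> S" for x unfolding R_def by (rule hol_bounded[OF hm that])
  have R_nn: "R \<ge> 0" using hol_nonneg[OF hm] by (simp add: R_def)
  have R0_nn: "R0 \<ge> 0" using hol_nonneg[OF w0(1)] by (simp add: R0_def)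
  have \<rho>_nn: "\<rho> \<ge> 0" unfolding \<rho>_def
    by (rule LIMSEQ_le_const[OF nu_tendsto[OF hm2 origin_in_S]])
       (auto intro!: exI Ln_nonneg origin_in_S)
  \<comment> \<open>The three summands bound, in units of \<open>|t|^3\<close>, the mixed term
    \<open>t^3 * u * z\<close>, the term of order \<open>t^4\<close> and the cubic remainder of the
    exponential.\<close>
  define C1 where "C1 = 2 * R0 * R + R0 * R\<^sup>2 + R ^ 3 * exp R * (1 + 2 * R0)"
  have C1_nn: "C1 \<ge> 0" using R_nn R0_nn by (simp add: C1_def)
  have pert: "exp (t * m y) * (1 + t\<^sup>2 * w y)
       \<le> (1 + t * m y + t\<^sup>2 * ((m y)\<^sup>2 / 2 + w y)) + C1 * \<bar>t\<bar> ^ 3"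
    if t: "\<bar>t\<bar> \<le> 1" and y: "y \<in> S" for t y
  proof -
    define u where "u = m y"
    define z where "z = w y"
    have uz: "\<bar>u\<bar> \<le> R" "0 \<le> z" "z \<le> 2 * R0" using R[OF y] w_bd[OF y] by (auto simp: u_def z_def)
    have t2: "t\<^sup>2 \<le> 1" using t by (simp add: abs_square_le_1)
    have tu: "\<bar>t * u\<bar> \<le> R" unfolding abs_mult using mult_mono[OF t uz(1)] R_nn by simp
    have t3: "\<bar>t * u\<bar> ^ 3 * exp \<bar>t * u\<bar> \<le> \<bar>t\<bar> ^ 3 * (R ^ 3 * exp R)"
    proof -
      have "\<bar>u\<bar> ^ 3 \<le> R ^ 3" using uz by (intro power_mono) auto
      then have "\<bar>t\<bar> ^ 3 * \<bar>u\<bar> ^ 3 * exp \<bar>t * u\<bar> \<le> \<bar>t\<bar> ^ 3 * R ^ 3 * exp R"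
        using tu R_nn by (intro mult_mono) auto
      then show ?thesis by (simp add: abs_mult power_mult_distrib mult.assoc)
    qed
    have cub: "t\<^sup>2 * \<bar>t\<bar> = \<bar>t\<bar> ^ 3" by (simp add: power3_eq_cube power2_eq_square)
    have W: "1 \<le> 1 + t\<^sup>2 * z" "1 + t\<^sup>2 * z \<le> 1 + 2 * R0"
      using uz t2 mult_mono[OF t2 uz(3)] by auto
    have "exp (t * u) * (1 + t\<^sup>2 * z) \<le> (1 + t * u + (t * u)\<^sup>2 / 2 + \<bar>t\<bar> ^ 3 * (R ^ 3 * exp R)) * (1 + t\<^sup>2 * z)"
      using exp_le_cubic[of "t * u"] t3 W by (intro mult_right_mono) auto
    also have "\<dots> = (1 + t * u + t\<^sup>2 * (u\<^sup>2 / 2 + z)) + (t\<^sup>2 * (t * (u * z)) + t\<^sup>2 * t\<^sup>2 * (u\<^sup>2 * z / 2)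
        + \<bar>t\<bar> ^ 3 * (R ^ 3 * exp R) * (1 + t\<^sup>2 * z))"
    proof -
      have "(1 + t * u + (t * u)\<^sup>2 / 2 + Q) * (1 + t\<^sup>2 * z) = (1 + t * u + t\<^sup>2 * (u\<^sup>2 / 2 + z))
        + (t\<^sup>2 * (t * (u * z)) + t\<^sup>2 * t\<^sup>2 * (u\<^sup>2 * z / 2) + Q * (1 + t\<^sup>2 * z))" for Q :: real
        by (simp add: field_simps power2_eq_square)
      then show ?thesis .
    qed
    also have "\<dots> \<le> (1 + t * u + t\<^sup>2 * (u\<^sup>2 / 2 + z)) + (\<bar>t\<bar> ^ 3 * (2 * R0 * R) + \<bar>t\<bar> ^ 3 * (R0 * R\<^sup>2)
        + \<bar>t\<bar> ^ 3 * (R ^ 3 * exp R) * (1 + 2 * R0))"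
    proof (intro add_mono order_refl)
      have "t * (u * z) \<le> \<bar>t\<bar> * (\<bar>u\<bar> * z)"
        using uz(2) abs_ge_self[of "t * (u * z)"] by (simp add: abs_mult)
      also have "\<dots> \<le> \<bar>t\<bar> * (R * (2 * R0))"
        using uz R_nn by (intro mult_left_mono mult_mono) auto
      finally have "t\<^sup>2 * (t * (u * z)) \<le> t\<^sup>2 * (\<bar>t\<bar> * (R * (2 * R0)))"
        by (intro mult_left_mono) auto
      then show "t\<^sup>2 * (t * (u * z)) \<le> \<bar>t\<bar> ^ 3 * (2 * R0 * R)"
        unfolding cub[symmetric] by (simp add: mult_ac)
      have t43: "t\<^sup>2 * t\<^sup>2 \<le> \<bar>t\<bar> ^ 3"
      proof -
        have "t\<^sup>2 * t\<^sup>2 = \<bar>t\<bar> ^ 3 * \<bar>t\<bar>" by (simp add: power3_eq_cube power2_eq_square abs_if)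
        also have "\<dots> \<le> \<bar>t\<bar> ^ 3 * 1" using t by (intro mult_left_mono) auto
        finally show ?thesis by simp
      qed
      have "u\<^sup>2 \<le> R\<^sup>2" using uz R_nn by (auto intro: abs_le_square_iff[THEN iffD1])
      then have "u\<^sup>2 * z \<le> R\<^sup>2 * (2 * R0)" using uz by (intro mult_mono) auto
      then show "t\<^sup>2 * t\<^sup>2 * (u\<^sup>2 * z / 2) \<le> \<bar>t\<bar> ^ 3 * (R0 * R\<^sup>2)"
        using t43 uz by (intro mult_mono) (auto simp: mult_ac)
      show "\<bar>t\<bar> ^ 3 * (R ^ 3 * exp R) * (1 + t\<^sup>2 * z) \<le> \<bar>t\<bar> ^ 3 * (R ^ 3 * exp R) * (1 + 2 * R0)"
        using W R_nn by (intro mult_left_mono) auto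
    qed
    also have "\<dots> = (1 + t * u + t\<^sup>2 * (u\<^sup>2 / 2 + z)) + C1 * \<bar>t\<bar> ^ 3"
      by (simp add: C1_def algebra_simps)
    finally show ?thesis by (simp add: u_def z_def)
  qed
  define W where "W = (\<lambda>t y. 1 + t\<^sup>2 * w y)"
  define q where "q = (\<lambda>t. exp (t\<^sup>2 * \<rho> / 2 + C1 * \<bar>t\<bar> ^ 3))"
  have W1: "1 \<le> W t x" if "x \<in> S" for t x
    using w_bd[OF that] by (simp add: W_def)
  have eig: "L g (\<lambda>y. exp (t * m y) * W t y) x \<le> q t * W t x"
    if t: "\<bar>t\<bar> \<le> 1" and x: "x \<in> S" for t x
  proof -
    have "L g (\<lambda>y. exp (t * m y) * W t y) x
        \<le> L g (\<lambda>y. 1 + t * m y + t\<^sup>2 * ((m y)\<^sup>2 / 2 + w y)) x + C1 * \<bar>t\<bar> ^ 3"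
      unfolding W_def by (rule L_le_add_const[OF pert[OF t] x])
    also have "L g (\<lambda>y. 1 + t * m y + t\<^sup>2 * ((m y)\<^sup>2 / 2 + w y)) x
        = 1 + t\<^sup>2 * (L g (\<lambda>x. (m x)\<^sup>2) x / 2 + L g w x)"
      using L_cmult[of g "1/2" "\<lambda>x. (m x)\<^sup>2"]
      by (simp add: L_add L_cmult L_one[OF x] m0[OF x])
    also have "\<dots> = W t x + t\<^sup>2 * \<rho> / 2"
      using w_eq[OF x] by (simp add: W_def algebra_simps add_divide_distrib)
    also have "W t x + t\<^sup>2 * \<rho> / 2 + C1 * \<bar>t\<bar> ^ 3 = W t x + (t\<^sup>2 * \<rho> / 2 + C1 * \<bar>t\<bar> ^ 3) * 1"
      by simp
    also have "\<dots> \<le> W t x + (t\<^sup>2 * \<rho> / 2 + C1 * \<bar>t\<bar> ^ 3) * W t x"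
      using W1[OF x] C1_nn \<rho>_nn by (intro add_left_mono mult_left_mono) auto
    also have "\<dots> = (1 + (t\<^sup>2 * \<rho> / 2 + C1 * \<bar>t\<bar> ^ 3)) * W t x" by (simp add: algebra_simps)
    also have "\<dots> \<le> q t * W t x"
      using W1[OF x, of t] unfolding q_def by (intro mult_right_mono exp_ge_add_one_self) auto
    finally show ?thesis .
  qed
  \<comment> \<open>Carrying the weight through the induction avoids a loss of a constant in every
    step. It is removed only at the end, where it lies between 1 and
    \<open>1 + 2 * R0\<close>.\<close>
  have it: "(L g ^^ n) (\<lambda>y. exp (t * birkhoff m n y) * W t y) x \<le> q t ^ n * W t x"
    if t: "\<bar>t\<bar> \<le> 1" and x: "x \<in> S" for t n x
    using x
  proof (induction n arbitrary: x)
    case (Suc n)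
    have e: "(\<lambda>y. exp (t * birkhoff m (Suc n) y) * W t y)
        = (\<lambda>y. (exp (t * m y) * W t y) * exp (t * birkhoff m n (shift y)))"
      by (auto simp: birkhoff_Suc exp_add algebra_simps)
    have "(L g ^^ Suc n) (\<lambda>y. exp (t * birkhoff m (Suc n) y) * W t y) x
        = (L g ^^ n) (L g (\<lambda>y. exp (t * birkhoff m (Suc n) y) * W t y)) x"
      by (simp add: funpow_swap1)
    also have "\<dots> = (L g ^^ n) (\<lambda>x. exp (t * birkhoff m n x) * L g (\<lambda>y. exp (t * m y) * W t y) x) x"
      unfolding e L_mult_shift[of g "\<lambda>y. exp (t * m y) * W t y" "\<lambda>y. exp (t * birkhoff m n y)"] ..
    also have "\<dots> \<le> (L g ^^ n) (\<lambda>x. exp (t * birkhoff m n x) * (q t * W t x)) x"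
      using eig[OF t] Suc.prems by (intro Ln_mono mult_left_mono) auto
    also have "\<dots> = (L g ^^ n) (\<lambda>x. q t * (exp (t * birkhoff m n x) * W t x)) x"
      by (simp add: mult_ac)
    also have "\<dots> = q t * (L g ^^ n) (\<lambda>x. exp (t * birkhoff m n x) * W t x) x"
      by (simp add: Ln_cmult)
    also have "\<dots> \<le> q t * (q t ^ n * W t x)"
      using Suc by (intro mult_left_mono) (auto simp: q_def)
    finally show ?case by (simp add: mult_ac)
  qed simp
  have "(L g ^^ n) (\<lambda>y. exp (t * birkhoff m n y)) x
      \<le> (1 + 2 * R0) * exp (real n * (t\<^sup>2 * \<rho> / 2 + C1 * \<bar>t\<bar> ^ 3))"
    if t: "\<bar>t\<bar> \<le> 1" and x: "x \<in> S" for t n x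
  proof -
    have "(L g ^^ n) (\<lambda>y. exp (t * birkhoff m n y)) x \<le> (L g ^^ n) (\<lambda>y. exp (t * birkhoff m n y) * W t y) x"
      using W1 x by (intro Ln_mono) (auto simp: mult_le_cancel_left1)
    also have "\<dots> \<le> q t ^ n * W t x" by (rule it[OF t x])
    also have "\<dots> \<le> q t ^ n * (1 + 2 * R0)"
    proof (rule mult_left_mono)
      have "t\<^sup>2 \<le> 1" using t by (simp add: abs_square_le_1)
      then have "t\<^sup>2 * w x \<le> 1 * (2 * R0)" using w_bd[OF x] by (intro mult_mono) auto
      then show "W t x \<le> 1 + 2 * R0" by (simp add: W_def)
    qed (simp add: q_def)
    also have "q t ^ n = exp (real n * (t\<^sup>2 * \<rho> / 2 + C1 * \<bar>t\<bar> ^ 3))"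
      by (simp add: q_def exp_of_nat_mult)
    finally show ?thesis by (simp add: mult_ac)
  qed
  then show ?thesis using C1_nn by blast
qed

end

subsection \<open>Words and cylinders\<close>

context sft
begin

abbreviation W :: "nat \<Rightarrow> nat list set" where "W \<equiv> words K A"
abbreviation Cyl :: "nat list \<Rightarrow> seq set" where "Cyl \<equiv> cyl K A"

lemma finite_words [simp]: "finite (W n)"
proof (rule finite_subset)
  show "W n \<subseteq> {w. set w \<subseteq> {1..K} \<and> length w = n}" by (auto simp: words_def)
  show "finite {w. set w \<subseteq> {1..K} \<and> length w = n}"
    by (rule finite_lists_length_eq) simp
qed

lemma length_prefix_word [simp]: "length (prefix_word x n) = n"
  by (simp add: prefix_word_def)

lemma nth_prefix_word [simp]: "l < n \<Longrightarrow> prefix_word x n ! l = x l"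
  by (simp add: prefix_word_def)

lemma prefix_word_eq_iff: "prefix_word x n = prefix_word y n \<longleftrightarrow> agree n x y"
  by (auto simp: list_eq_iff_nth_eq agree_def)

lemma words_length: "w \<in> W n \<Longrightarrow> length w = n"
  by (simp add: words_def)

lemma mem_cyl_iff: "length w = n \<Longrightarrow> x \<in> Cyl w \<longleftrightarrow> x \<in> S \<and> prefix_word x n = w"
  by (auto simp: cyl_def list_eq_iff_nth_eq)

lemma cyl_prefix_word: "Cyl (prefix_word x n) = {y \<in> S. agree n y x}"
  by (auto simp: mem_cyl_iff[of _ n] prefix_word_eq_iff)

lemma mem_cyl_prefix_word: "x \<in> S \<Longrightarrow> x \<in> Cyl (prefix_word x n)"
  by (simp add: cyl_prefix_word agree_def)

lemma prefix_word_in_words: "x \<in> S \<Longrightarrow> prefix_word x n \<in> W n"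
  using S_letter[of x] by (auto simp: words_def prefix_word_def SFT_def)

lemma prefix_word_add:
  "prefix_word x (n + k) = prefix_word x n @ prefix_word ((shift ^^ n) x) k"
  by (auto simp: list_eq_iff_nth_eq nth_append funpow_shift)

lemma take_prefix_word: "k \<le> n \<Longrightarrow> take k (prefix_word x n) = prefix_word x k"
  by (auto simp: list_eq_iff_nth_eq)

lemma shift_base_point: "shift (base_point a) = base_point (next_letter a)"
  by (auto simp: base_point_def shift_def funpow_swap1)

lemma next_letter_mem: "a \<in> {1..K} \<Longrightarrow> next_letter a \<in> {1..K}"
  using S_letter[OF base_point_in_S, of a 1] by (simp add: base_point_def)

lemma word_extension:
  "w \<in> W n \<Longrightarrow> \<exists>y\<in>S. prefix_word y n = w \<and> (\<exists>c\<in>{1..K}. (shift ^^ n) y = base_point c)"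
proof (induction n arbitrary: w)
  case 0
  then have "w = []" by (simp add: words_def)
  then show ?case using K2 by (intro bexI[of _ "base_point 1"]) (auto simp: prefix_word_def intro!: base_point_in_S bexI[of _ 1])
next
  case (Suc n)
  then obtain a w' where w: "w = a # w'" using words_length[OF Suc.prems] by (cases w) auto
  have a: "a \<in> {1..K}" using Suc.prems by (auto simp: words_def w)
  have pw: "prefix_word (scons a y) (Suc n) = a # prefix_word y n" for y
    using prefix_word_add[of "scons a y" 1 n] by (simp add: prefix_word_def)
  show ?case
  proof (cases "n = 0")
    case True
    then have "w' = []" using words_length[OF Suc.prems] w by simp
    moreover have "prefix_word (base_point a) (Suc 0) = [a]" by (simp add: prefix_word_def)
    ultimately show ?thesis
      using a True w shift_base_point[of a] next_letter_mem[OF a] base_point_in_S[OF a]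
      by (intro bexI[of _ "base_point a"] conjI bexI[of _ "next_letter a"]) auto
  next
    case False
    have "w' \<in> W n"
    proof -
      have "A (w' ! l) (w' ! Suc l) = 1" if "Suc l < n" for l
      proof -
        have "Suc (Suc l) < Suc n" using that by simp
        then have "A (w ! Suc l) (w ! Suc (Suc l)) = 1" using Suc.prems unfolding words_def by blast
        then show ?thesis by (simp add: w)
      qed
      then show ?thesis using Suc.prems by (auto simp: words_def w)
    qed
    from Suc.IH[OF this] obtain y c where y: "y \<in> S" "prefix_word y n = w'" "c \<in> {1..K}"
      "(shift ^^ n) y = base_point c" by blast
    have "y 0 = w' ! 0" using y(2) False nth_prefix_word[of 0 n y] by simp
    moreover have "A a (w' ! 0) = 1"
    proof -
      have "Suc 0 < Suc n" using False by simp
      then have "A (w ! 0) (w ! Suc 0) = 1" using Suc.prems unfolding words_def by blast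
      then show ?thesis by (simp add: w)
    qed
    ultimately have "scons a y \<in> S" using y a by (intro scons_in_S) auto
    then show ?thesis
      using y w pw[of y]
      by (intro bexI[of _ "scons a y"] conjI bexI[of _ c]) (auto simp: funpow_Suc_right simp del: funpow.simps(2))
  qed
qed

text \<open>Each word is represented by a point whose n-th shift is one of the \<open>K\<close> base
  points. A sum over words of length \<open>n\<close> is then a sum over n-th preimages of finitely
  many points, which \<open>L^n\<close> bounds.\<close>

definition ext :: "nat \<Rightarrow> nat list \<Rightarrow> seq" where
  "ext n w = (SOME y. y \<in> S \<and> prefix_word y n = w \<and> (\<exists>c\<in>{1..K}. (shift ^^ n) y = base_point c))"

lemma ext:
  assumes "w \<in> W n"
  shows ext_in_S: "ext n w \<in> S" and prefix_ext: "prefix_word (ext n w) n = w"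
    and shift_ext: "\<exists>c\<in>{1..K}. (shift ^^ n) (ext n w) = base_point c"
proof -
  have "\<exists>y. y \<in> S \<and> prefix_word y n = w \<and> (\<exists>c\<in>{1..K}. (shift ^^ n) y = base_point c)"
    using word_extension[OF assms] by blast
  from someI_ex[OF this] show "ext n w \<in> S" "prefix_word (ext n w) n = w"
    "\<exists>c\<in>{1..K}. (shift ^^ n) (ext n w) = base_point c"
    unfolding ext_def by blast+
qed

lemma agree_ext: "x \<in> S \<Longrightarrow> agree n x (ext n (prefix_word x n))"
  using prefix_ext[OF prefix_word_in_words, of x n] by (metis prefix_word_eq_iff)

text \<open>Unfolded, \<open>L^n F x\<close> is the sum over all n-th preimages of \<open>x\<close>,
  of which \<open>Y\<close> is a part, and the terms are nonnegative. The induction groups the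
  points of \<open>Y\<close> by their first shift.\<close>

lemma sum_preimages_le_Ln:
  assumes F: "\<And>y. y \<in> S \<Longrightarrow> F y \<ge> 0" and "finite Y"
    and "Y \<subseteq> {y \<in> S. (shift ^^ n) y = x}" "x \<in> S"
  shows "(\<Sum>y\<in>Y. exp (birkhoff g n y) * F y) \<le> (L g ^^ n) F x"
  using assms
proof (induction n arbitrary: F Y)
  case 0
  then have "Y \<subseteq> {x}" by auto
  then have "Y = {} \<or> Y = {x}" by auto
  then show ?case using 0 by auto
next
  case (Suc n)
  have inner: "(\<Sum>y\<in>{y\<in>Y. shift y = z}. exp (g y) * F y) \<le> L g F z" if z: "z \<in> S" for z
  proof -
    have inj: "inj_on (\<lambda>y. y 0) {y\<in>Y. shift y = z}"
      by (rule inj_onI) (metis (mono_tags, lifting) mem_Collect_eq scons_shift)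
    have "(\<Sum>y\<in>{y\<in>Y. shift y = z}. exp (g y) * F y)
        = (\<Sum>y\<in>{y\<in>Y. shift y = z}. exp (g (scons (y 0) z)) * F (scons (y 0) z))"
      by (intro sum.cong) auto
    also have "\<dots> = (\<Sum>a\<in>(\<lambda>y. y 0) ` {y\<in>Y. shift y = z}. exp (g (scons a z)) * F (scons a z))"
      by (subst sum.reindex[OF inj]) simp
    also have "\<dots> \<le> (\<Sum>a\<in>pred_letters (z 0). exp (g (scons a z)) * F (scons a z))"
    proof (rule sum_mono2)
      show "(\<lambda>y. y 0) ` {y\<in>Y. shift y = z} \<subseteq> pred_letters (z 0)"
        using S_pred_letters Suc.prems(3) by auto
      show "0 \<le> exp (g (scons a z)) * F (scons a z)"
        if "a \<in> pred_letters (z 0) - (\<lambda>y. y 0) ` {y\<in>Y. shift y = z}" for a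
        using scons_pred_in_S[OF z, of a] that Suc.prems(1) by simp
    qed simp
    finally show ?thesis by (simp add: transfer_eq)
  qed
  have "(\<Sum>y\<in>Y. exp (birkhoff g (Suc n) y) * F y)
      = (\<Sum>z\<in>shift ` Y. \<Sum>y\<in>{y\<in>Y. shift y = z}. exp (birkhoff g (Suc n) y) * F y)"
    using Suc.prems by (intro sum.image_gen) auto
  also have "\<dots> = (\<Sum>z\<in>shift ` Y. exp (birkhoff g n z) * (\<Sum>y\<in>{y\<in>Y. shift y = z}. exp (g y) * F y))"
    unfolding sum_distrib_left
    by (intro sum.cong) (auto simp: birkhoff_Suc exp_add)
  also have "\<dots> \<le> (\<Sum>z\<in>shift ` Y. exp (birkhoff g n z) * L g F z)"
    using Suc.prems(3) by (intro sum_mono mult_left_mono inner) (auto intro: shift_in_S)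
  also have "\<dots> \<le> (L g ^^ n) (L g F) x"
  proof (rule Suc.IH)
    show "shift ` Y \<subseteq> {y \<in> S. (shift ^^ n) y = x}"
      using Suc.prems(3) by (auto simp: shift_in_S funpow_swap1)
  qed (use Suc.prems L_nonneg in auto)
  finally show ?case by (simp add: funpow_swap1)
qed

lemma sum_words_le_Ln:
  assumes F: "\<And>y. y \<in> S \<Longrightarrow> F y \<ge> 0"
  shows "(\<Sum>w\<in>W n. exp (birkhoff g n (ext n w)) * F (ext n w)) \<le> (\<Sum>c\<in>{1..K}. (L g ^^ n) F (base_point c))"
proof -
  define Y where "Y = ext n ` W n"
  have inj: "inj_on (ext n) (W n)" by (rule inj_onI) (metis prefix_ext)
  have Y: "finite Y" "Y \<subseteq> S" by (auto simp: Y_def ext_in_S)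
  have bp_inj: "inj_on base_point {1..K}" by (rule inj_onI) (metis base_point_0)
  have "(\<Sum>w\<in>W n. exp (birkhoff g n (ext n w)) * F (ext n w)) = (\<Sum>y\<in>Y. exp (birkhoff g n y) * F y)"
    unfolding Y_def by (subst sum.reindex[OF inj]) simp
  also have "\<dots> = (\<Sum>z\<in>(shift ^^ n) ` Y. \<Sum>y\<in>{y\<in>Y. (shift ^^ n) y = z}. exp (birkhoff g n y) * F y)"
    using Y by (intro sum.image_gen)
  also have "\<dots> \<le> (\<Sum>z\<in>(shift ^^ n) ` Y. (L g ^^ n) F z)"
    using Y F by (intro sum_mono sum_preimages_le_Ln) (auto intro: funpow_shift_in_S)
  also have "\<dots> \<le> (\<Sum>z\<in>base_point ` {1..K}. (L g ^^ n) F z)"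
  proof (rule sum_mono2)
    show "(shift ^^ n) ` Y \<subseteq> base_point ` {1..K}" using shift_ext by (force simp: Y_def)
    show "0 \<le> (L g ^^ n) F z" if "z \<in> base_point ` {1..K} - (shift ^^ n) ` Y" for z
      using that F by (auto intro!: Ln_nonneg base_point_in_S)
  qed simp
  also have "\<dots> = (\<Sum>c\<in>{1..K}. (L g ^^ n) F (base_point c))"
    by (subst sum.reindex[OF bp_inj]) simp
  finally show ?thesis .
qed

subsection \<open>Topology and measurability\<close>

lemma open_agree: "open {y. agree n y x}"
proof -
  have "{y. agree n y x} = (\<Inter>l<n. (\<lambda>y. y l) -` {x l})" by (auto simp: agree_def)
  moreover have "open ((\<lambda>y::seq. y l) -` {x l})" for l
    by (intro open_vimage continuous_on_product_coordinates) (simp add: Topological_Spaces.open_discrete)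
  ultimately show ?thesis by auto
qed

lemma hol_continuous:
  assumes h: "hol \<alpha> C \<phi>" and \<alpha>: "0 < \<alpha>" "\<alpha> < 1"
  shows "continuous_on S \<phi>"
  unfolding continuous_on_def
proof (intro ballI)
  fix x assume x: "x \<in> S"
  show "(\<phi> \<longlongrightarrow> \<phi> x) (at x within S)"
  proof (rule tendstoI)
    fix e :: real assume "e > 0"
    have "(\<lambda>n. C * \<alpha> ^ n) \<longlonglongrightarrow> 0" using \<alpha> by (rule geometric_null)
    then have "eventually (\<lambda>n. C * \<alpha> ^ n < e) sequentially" using \<open>e > 0\<close> by (intro order_tendstoD(2)) auto
    then obtain n where n: "C * \<alpha> ^ n < e" by (auto simp: eventually_sequentially)
    have "dist (\<phi> y) (\<phi> x) < e" if "agree n y x" "y \<in> S" for y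
      using holD[OF h that(2) x that(1)] n by (simp add: dist_real_def)
    then show "\<forall>\<^sub>F y in at x within S. dist (\<phi> y) (\<phi> x) < e"
      unfolding eventually_at_topological
      using open_agree[of n x] by (intro exI[of _ "{y. agree n y x}"]) (auto simp: agree_def)
  qed
qed

lemma coordinate_measurable: "(\<lambda>y::seq. y l) -` X \<in> sets borel"
proof -
  have "open ((\<lambda>y::seq. y l) -` X)"
    by (intro open_vimage continuous_on_product_coordinates) (simp add: Topological_Spaces.open_discrete)
  then show ?thesis by simp
qed

lemma S_measurable: "S \<in> sets borel"
proof -
  have "(\<lambda>y. y l) -` {1..K} \<inter> (\<Union>a. (\<lambda>y. y l) -` {a} \<inter> (\<lambda>y. y (Suc l)) -` {b. A a b = 1}) \<in> sets borel"
    (is "?X l \<in> _") for l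
    by (intro sets.Int sets.countable_UN'' coordinate_measurable) auto
  then have "(\<Inter>l. ?X l) \<in> sets borel" by (intro sets.countable_INT'') auto
  also have "(\<Inter>l. ?X l) = S"
    by (auto simp: SFT_def full_shift_def)
  finally show ?thesis .
qed

lemma cyl_measurable: "Cyl w \<in> sets borel"
proof -
  have "Cyl w = S \<inter> {y. agree (length w) y (\<lambda>l. w ! l)}" by (auto simp: cyl_def agree_def)
  then show ?thesis using S_measurable open_agree[of "length w" "\<lambda>l. w ! l"] by auto
qed

lemma shift_measurable: "shift \<in> borel_measurable borel"
proof (rule borel_measurable_continuous_onI)
  show "continuous_on UNIV shift"
    unfolding shift_def by (intro continuous_on_coordinatewise_then_product continuous_on_product_coordinates)
qed

end

section \<open>Integration against an invariant measure on the subshift\<close>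

locale invariant_measure = sft K A p
  for K :: nat and A :: "nat \<Rightarrow> nat \<Rightarrow> nat" and p :: nat +
  fixes M :: "seq measure"
  assumes sets_M: "sets M = sets borel" and prob_M: "prob_space M" and M_S: "measure M S = 1"
    and invariant: "shift_invariant M"
begin

sublocale prob_space M by (rule prob_M)

lemma space_M [simp]: "space M = UNIV"
  using sets_eq_imp_space_eq[OF sets_M] by simp

lemma S_sets [measurable]: "S \<in> sets M" and cyl_sets [measurable]: "Cyl w \<in> sets M"
  using S_measurable cyl_measurable by (simp_all add: sets_M)

lemma AE_S: "AE x in M. x \<in> S"
  using prob_eq_1[OF S_sets] M_S by simp

abbreviation mass :: "nat list \<Rightarrow> real" where
  "mass w \<equiv> measure M (Cyl w)"

text \<open>The indicator matches the integrals in \<open>variance_of\<close>; functions are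
  controlled on \<open>S\<close> only.\<close>

abbreviation I :: "(seq \<Rightarrow> real) \<Rightarrow> real" where
  "I \<phi> \<equiv> (\<integral>i. indicator S i * \<phi> i \<partial>M)"

text \<open>A function of the first \<open>n\<close> letters is a finite combination of indicators
  of cylinders, so measurability and integrability come for free and integrals become sums over
  words.\<close>

lemma indicator_prefix_sum:
  "indicator S i * G (prefix_word i n) = (\<Sum>w\<in>W n. G w * indicator (Cyl w) i)" for G :: "nat list \<Rightarrow> real"
proof (cases "i \<in> S")
  case True
  have "(\<Sum>w\<in>W n. G w * indicator (Cyl w) i) = (\<Sum>w\<in>W n. if w = prefix_word i n then G w else 0)"
    using True by (intro sum.cong) (auto simp: indicator_def mem_cyl_iff words_length)
  also have "\<dots> = G (prefix_word i n)"
    using prefix_word_in_words[OF True, of n] by (simp add: sum.delta)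
  finally show ?thesis using True by simp
next
  case False
  then show ?thesis by (auto simp: indicator_def cyl_def intro!: sum.neutral)
qed

lemma integrable_prefix: "integrable M (\<lambda>i. indicator S i * G (prefix_word i n) :: real)"
  unfolding indicator_prefix_sum
  by (intro Bochner_Integration.integrable_sum integrable_mult_right integrable_real_indicator)
     (auto simp: less_top[symmetric])

lemma integral_prefix: "I (\<lambda>i. G (prefix_word i n)) = (\<Sum>w\<in>W n. mass w * G w)"
proof -
  have "integrable M (\<lambda>i. G w * indicator (Cyl w) i)" for w
    by (intro integrable_mult_right integrable_real_indicator) (auto simp: less_top[symmetric])
  then show ?thesis
    unfolding indicator_prefix_sum
    by (subst Bochner_Integration.integral_sum) (auto simp: mult.commute)
qed

lemma sum_cyl: "(\<Sum>w\<in>W n. mass w) = 1"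
  using integral_prefix[of "\<lambda>_. 1" n] M_S by simp

lemma prefix_set_eq: "X \<subseteq> W n \<Longrightarrow> {i \<in> S. prefix_word i n \<in> X} = (\<Union>w\<in>X. Cyl w)"
  using mem_cyl_prefix_word by (auto simp: mem_cyl_iff[OF words_length] subset_iff)

lemma prefix_set_sets [measurable]: "{i \<in> S. prefix_word i n \<in> X} \<in> sets M"
proof -
  have "{i \<in> S. prefix_word i n \<in> X} = (\<Union>w\<in>X \<inter> W n. Cyl w)"
    using prefix_set_eq[of "X \<inter> W n" n] prefix_word_in_words by auto
  also have "\<dots> \<in> sets M" by (intro sets.finite_UN) (auto intro: finite_subset[OF _ finite_words[of n]])
  finally show ?thesis .
qed

lemma measure_prefix_set: "measure M {i \<in> S. prefix_word i n \<in> X} = (\<Sum>w\<in>X \<inter> W n. mass w)"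
proof -
  have "{i \<in> S. prefix_word i n \<in> X} = (\<Union>w\<in>X \<inter> W n. Cyl w)"
    using prefix_set_eq[of "X \<inter> W n" n] prefix_word_in_words by auto
  also have "measure M \<dots> = (\<Sum>w\<in>X \<inter> W n. mass w)"
  proof (rule finite_measure_finite_Union)
    show "disjoint_family_on Cyl (X \<inter> W n)"
      by (auto simp: disjoint_family_on_def mem_cyl_iff[OF words_length])
  qed auto
  finally show ?thesis .
qed

lemma hol_integrable:
  assumes h: "hol \<alpha> C \<phi>" and \<alpha>: "0 < \<alpha>" "\<alpha> < 1"
  shows "integrable M (\<lambda>i. indicator S i * \<phi> i)"
proof (rule integrable_const_bound[of _ "\<bar>\<phi> origin\<bar> + C"])
  have "(\<lambda>i. indicator S i *\<^sub>R \<phi> i) \<in> borel_measurable borel"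
    by (intro borel_measurable_continuous_on_indicator S_measurable hol_continuous[OF h \<alpha>])
  then show "(\<lambda>i. indicator S i * \<phi> i) \<in> borel_measurable M"
    by (simp add: measurable_cong_sets[OF sets_M refl])
  show "AE i in M. norm (indicator S i * \<phi> i) \<le> \<bar>\<phi> origin\<bar> + C"
    using AE_S by eventually_elim (use hol_bounded[OF h] in auto)
qed

lemma I_mono:
  assumes "integrable M (\<lambda>i. indicator S i * \<phi> i)" "integrable M (\<lambda>i. indicator S i * \<psi> i)"
    and "\<And>i. i \<in> S \<Longrightarrow> \<phi> i \<le> \<psi> i"
  shows "I \<phi> \<le> I \<psi>"
  using assms by (intro integral_mono) (auto simp: indicator_def)

lemma I_cong: "(\<And>i. i \<in> S \<Longrightarrow> \<phi> i = \<psi> i) \<Longrightarrow> I \<phi> = I \<psi>"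
  by (intro Bochner_Integration.integral_cong) (auto simp: indicator_def)

lemma I_const: "I (\<lambda>_. c) = c"
  using M_S by simp

lemma I_add:
  assumes "integrable M (\<lambda>i. indicator S i * \<phi> i)" "integrable M (\<lambda>i. indicator S i * \<psi> i)"
  shows "I (\<lambda>i. \<phi> i + \<psi> i) = I \<phi> + I \<psi>"
  using assms by (simp add: distrib_left)

lemma I_diff:
  assumes "integrable M (\<lambda>i. indicator S i * \<phi> i)" "integrable M (\<lambda>i. indicator S i * \<psi> i)"
  shows "I (\<lambda>i. \<phi> i - \<psi> i) = I \<phi> - I \<psi>"
  using assms by (simp add: right_diff_distrib)

lemma I_cmult: "I (\<lambda>i. c * \<phi> i) = c * I \<phi>"
  by (simp add: mult.left_commute)

lemma distr_shift: "distr M M shift = M"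
proof (rule measure_eqI)
  fix B assume "B \<in> sets (distr M M shift)"
  then have B: "B \<in> sets M" by simp
  have sm: "shift \<in> measurable M M"
    using shift_measurable by (simp add: measurable_cong_sets[OF sets_M sets_M])
  have "emeasure (distr M M shift) B = emeasure M (shift -` B)"
    using emeasure_distr[OF sm B] by simp
  also have "\<dots> = emeasure M B"
    using invariant B by (simp add: emeasure_eq_measure shift_invariant_def)
  finally show "emeasure (distr M M shift) B = emeasure M B" .
qed simp

lemma I_shift:
  assumes "integrable M (\<lambda>i. indicator S i * \<phi> i)"
  shows "I (\<lambda>i. \<phi> (shift i)) = I \<phi>"
proof -
  have sm: "shift \<in> measurable M M"
    using shift_measurable by (simp add: measurable_cong_sets[OF sets_M sets_M])
  have meas: "(\<lambda>i. indicator S i * \<phi> i) \<in> borel_measurable M" using assms by auto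
  have "I \<phi> = (\<integral>i. indicator S i * \<phi> i \<partial>(distr M M shift))" by (simp add: distr_shift)
  also have "\<dots> = (\<integral>i. indicator S (shift i) * \<phi> (shift i) \<partial>M)"
    by (rule integral_distr[OF sm meas])
  also have "\<dots> = I (\<lambda>i. \<phi> (shift i))"
  \<comment> \<open>A sequence outside \<open>S\<close> may be shifted into \<open>S\<close>, so the
    two integrands agree only almost everywhere.\<close>
  proof (rule integral_cong_AE)
    have m: "(\<lambda>i. indicator S (shift i) * \<phi> (shift i)) \<in> borel_measurable M"
      using measurable_compose[OF sm meas] by simp
    then show "(\<lambda>i. indicator S (shift i) * \<phi> (shift i)) \<in> borel_measurable M" .
    \<comment> \<open>Nothing is known about \<phi> off \<open>S\<close>. The second integrand is
      measurable because it is the first one times the indicator of \<open>S\<close>.\<close>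
    have "(\<lambda>i. indicator S i * (indicator S (shift i) * \<phi> (shift i))) \<in> borel_measurable M"
      using m by measurable
    moreover have "indicator S i * (indicator S (shift i) * \<phi> (shift i)) = indicator S i * \<phi> (shift i)" for i
      by (auto simp: indicator_def shift_in_S)
    ultimately show "(\<lambda>i. indicator S i * \<phi> (shift i)) \<in> borel_measurable M" by simp
    show "AE i in M. indicator S (shift i) * \<phi> (shift i) = indicator S i * \<phi> (shift i)"
      using AE_S by eventually_elim (auto simp: shift_in_S)
  qed
  finally show ?thesis ..
qed

end

subsection \<open>Gibbs measures of normalised potentials\<close>

text \<open>The Gibbs inequality with the pressure normalised to 0, and with \<open>n = 0\<close>
  included.\<close>

locale gibbs_normalised =
  normalised K A p g b \<alpha> + invariant_measure K A p M
  for K :: nat and A :: "nat \<Rightarrow> nat \<Rightarrow> nat" and p :: nat and g :: "seq \<Rightarrow> real"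
    and b \<alpha> :: real and M :: "seq measure" +
  fixes Cg :: real
  assumes Cg: "Cg \<ge> 1"
    and gibbs_lower: "\<And>i n. i \<in> S \<Longrightarrow> exp (birkhoff g n i) / Cg \<le> mass (prefix_word i n)"
    and gibbs_upper: "\<And>i n. i \<in> S \<Longrightarrow> mass (prefix_word i n) \<le> Cg * exp (birkhoff g n i)"
begin

lemma cyl_pos: "i \<in> S \<Longrightarrow> mass (prefix_word i n) > 0"
  using gibbs_lower[of i n] Cg by (smt (verit) divide_pos_pos exp_gt_zero)

lemma hol_int: "hol \<alpha> C \<phi> \<Longrightarrow> integrable M (\<lambda>i. indicator S i * \<phi> i)"
  using hol_integrable \<alpha> by blast

text \<open>The Gibbs inequality replaces the measure of a word by the weight
  \<open>exp (birkhoff g n y)\<close> of its representative \<open>y\<close>, and sums with these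
  weights are bounded through \<open>L^n\<close> at the base points. Thus bounds on
  \<open>L^n F\<close> become bounds on expectations before the integral is identified with
  \<open>nu\<close>.\<close>

lemma moment_bound:
  assumes F: "\<And>y. y \<in> S \<Longrightarrow> F y \<ge> 0"
    and le: "\<And>c. c \<in> {1..K} \<Longrightarrow> (L g ^^ n) F (base_point c) \<le> D"
  shows "(\<Sum>w\<in>W n. mass w * F (ext n w)) \<le> Cg * (real K * D)"
proof -
  have "(\<Sum>w\<in>W n. mass w * F (ext n w))
      \<le> (\<Sum>w\<in>W n. Cg * (exp (birkhoff g n (ext n w)) * F (ext n w)))"
  proof (rule sum_mono)
    fix w assume w: "w \<in> W n"
    have "mass w \<le> Cg * exp (birkhoff g n (ext n w))"
      using gibbs_upper[OF ext_in_S[OF w], of n] prefix_ext[OF w] by simp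
    then have "mass w * F (ext n w) \<le> Cg * exp (birkhoff g n (ext n w)) * F (ext n w)"
      using F ext_in_S[OF w] by (intro mult_right_mono) auto
    then show "mass w * F (ext n w) \<le> Cg * (exp (birkhoff g n (ext n w)) * F (ext n w))"
      by (simp add: mult.assoc)
  qed
  also have "\<dots> = Cg * (\<Sum>w\<in>W n. exp (birkhoff g n (ext n w)) * F (ext n w))"
    by (simp add: sum_distrib_left)
  also have "\<dots> \<le> Cg * (\<Sum>c\<in>{1..K}. (L g ^^ n) F (base_point c))"
    using Cg F by (intro mult_left_mono sum_words_le_Ln) auto
  also have "\<dots> \<le> Cg * (\<Sum>c\<in>{1..K}. D)"
    using Cg le by (intro mult_left_mono sum_mono) auto
  finally show ?thesis by simp
qed

lemma second_moment_words:
  assumes m0: "\<And>x. x \<in> S \<Longrightarrow> L g m x = 0" and R: "\<And>x. x \<in> S \<Longrightarrow> \<bar>m x\<bar> \<le> R"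
  shows "(\<Sum>w\<in>W n. mass w * (birkhoff m n (ext n w))\<^sup>2) \<le> Cg * (real K * (real n * R\<^sup>2))"
  by (rule moment_bound) (auto intro!: birkhoff_second_moment m0 R base_point_in_S)

lemma I_birkhoff:
  assumes h: "hol \<alpha> C \<phi>"
  shows "I (birkhoff \<phi> n) = real n * I \<phi>"
proof (induction n)
  case 0
  then show ?case by (simp add: birkhoff_def)
next
  case (Suc n)
  obtain D where D: "hol \<alpha> D (birkhoff \<phi> n)" using hol_birkhoff[OF h \<alpha>] by blast
  have "I (birkhoff \<phi> (Suc n)) = I (\<lambda>x. \<phi> x + birkhoff \<phi> n (shift x))"
    by (simp add: birkhoff_Suc)
  also have "\<dots> = I \<phi> + I (\<lambda>x. birkhoff \<phi> n (shift x))"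
    by (rule I_add[OF hol_int[OF h] hol_int[OF hol_shift[OF D \<alpha>]]])
  also have "I (\<lambda>x. birkhoff \<phi> n (shift x)) = I (birkhoff \<phi> n)"
    by (rule I_shift[OF hol_int[OF D]])
  finally show ?case using Suc by (simp add: algebra_simps)
qed

text \<open>By invariance the n-th Birkhoff sum has mean \<open>n * I m\<close>, while the second
  moment bound keeps this mean of order \<open>sqrt n\<close>. The integral is not yet known to be
  preserved by \<open>L\<close>, so \<open>L m = 0\<close> cannot simply be integrated.\<close>

lemma I_martingale:
  assumes hm: "hol \<alpha> Cm m" and m0: "\<And>x. x \<in> S \<Longrightarrow> L g m x = 0"
  shows "I m = 0"
proof -
  define R where "R = \<bar>m origin\<bar> + Cm"
  have R: "\<bar>m x\<bar> \<le> R" if "x \<in> S" for x unfolding R_def by (rule hol_bounded[OF hm that])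
  define D where "D = Cm / (1 - \<alpha>)"
  have D: "D \<ge> 0" using hol_nonneg[OF hm] \<alpha> by (simp add: D_def)
  define E where "E = 1 + Cg * (real K * R\<^sup>2)"
  have bound: "\<bar>I m\<bar> \<le> (E + D) / sqrt (real n)" if n: "n \<ge> 1" for n
  proof -
    define s where "s = sqrt (real n)"
    have s: "s \<ge> 1" "s * s = real n" using n by (auto simp: s_def)
    define H where "H = (\<lambda>w. (s + D) + (birkhoff m n (ext n w))\<^sup>2 * (1 / s))"
    \<comment> \<open>A substitute for the Cauchy-Schwarz inequality; the scale
      \<open>s = sqrt n\<close> makes both terms of mean order \<open>sqrt n\<close>.\<close>
    have young: "\<bar>a\<bar> \<le> s + a\<^sup>2 * (1 / s)" for a :: real
    proof -
      have "0 \<le> (\<bar>a\<bar> - s)\<^sup>2 + s * \<bar>a\<bar>" using s by simp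
      then have "\<bar>a\<bar> * s \<le> s * s + a\<^sup>2" by (simp add: power2_diff power2_eq_square algebra_simps)
      then show ?thesis using s by (simp add: field_simps)
    qed
    have ptw: "\<bar>birkhoff m n i\<bar> \<le> H (prefix_word i n)" if i: "i \<in> S" for i
    proof -
      define y where "y = ext n (prefix_word i n)"
      have "\<bar>birkhoff m n i - birkhoff m n y\<bar> \<le> D" unfolding D_def y_def
        by (rule birkhoff_distortion[OF hm \<alpha> i ext_in_S[OF prefix_word_in_words[OF i]] agree_ext[OF i]])
      then show ?thesis using young[of "birkhoff m n y"] unfolding H_def y_def[symmetric] by linarith
    qed
    have IH: "I (\<lambda>i. H (prefix_word i n)) \<le> (E + D) * s"
    proof -
      have "I (\<lambda>i. H (prefix_word i n)) = (\<Sum>w\<in>W n. mass w * H w)"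
        by (rule integral_prefix)
      also have "\<dots> = (s + D) + (\<Sum>w\<in>W n. mass w * (birkhoff m n (ext n w))\<^sup>2) * (1 / s)"
        unfolding H_def distrib_left sum.distrib mult.assoc[symmetric] sum_distrib_right[symmetric] sum_cyl
        by simp
      also have "\<dots> \<le> (s + D) + (Cg * (real K * (real n * R\<^sup>2))) * (1 / s)"
        using s second_moment_words[OF m0 R, of n] by (intro add_left_mono mult_right_mono) auto
      also have "\<dots> = E * s + D"
        using s(1) by (simp add: E_def s(2)[symmetric] field_simps)
      also have "\<dots> \<le> (E + D) * s" using s D by (simp add: algebra_simps mult_le_cancel_left1)
      finally show ?thesis .
    qed
    obtain Db where Db: "hol \<alpha> Db (birkhoff m n)" using hol_birkhoff[OF hm \<alpha>] by blast
    have i1: "integrable M (\<lambda>i. indicator S i * H (prefix_word i n))" by (rule integrable_prefix)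
    have "I (birkhoff m n) \<le> I (\<lambda>i. H (prefix_word i n))"
      using ptw by (intro I_mono hol_int[OF Db] i1) force
    moreover have "I (\<lambda>i. - 1 * birkhoff m n i) \<le> I (\<lambda>i. H (prefix_word i n))"
      using ptw by (intro I_mono hol_int[OF hol_cmult[OF Db]] i1) force
    ultimately have "\<bar>I (birkhoff m n)\<bar> \<le> (E + D) * s"
      unfolding I_cmult using IH by linarith
    then have "s * (s * \<bar>I m\<bar>) \<le> s * (E + D)"
      using I_birkhoff[OF hm, of n] s by (simp add: abs_mult flip: mult.assoc) (simp add: mult_ac)
    then have "s * \<bar>I m\<bar> \<le> E + D" using s by (simp add: mult_le_cancel_left)
    then show ?thesis using s(1) by (simp add: s_def[symmetric] field_simps)
  qed
  have "(\<lambda>n. (E + D) / sqrt (real n)) \<longlonglongrightarrow> 0"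
    by (intro real_tendsto_divide_at_top[of _ "E + D"] filterlim_compose[OF sqrt_at_top] filterlim_real_sequentially tendsto_const)
  then have "\<bar>I m\<bar> \<le> 0"
    by (rule LIMSEQ_le_const) (use bound in auto)
  then show ?thesis by simp
qed

text \<open>In the decomposition the martingale part has mean 0 by \<open>I_martingale\<close> and
  the coboundary by invariance.\<close>

theorem I_eq_nu:
  assumes h: "hol \<alpha> C \<phi>"
  shows "I \<phi> = nu \<phi>"
proof -
  obtain m v Cm Cv where hm: "hol \<alpha> Cm m" and hv: "hol \<alpha> Cv v" and m0: "\<And>x. x \<in> S \<Longrightarrow> L g m x = 0"
    and eq: "\<And>x. x \<in> S \<Longrightarrow> \<phi> x - nu \<phi> = m x + v (shift x) - v x"
    using martingale_decomposition[OF h] by blast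
  have hs: "hol \<alpha> (Cv / \<alpha>) (\<lambda>x. v (shift x))" by (rule hol_shift[OF hv \<alpha>])
  have "I \<phi> - nu \<phi> = I (\<lambda>x. \<phi> x - nu \<phi>)"
    using I_diff[OF hol_int[OF h] hol_int[OF hol_const[of \<alpha> "nu \<phi>"]]] by (simp only: I_const)
  also have "\<dots> = I (\<lambda>x. (m x + v (shift x)) - v x)" using eq by (intro I_cong) auto
  also have "\<dots> = I m + I (\<lambda>x. v (shift x)) - I v"
    using I_diff[OF hol_int[OF hol_add[OF hm hs]] hol_int[OF hv]] I_add[OF hol_int[OF hm] hol_int[OF hs]]
    by simp
  also have "\<dots> = 0" using I_martingale[OF hm m0] I_shift[OF hol_int[OF hv]] by simp
  finally show ?thesis by simp
qed

text \<open>The cross terms vanish because the integral is now \<open>nu\<close>, which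
  \<open>L\<close> preserves: \<open>L\<close> moves the Birkhoff sum out of the product and leaves
  the factor \<open>L m\<close>, which is 0 on \<open>S\<close>.\<close>

lemma I_martingale_square:
  assumes hm: "hol \<alpha> Cm m" and m0: "\<And>x. x \<in> S \<Longrightarrow> L g m x = 0"
  shows "I (\<lambda>x. (birkhoff m n x)\<^sup>2) = real n * nu (\<lambda>x. (m x)\<^sup>2)"
proof (induction n)
  case (Suc n)
  obtain D where D: "hol \<alpha> D (birkhoff m n)" using hol_birkhoff[OF hm \<alpha>] by blast
  have \<alpha>0: "\<alpha> \<ge> 0" using \<alpha> by simp
  obtain E1 where E1: "hol \<alpha> E1 (\<lambda>x. (m x)\<^sup>2)"
    using hol_mult[OF hm hm \<alpha>0] by (auto simp: power2_eq_square)
  obtain E2 where E2: "hol \<alpha> E2 (\<lambda>x. (birkhoff m n x)\<^sup>2)"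
    using hol_mult[OF D D \<alpha>0] by (auto simp: power2_eq_square)
  have E2': "hol \<alpha> (E2 / \<alpha>) (\<lambda>x. (birkhoff m n (shift x))\<^sup>2)" by (rule hol_shift[OF E2 \<alpha>])
  obtain E3 where E3: "hol \<alpha> E3 (\<lambda>x. m x * birkhoff m n (shift x))"
    using hol_mult[OF hm hol_shift[OF D \<alpha>] \<alpha>0] by blast
  have "I (\<lambda>x. m x * birkhoff m n (shift x)) = nu (L g (\<lambda>x. m x * birkhoff m n (shift x)))"
    by (simp add: I_eq_nu[OF E3] nu_L[OF E3])
  also have "\<dots> = nu (\<lambda>_. 0)"
  proof -
    have "(L g ^^ k) (\<lambda>x. birkhoff m n x * L g m x) origin = 0" for k
      using Ln_cong[of "\<lambda>x. birkhoff m n x * L g m x" "\<lambda>_. 0" origin] m0 Ln_const[OF origin_in_S, of k 0]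
      by simp
    then show ?thesis unfolding L_mult_shift[of g m "birkhoff m n"] nu_def
      by (simp add: Ln_const)
  qed
  finally have cross: "I (\<lambda>x. m x * birkhoff m n (shift x)) = 0" by (simp add: nu_const)
  have "I (\<lambda>x. (birkhoff m (Suc n) x)\<^sup>2)
      = I (\<lambda>x. ((m x)\<^sup>2 + (birkhoff m n (shift x))\<^sup>2) + 2 * (m x * birkhoff m n (shift x)))"
    by (simp add: birkhoff_Suc power2_sum algebra_simps)
  also have "\<dots> = I (\<lambda>x. (m x)\<^sup>2) + I (\<lambda>x. (birkhoff m n (shift x))\<^sup>2) + 2 * I (\<lambda>x. m x * birkhoff m n (shift x))"
    using I_add[OF hol_int[OF hol_add[OF E1 E2']] hol_int[OF hol_cmult[OF E3, of 2]]]
      I_add[OF hol_int[OF E1] hol_int[OF E2']] by (simp only: I_cmult)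
  also have "I (\<lambda>x. (birkhoff m n (shift x))\<^sup>2) = I (\<lambda>x. (birkhoff m n x)\<^sup>2)"
    by (rule I_shift[OF hol_int[OF E2]])
  finally show ?case using Suc cross I_eq_nu[OF E1] by (simp add: algebra_simps)
qed (simp add: birkhoff_def)

text \<open>Meant for the centred Birkhoff sums of the original potential, which differ from those
  of \<open>m\<close> by a bounded coboundary. The squares then differ by terms of mean order
  \<open>sqrt n\<close>, which disappear after division by \<open>n\<close>.\<close>

lemma variance_limit:
  assumes hm: "hol \<alpha> Cm m" and m0: "\<And>x. x \<in> S \<Longrightarrow> L g m x = 0"
    and hF: "\<And>n. \<exists>C. hol \<alpha> C (F n)"
    and close: "\<And>n x. x \<in> S \<Longrightarrow> \<bar>F n x - birkhoff m n x\<bar> \<le> E"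
  shows "(\<lambda>n. (1 / real n) * I (\<lambda>x. (F n x)\<^sup>2)) \<longlonglongrightarrow> nu (\<lambda>x. (m x)\<^sup>2)"
proof -
  define \<rho> where "\<rho> = nu (\<lambda>x. (m x)\<^sup>2)"
  have E: "E \<ge> 0" using close[OF origin_in_S, of 0] by linarith
  have \<alpha>0: "\<alpha> \<ge> 0" using \<alpha> by simp
  have est: "\<bar>(1 / real n) * I (\<lambda>x. (F n x)\<^sup>2) - \<rho>\<bar> \<le> (2 * E * (1 + \<rho>) + E\<^sup>2) / sqrt (real n)" if n: "n \<ge> 1" for n
  proof -
    define s where "s = sqrt (real n)"
    have s: "s \<ge> 1" "s * s = real n" using n by (auto simp: s_def)
    define a where "a = birkhoff m n"
    obtain D where D: "hol \<alpha> D a" unfolding a_def using hol_birkhoff[OF hm \<alpha>] by blast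
    obtain E2 where E2: "hol \<alpha> E2 (\<lambda>x. (a x)\<^sup>2)"
      using hol_mult[OF D D \<alpha>0] by (auto simp: power2_eq_square)
    obtain DF where DF: "hol \<alpha> DF (F n)" using hF by blast
    obtain EF where EF: "hol \<alpha> EF (\<lambda>x. (F n x)\<^sup>2)"
      using hol_mult[OF DF DF \<alpha>0] by (auto simp: power2_eq_square)
    define G where "G = (\<lambda>x. (2 * E / s) * (a x)\<^sup>2 + (2 * E * s + E\<^sup>2))"
    have hG: "hol \<alpha> (\<bar>2 * E / s\<bar> * E2 + 0) G" unfolding G_def by (intro hol_add hol_cmult E2 hol_const)
    have ptw: "\<bar>(F n x)\<^sup>2 - (a x)\<^sup>2\<bar> \<le> G x" if x: "x \<in> S" for x
    proof -
      define e where "e = F n x - a x"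
      have e: "\<bar>e\<bar> \<le> E" unfolding e_def a_def by (rule close[OF x])
      have "0 \<le> (\<bar>a x\<bar> - s)\<^sup>2 + s * \<bar>a x\<bar>" using s by simp
      then have "\<bar>a x\<bar> * s \<le> s * s + (a x)\<^sup>2" by (simp add: power2_diff power2_eq_square algebra_simps)
      then have y: "\<bar>a x\<bar> \<le> s + (a x)\<^sup>2 / s" using s by (simp add: field_simps)
      have "(F n x)\<^sup>2 - (a x)\<^sup>2 = 2 * (e * a x) + e\<^sup>2"
        by (simp add: e_def power2_eq_square algebra_simps)
      then have "\<bar>(F n x)\<^sup>2 - (a x)\<^sup>2\<bar> \<le> 2 * (\<bar>e\<bar> * \<bar>a x\<bar>) + e\<^sup>2"
        using abs_triangle_ineq[of "2 * (e * a x)" "e\<^sup>2"] by (simp add: abs_mult)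
      also have "\<dots> \<le> 2 * (E * (s + (a x)\<^sup>2 / s)) + E\<^sup>2"
        using e y E by (intro add_mono mult_left_mono mult_mono)
          (auto simp: abs_le_square_iff[symmetric])
      also have "\<dots> = G x" by (simp add: G_def algebra_simps)
      finally show ?thesis .
    qed
    have Ia: "I (\<lambda>x. (a x)\<^sup>2) = real n * \<rho>"
      unfolding a_def \<rho>_def by (rule I_martingale_square[OF hm m0])
    have IG: "I G = (2 * E / s) * (real n * \<rho>) + (2 * E * s + E\<^sup>2)"
      using I_add[OF hol_int[OF hol_cmult[OF E2, of "2 * E / s"]] hol_int[OF hol_const[of \<alpha> "2 * E * s + E\<^sup>2"]]]
      unfolding G_def I_cmult I_const Ia by simp
    have "I (\<lambda>x. (F n x)\<^sup>2 - (a x)\<^sup>2) \<le> I G"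
      using ptw by (intro I_mono hol_int[OF hol_diff[OF EF E2]] hol_int[OF hG]) force
    moreover have "I (\<lambda>x. - 1 * ((F n x)\<^sup>2 - (a x)\<^sup>2)) \<le> I G"
      using ptw by (intro I_mono hol_int[OF hol_cmult[OF hol_diff[OF EF E2]]] hol_int[OF hG]) force
    ultimately have "\<bar>I (\<lambda>x. (F n x)\<^sup>2 - (a x)\<^sup>2)\<bar> \<le> I G" unfolding I_cmult by linarith
    then have "\<bar>I (\<lambda>x. (F n x)\<^sup>2) - real n * \<rho>\<bar> \<le> (2 * E / s) * (real n * \<rho>) + (2 * E * s + E\<^sup>2)"
      using I_diff[OF hol_int[OF EF] hol_int[OF E2]] Ia IG by simp
    also have "\<dots> = 2 * E * (1 + \<rho>) * s + E\<^sup>2"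
      using s(1) by (simp add: s(2)[symmetric] field_simps)
    also have "\<dots> \<le> (2 * E * (1 + \<rho>) + E\<^sup>2) * s"
      using s E by (simp add: distrib_right mult_le_cancel_left1)
    finally have "\<bar>I (\<lambda>x. (F n x)\<^sup>2) - s * s * \<rho>\<bar> \<le> (2 * E * (1 + \<rho>) + E\<^sup>2) * s" using s by simp
    then have "\<bar>I (\<lambda>x. (F n x)\<^sup>2) - s * s * \<rho>\<bar> / (s * s) \<le> (2 * E * (1 + \<rho>) + E\<^sup>2) * s / (s * s)"
      using s by (intro divide_right_mono) auto
    moreover have "(1 / real n) * I (\<lambda>x. (F n x)\<^sup>2) - \<rho> = (I (\<lambda>x. (F n x)\<^sup>2) - s * s * \<rho>) / (s * s)"
      using s(1) by (simp add: s(2)[symmetric] field_simps)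
    ultimately show ?thesis using s(1) by (simp add: s_def[symmetric] abs_mult)
  qed
  have "(\<lambda>n. (2 * E * (1 + \<rho>) + E\<^sup>2) / sqrt (real n)) \<longlonglongrightarrow> 0"
    by (intro real_tendsto_divide_at_top[of _ "2 * E * (1 + \<rho>) + E\<^sup>2"] filterlim_compose[OF sqrt_at_top]
        filterlim_real_sequentially tendsto_const)
  then have "(\<lambda>n. (1 / real n) * I (\<lambda>x. (F n x)\<^sup>2) - \<rho>) \<longlonglongrightarrow> 0"
    by (rule Lim_null_comparison[rotated]) (use est in \<open>auto intro!: eventually_sequentiallyI[of 1]\<close>)
  then show ?thesis by (simp add: LIM_zero_iff \<rho>_def)
qed

text \<open>Cylinders of points of \<open>S\<close> have positive measure, so a Hoelder function
  whose square has integral 0 vanishes everywhere on \<open>S\<close>. The cohomology equation has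
  to hold at every point, not just almost everywhere.\<close>

lemma zero_variance:
  assumes hm: "hol \<alpha> Cm m" and 0: "nu (\<lambda>x. (m x)\<^sup>2) = 0" and x: "x \<in> S"
  shows "m x = 0"
proof (rule ccontr)
  assume nz: "m x \<noteq> 0"
  have "(\<lambda>n. Cm * \<alpha> ^ n) \<longlonglongrightarrow> 0" using \<alpha> by (rule geometric_null)
  then have "eventually (\<lambda>n. Cm * \<alpha> ^ n < \<bar>m x\<bar> / 2) sequentially" using nz by (intro order_tendstoD(2)) auto
  then obtain n where n: "Cm * \<alpha> ^ n < \<bar>m x\<bar> / 2" by (auto simp: eventually_sequentially)
  obtain E1 where E1: "hol \<alpha> E1 (\<lambda>x. (m x)\<^sup>2)"
    using hol_mult[OF hm hm] \<alpha> by (auto simp: power2_eq_square)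
  define H where "H = (\<lambda>w. if w = prefix_word x n then (m x / 2)\<^sup>2 else 0)"
  have "I (\<lambda>i. H (prefix_word i n)) = (\<Sum>w\<in>W n. mass w * H w)"
    by (rule integral_prefix)
  also have "\<dots> = (\<Sum>w\<in>W n. if w = prefix_word x n then mass w * (m x / 2)\<^sup>2 else 0)"
    unfolding H_def by (intro sum.cong) auto
  also have "\<dots> = mass (prefix_word x n) * (m x / 2)\<^sup>2"
    using prefix_word_in_words[OF x, of n] by (simp add: sum.delta)
  finally have "I (\<lambda>i. H (prefix_word i n)) > 0" using cyl_pos[OF x, of n] nz by simp
  moreover have "I (\<lambda>i. H (prefix_word i n)) \<le> I (\<lambda>x. (m x)\<^sup>2)"
  proof (rule I_mono[OF integrable_prefix hol_int[OF E1]])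
    fix i assume i: "i \<in> S"
    show "H (prefix_word i n) \<le> (m i)\<^sup>2"
    proof (cases "agree n i x")
      case True
      have "\<bar>m i - m x\<bar> < \<bar>m x\<bar> / 2" using holD[OF hm i x True] n by simp
      then have "\<bar>m x / 2\<bar> \<le> \<bar>m i\<bar>" by (auto simp: abs_if split: if_splits)
      then have "(m x / 2)\<^sup>2 \<le> (m i)\<^sup>2" unfolding abs_le_square_iff .
      then show ?thesis by (simp add: H_def)
    qed (simp add: H_def prefix_word_eq_iff)
  qed
  ultimately show False using I_eq_nu[OF E1] 0 by simp
qed

text \<open>The centred logarithm of the cylinder measure: \<open>nu g\<close> is minus the entropy
  by \<open>entropy_eq\<close>. Large values mean large cylinders, so only upper bounds are needed.
  As a function of words it yields events that are finite unions of cylinders.\<close>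

definition X :: "nat \<Rightarrow> nat list \<Rightarrow> real" where
  "X n w = ln (mass w) - real n * nu g"

lemma ln_cyl_close: "i \<in> S \<Longrightarrow> \<bar>ln (mass (prefix_word i n)) - birkhoff g n i\<bar> \<le> ln Cg"
proof -
  assume i: "i \<in> S"
  define \<mu> where "\<mu> = mass (prefix_word i n)"
  have \<mu>: "\<mu> > 0" unfolding \<mu>_def by (rule cyl_pos[OF i])
  have "ln (exp (birkhoff g n i) / Cg) \<le> ln \<mu>"
    using gibbs_lower[OF i, of n] Cg \<mu> by (subst ln_le_cancel_iff) (auto simp: \<mu>_def)
  moreover have "ln \<mu> \<le> ln (Cg * exp (birkhoff g n i))"
    using gibbs_upper[OF i, of n] Cg \<mu> by (subst ln_le_cancel_iff) (auto simp: \<mu>_def)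
  ultimately show ?thesis using Cg by (simp add: ln_div ln_mult \<mu>_def abs_le_iff)
qed

text \<open>Birkhoff sums add up exactly over the two blocks, and each of the three uses of the
  Gibbs inequality costs a factor \<open>Cg\<close>.\<close>

lemma quasi_bernoulli:
  assumes "i \<in> S"
  shows "mass (prefix_word i (n + k))
    \<le> Cg ^ 3 * (mass (prefix_word i n) * measure M (Cyl (prefix_word ((shift ^^ n) i) k)))"
proof -
  have i': "(shift ^^ n) i \<in> S" by (rule funpow_shift_in_S[OF assms])
  have 1: "exp (birkhoff g n i) \<le> Cg * mass (prefix_word i n)"
    "exp (birkhoff g k ((shift ^^ n) i)) \<le> Cg * measure M (Cyl (prefix_word ((shift ^^ n) i) k))"
    using gibbs_lower[OF assms, of n] gibbs_lower[OF i', of k] Cg by (auto simp: field_simps)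
  have "mass (prefix_word i (n + k)) \<le> Cg * (exp (birkhoff g n i) * exp (birkhoff g k ((shift ^^ n) i)))"
    using gibbs_upper[OF assms, of "n + k"] by (simp add: birkhoff_add exp_add)
  also have "\<dots> \<le> Cg * ((Cg * mass (prefix_word i n)) * (Cg * measure M (Cyl (prefix_word ((shift ^^ n) i) k))))"
    using Cg 1 by (intro mult_left_mono mult_mono) auto
  finally show ?thesis by (simp add: power3_eq_cube mult_ac)
qed

lemma X_superadditive:
  assumes "i \<in> S"
  shows "X n (prefix_word i n) + X k (prefix_word ((shift ^^ n) i) k) - 3 * ln Cg \<le> X (n + k) (prefix_word i (n + k))"
proof -
  have i': "(shift ^^ n) i \<in> S" by (rule funpow_shift_in_S[OF assms])
  show ?thesis
    using ln_cyl_close[OF assms, of n] ln_cyl_close[OF assms, of "n + k"] ln_cyl_close[OF i', of k]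
    unfolding X_def birkhoff_add of_nat_add distrib_right by linarith
qed

text \<open>The difference of \<open>X n w\<close> and the Birkhoff sum of \<open>m\<close> at the
  representative of \<open>w\<close> is at most \<open>E\<close>: \<open>ln Cg\<close> from the
  Gibbs inequality and \<open>2 * V\<close> from the coboundary. A bounded difference leaves the
  rate in the exponential moment untouched.\<close>

lemma word_moments:
  assumes hm: "hol \<alpha> Cm m" and hv: "hol \<alpha> Cv v" and m0: "\<And>x. x \<in> S \<Longrightarrow> L g m x = 0"
    and eq: "\<And>x. x \<in> S \<Longrightarrow> g x - nu g = m x + v (shift x) - v x"
  defines "\<rho> \<equiv> nu (\<lambda>x. (m x)\<^sup>2)"
  shows X_second_moment: "\<exists>C\<ge>0. \<forall>n\<ge>1. (\<Sum>w\<in>W n. mass w * (X n w)\<^sup>2) \<le> C * real n"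
    and X_exponential_moment: "\<exists>Q D. Q \<ge> 0 \<and> (\<forall>n t. \<bar>t\<bar> \<le> 1 \<longrightarrow>
      (\<Sum>w\<in>W n. mass w * exp (t * X n w)) \<le> D * exp (real n * (t\<^sup>2 * \<rho> / 2 + Q * \<bar>t\<bar> ^ 3)))"
proof -
  define V where "V = \<bar>v origin\<bar> + Cv"
  have V: "\<bar>v x\<bar> \<le> V" if "x \<in> S" for x unfolding V_def by (rule hol_bounded[OF hv that])
  define E where "E = ln Cg + 2 * V"
  have close: "\<bar>X n w - birkhoff m n (ext n w)\<bar> \<le> E" if w: "w \<in> W n" for n w
  proof -
    define y where "y = ext n w"
    have y: "y \<in> S" "prefix_word y n = w" unfolding y_def using ext_in_S[OF w] prefix_ext[OF w] by auto
    show ?thesis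
      using ln_cyl_close[OF y(1), of n] birkhoff_coboundary[of g "nu g" m v y n, OF eq y(1)]
        V[OF y(1)] V[OF funpow_shift_in_S[OF y(1)], of n]
      unfolding X_def y_def[symmetric] y(2) E_def by linarith
  qed
  have E: "E \<ge> 0" using Cg V[OF origin_in_S] by (simp add: E_def add_nonneg_nonneg)
  define R where "R = \<bar>m origin\<bar> + Cm"
  have R: "\<bar>m x\<bar> \<le> R" if "x \<in> S" for x unfolding R_def by (rule hol_bounded[OF hm that])
  show "\<exists>C\<ge>0. \<forall>n\<ge>1. (\<Sum>w\<in>W n. mass w * (X n w)\<^sup>2) \<le> C * real n"
  proof (intro exI[of _ "2 * (Cg * (real K * R\<^sup>2)) + 2 * E\<^sup>2"] conjI allI impI)
    show "0 \<le> 2 * (Cg * (real K * R\<^sup>2)) + 2 * E\<^sup>2" using Cg by simp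
    fix n :: nat assume n: "1 \<le> n"
    have "(\<Sum>w\<in>W n. mass w * (X n w)\<^sup>2)
        \<le> (\<Sum>w\<in>W n. 2 * (mass w * (birkhoff m n (ext n w))\<^sup>2) + mass w * (2 * E\<^sup>2))"
    proof (rule sum_mono)
      fix w assume w: "w \<in> W n"
      define a where "a = birkhoff m n (ext n w)"
      define e where "e = X n w - a"
      have "\<bar>e\<bar> \<le> \<bar>E\<bar>" using close[OF w] by (simp add: e_def a_def)
      then have "e\<^sup>2 \<le> E\<^sup>2" by (simp add: abs_le_square_iff)
      moreover have "(X n w)\<^sup>2 = 2 * a\<^sup>2 + 2 * e\<^sup>2 - (a - e)\<^sup>2" by (simp add: e_def power2_eq_square algebra_simps)
      ultimately have "(X n w)\<^sup>2 \<le> 2 * a\<^sup>2 + 2 * E\<^sup>2" using zero_le_power2[of "a - e"] by linarith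
      then have "mass w * (X n w)\<^sup>2 \<le> mass w * (2 * a\<^sup>2 + 2 * E\<^sup>2)"
        by (intro mult_left_mono) auto
      then show "mass w * (X n w)\<^sup>2
          \<le> 2 * (mass w * (birkhoff m n (ext n w))\<^sup>2) + mass w * (2 * E\<^sup>2)"
        by (simp add: a_def algebra_simps)
    qed
    also have "\<dots> = 2 * (\<Sum>w\<in>W n. mass w * (birkhoff m n (ext n w))\<^sup>2) + 2 * E\<^sup>2"
      unfolding sum.distrib sum_distrib_left[symmetric] sum_distrib_right[symmetric] sum_cyl by simp
    also have "\<dots> \<le> 2 * (Cg * (real K * (real n * R\<^sup>2))) + 2 * E\<^sup>2"
      using second_moment_words[OF m0 R, of n] by simp
    also have "\<dots> \<le> 2 * (Cg * (real K * (real n * R\<^sup>2))) + 2 * E\<^sup>2 * real n"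
      using n by (simp add: mult_le_cancel_left1)
    finally show "(\<Sum>w\<in>W n. mass w * (X n w)\<^sup>2) \<le> (2 * (Cg * (real K * R\<^sup>2)) + 2 * E\<^sup>2) * real n"
      by (simp add: algebra_simps)
  qed
  obtain Q D where Q: "Q \<ge> 0" and D: "\<And>t n x. x \<in> S \<Longrightarrow> \<bar>t\<bar> \<le> 1 \<Longrightarrow>
     (L g ^^ n) (\<lambda>y. exp (t * birkhoff m n y)) x \<le> D * exp (real n * (t\<^sup>2 * \<rho> / 2 + Q * \<bar>t\<bar> ^ 3))"
    using birkhoff_exponential_moment[OF hm m0] unfolding \<rho>_def by blast
  have "(\<Sum>w\<in>W n. mass w * exp (t * X n w))
      \<le> (exp E * Cg * real K * D) * exp (real n * (t\<^sup>2 * \<rho> / 2 + Q * \<bar>t\<bar> ^ 3))" if t: "\<bar>t\<bar> \<le> 1" for n t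
  proof -
    have "(\<Sum>w\<in>W n. mass w * exp (t * X n w))
        \<le> (\<Sum>w\<in>W n. exp E * (mass w * exp (t * birkhoff m n (ext n w))))"
    proof (rule sum_mono)
      fix w assume w: "w \<in> W n"
      have "t * (X n w - birkhoff m n (ext n w)) \<le> \<bar>t\<bar> * \<bar>X n w - birkhoff m n (ext n w)\<bar>"
        by (metis abs_ge_self abs_mult)
      also have "\<dots> \<le> 1 * E" using t close[OF w] by (intro mult_mono) auto
      finally have "exp (t * X n w) \<le> exp (E + t * birkhoff m n (ext n w))" by (simp add: algebra_simps)
      then have "mass w * exp (t * X n w) \<le> mass w * exp (E + t * birkhoff m n (ext n w))"
        by (intro mult_left_mono) auto
      then show "mass w * exp (t * X n w)
          \<le> exp E * (mass w * exp (t * birkhoff m n (ext n w)))"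
        by (simp add: exp_add mult_ac)
    qed
    also have "\<dots> = exp E * (\<Sum>w\<in>W n. mass w * exp (t * birkhoff m n (ext n w)))"
      by (simp add: sum_distrib_left)
    also have "\<dots> \<le> exp E * (Cg * (real K * (D * exp (real n * (t\<^sup>2 * \<rho> / 2 + Q * \<bar>t\<bar> ^ 3)))))"
      by (intro mult_left_mono moment_bound D t base_point_in_S) auto
    finally show ?thesis by (simp add: mult_ac)
  qed
  then show "\<exists>Q D. Q \<ge> 0 \<and> (\<forall>n t. \<bar>t\<bar> \<le> 1 \<longrightarrow>
      (\<Sum>w\<in>W n. mass w * exp (t * X n w)) \<le> D * exp (real n * (t\<^sup>2 * \<rho> / 2 + Q * \<bar>t\<bar> ^ 3)))"
    using Q by blast
qed

end

subsection \<open>The upper law of the iterated logarithm\<close>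

lemma iterated_log_ratio:
  assumes "r > (0::real)"
  shows "((\<lambda>x. ln (ln (x / r)) / ln (ln x)) \<longlongrightarrow> 1) at_top"
  using assms by real_asymp

lemma iterated_log_small:
  assumes "a > (0::real)"
  shows "((\<lambda>x. sqrt (a * ln (ln x) / x)) \<longlongrightarrow> 0) at_top"
    and "((\<lambda>x. x * sqrt (a * ln (ln x) / x) ^ 3) \<longlongrightarrow> 0) at_top"
  using assms by real_asymp+

text \<open>The margin is spent in three portions. Division by \<open>sqrt r\<close> turns
  \<open>1 + \<epsilon>\<close> into \<open>1 + \<epsilon> / 2\<close>; passing from
  \<open>ln (ln (x / r))\<close> to \<open>ln (ln x)\<close> costs the descent to
  \<open>1 + \<epsilon> / 3\<close>; the term \<open>\<beta> * sqrt x\<close> costs the descent to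
  \<open>1 + \<epsilon> / 4\<close>.\<close>

lemma lil_threshold_gap:
  fixes \<epsilon> \<rho> \<beta> r :: real
  assumes "\<epsilon> > 0" "\<rho> > 0" and r: "r = ((1 + \<epsilon>) / (1 + \<epsilon> / 2))\<^sup>2"
  shows "eventually (\<lambda>x. (1 + \<epsilon> / 4) * sqrt (2 * \<rho> * x * ln (ln x))
     \<le> (1 + \<epsilon>) * sqrt (2 * \<rho> * (x / r) * ln (ln (x / r))) - \<beta> * sqrt x) at_top"
proof -
  define \<eta> where "\<eta> = (1 + \<epsilon> / 3) / (1 + \<epsilon> / 2)"
  have \<eta>: "0 < \<eta>" "\<eta> < 1" using assms by (auto simp: \<eta>_def field_simps)
  have r0: "r > 0" using assms by (simp add: r)
  have "\<eta>\<^sup>2 < 1" using \<eta> by (simp add: power_less_one_iff)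
  then have 1: "eventually (\<lambda>x. \<eta>\<^sup>2 < ln (ln (x / r)) / ln (ln x)) at_top"
    using order_tendstoD(1)[OF iterated_log_ratio[OF r0]] by blast
  have "filterlim (\<lambda>x::real. ln (ln x)) at_top at_top" by real_asymp
  \<comment> \<open>Here \<open>\<epsilon> / 12\<close> is the difference of
    \<open>\<epsilon> / 3\<close> and \<open>\<epsilon> / 4\<close>: for such \<open>x\<close> the
    number \<beta> is at most \<open>\<epsilon> / 12\<close> times
    \<open>sqrt (2 * \<rho> * ln (ln x))\<close>.\<close>
  then have 2: "eventually (\<lambda>x::real. max 1 ((\<beta> / (\<epsilon> / 12))\<^sup>2 / (2 * \<rho>)) \<le> ln (ln x)) at_top"
    unfolding filterlim_at_top by blast
  have 3: "eventually (\<lambda>x::real. x > 0) at_top" by (rule eventually_gt_at_top)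
  show ?thesis
    using 1 2 3
  proof eventually_elim
    case (elim x)
    define l where "l = ln (ln x)"
    have l: "l \<ge> 1" "(\<beta> / (\<epsilon> / 12))\<^sup>2 / (2 * \<rho>) \<le> l" using elim by (auto simp: l_def)
    have "\<eta>\<^sup>2 * l \<le> ln (ln (x / r))" using elim(1) l by (simp add: l_def field_simps)
    define q where "q = sqrt (2 * \<rho> * l)"
    have q: "q \<ge> 0" using l assms by (simp add: q_def)
    have "(\<beta> / (\<epsilon> / 12))\<^sup>2 \<le> 2 * \<rho> * l" using l assms by (simp add: field_simps)
    then have "\<bar>\<beta> / (\<epsilon> / 12)\<bar> \<le> q" unfolding q_def by (metis real_sqrt_abs real_sqrt_le_iff)
    then have \<beta>: "\<beta> \<le> \<epsilon> / 12 * q" using assms by (simp add: field_simps abs_if split: if_splits)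
    have sq: "sqrt r = (1 + \<epsilon>) / (1 + \<epsilon> / 2)" using assms by (simp add: r)
    have "(1 + \<epsilon> / 3) * (q * sqrt x) = (1 + \<epsilon>) * (sqrt (2 * \<rho> * l) * \<eta> * (sqrt x / sqrt r))"
    proof -
      have "d * (e / c) / (d / c) = e" if "c \<noteq> 0" "d \<noteq> 0" for c d e :: real
        using that by simp
      from this[of "1 + \<epsilon> / 2" "1 + \<epsilon>" "1 + \<epsilon> / 3"]
      have "(1 + \<epsilon>) * \<eta> / sqrt r = 1 + \<epsilon> / 3" using assms unfolding sq \<eta>_def by simp
      moreover have "(1 + \<epsilon>) * (sqrt (2 * \<rho> * l) * \<eta> * (sqrt x / sqrt r))
          = ((1 + \<epsilon>) * \<eta> / sqrt r) * (q * sqrt x)"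
        by (simp add: q_def)
      ultimately show ?thesis by simp
    qed
    also have "sqrt (2 * \<rho> * l) * \<eta> * (sqrt x / sqrt r) = sqrt (2 * \<rho> * (x / r) * (\<eta>\<^sup>2 * l))"
      using \<eta> by (simp add: real_sqrt_mult real_sqrt_divide mult_ac)
    also have "(1 + \<epsilon>) * sqrt (2 * \<rho> * (x / r) * (\<eta>\<^sup>2 * l)) \<le> (1 + \<epsilon>) * sqrt (2 * \<rho> * (x / r) * ln (ln (x / r)))"
      using \<open>\<eta>\<^sup>2 * l \<le> ln (ln (x / r))\<close> assms r0 elim
      by (intro mult_left_mono real_sqrt_le_mono) auto
    finally have main: "(1 + \<epsilon> / 3) * (q * sqrt x) \<le> (1 + \<epsilon>) * sqrt (2 * \<rho> * (x / r) * ln (ln (x / r)))" .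
    have "\<beta> * sqrt x \<le> \<epsilon> / 12 * q * sqrt x" using \<beta> elim by (intro mult_right_mono) auto
    moreover have "(1 + \<epsilon> / 4) * sqrt (2 * \<rho> * x * ln (ln x)) = (1 + \<epsilon> / 4) * (q * sqrt x)"
      by (simp add: q_def l_def real_sqrt_mult mult_ac)
    ultimately show ?case using main by (simp add: algebra_simps)
  qed
qed

context gibbs_normalised
begin

text \<open>Cutting after \<open>n\<close> letters maps words of length \<open>n + k\<close>
  injectively to pairs of words, and \<open>quasi_bernoulli\<close> applies to each. Admitting all
  pairs only adds nonnegative terms.\<close>

lemma quasi_independence:
  "measure M {i \<in> S. prefix_word i n \<in> U \<and> prefix_word ((shift ^^ n) i) k \<in> V}
   \<le> Cg ^ 3 * (measure M {i \<in> S. prefix_word i n \<in> U} * measure M {i \<in> S. prefix_word i k \<in> V})"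
proof -
  define Z where "Z = {w. take n w \<in> U \<and> drop n w \<in> V}"
  have pre: "take n (prefix_word i (n + k)) = prefix_word i n"
    "drop n (prefix_word i (n + k)) = prefix_word ((shift ^^ n) i) k" for i
    by (simp_all add: prefix_word_add)
  have "{i \<in> S. prefix_word i n \<in> U \<and> prefix_word ((shift ^^ n) i) k \<in> V}
      = {i \<in> S. prefix_word i (n + k) \<in> Z}"
    by (simp add: Z_def pre)
  then have "measure M {i \<in> S. prefix_word i n \<in> U \<and> prefix_word ((shift ^^ n) i) k \<in> V}
      = (\<Sum>w\<in>Z \<inter> W (n + k). mass w)"
    by (simp add: measure_prefix_set)
  also have "\<dots> \<le> (\<Sum>w\<in>Z \<inter> W (n + k). Cg ^ 3 * (mass (take n w) * mass (drop n w)))"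
  proof (rule sum_mono)
    fix w assume "w \<in> Z \<inter> W (n + k)"
    then have w: "w \<in> W (n + k)" by simp
    show "mass w \<le> Cg ^ 3 * (mass (take n w) * mass (drop n w))"
      using quasi_bernoulli[OF ext_in_S[OF w], of n k] pre[of "ext (n + k) w"] prefix_ext[OF w] by simp
  qed
  also have "\<dots> = (\<Sum>(u, v)\<in>(\<lambda>w. (take n w, drop n w)) ` (Z \<inter> W (n + k)).
      Cg ^ 3 * (mass u * mass v))"
  proof -
    have "inj_on (\<lambda>w. (take n w, drop n w)) (Z \<inter> W (n + k))"
      by (rule inj_onI) (metis append_take_drop_id prod.inject)
    then show ?thesis by (subst sum.reindex) auto
  qed
  also have "\<dots> \<le> (\<Sum>(u, v)\<in>(U \<inter> W n) \<times> (V \<inter> W k). Cg ^ 3 * (mass u * mass v))"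
  proof (rule sum_mono2)
    show "(\<lambda>w. (take n w, drop n w)) ` (Z \<inter> W (n + k)) \<subseteq> (U \<inter> W n) \<times> (V \<inter> W k)"
    proof (rule image_subsetI)
      fix w assume "w \<in> Z \<inter> W (n + k)"
      then have w: "w \<in> Z" "w \<in> W (n + k)" by auto
      have "take n w = prefix_word (ext (n + k) w) n" "drop n w = prefix_word ((shift ^^ n) (ext (n + k) w)) k"
        using pre[of "ext (n + k) w"] prefix_ext[OF w(2)] by auto
      then have "take n w \<in> W n" "drop n w \<in> W k"
        using prefix_word_in_words ext_in_S[OF w(2)] funpow_shift_in_S by metis+
      then show "(take n w, drop n w) \<in> (U \<inter> W n) \<times> (V \<inter> W k)" using w by (simp add: Z_def)
    qed
  qed (use Cg in auto)
  also have "\<dots> = Cg ^ 3 * ((\<Sum>u\<in>U \<inter> W n. mass u) * (\<Sum>v\<in>V \<inter> W k. mass v))"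
  proof -
    have "(\<Sum>u\<in>U \<inter> W n. mass u) * (\<Sum>v\<in>V \<inter> W k. mass v)
        = (\<Sum>(u, v)\<in>(U \<inter> W n) \<times> (V \<inter> W k). mass u * mass v)"
      by (simp only: sum_product sum.cartesian_product)
    then show ?thesis by (simp add: sum_distrib_left split_def)
  qed
  finally show ?thesis by (simp add: measure_prefix_set)
qed

lemma X_0: "X 0 [] = 0"
proof -
  have "Cyl [] = S" by (auto simp: cyl_def)
  then show ?thesis using M_S by (simp add: X_def)
qed

text \<open>Bounded in terms of \<open>N\<close> because in \<open>ottaviani\<close> the remaining
  length \<open>k\<close> varies with the passage time.\<close>

lemma chebyshev_X:
  assumes C: "\<And>n. n \<ge> 1 \<Longrightarrow> (\<Sum>w\<in>W n. mass w * (X n w)\<^sup>2) \<le> C * real n" "C \<ge> 0"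
    and b: "\<beta> > 0" and "k \<le> N"
  shows "measure M {i \<in> S. prefix_word i k \<in> {w. X k w \<le> - \<beta>}} \<le> C * real N / \<beta>\<^sup>2"
proof (cases "k = 0")
  case True
  then have e: "{i \<in> S. prefix_word i k \<in> {w. X k w \<le> - \<beta>}} = {}"
    using b X_0 by (auto simp: prefix_word_def)
  show ?thesis unfolding e using C b by simp
next
  case False
  have "measure M {i \<in> S. prefix_word i k \<in> {w. X k w \<le> - \<beta>}} = (\<Sum>w\<in>{w. X k w \<le> - \<beta>} \<inter> W k. mass w)"
    by (rule measure_prefix_set)
  also have "\<dots> \<le> (\<Sum>w\<in>{w. X k w \<le> - \<beta>} \<inter> W k. mass w * (X k w)\<^sup>2 / \<beta>\<^sup>2)"
  proof (rule sum_mono)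
    fix w assume "w \<in> {w. X k w \<le> - \<beta>} \<inter> W k"
    then have "\<bar>\<beta>\<bar> \<le> \<bar>X k w\<bar>" using b by auto
    then have "\<beta>\<^sup>2 \<le> (X k w)\<^sup>2" unfolding abs_le_square_iff .
    then have "mass w * \<beta>\<^sup>2 \<le> mass w * (X k w)\<^sup>2" by (intro mult_left_mono) auto
    then show "mass w \<le> mass w * (X k w)\<^sup>2 / \<beta>\<^sup>2" using b by (simp add: field_simps)
  qed
  also have "\<dots> \<le> (\<Sum>w\<in>W k. mass w * (X k w)\<^sup>2 / \<beta>\<^sup>2)"
    by (rule sum_mono2) auto
  also have "\<dots> = (\<Sum>w\<in>W k. mass w * (X k w)\<^sup>2) / \<beta>\<^sup>2" by (simp add: sum_divide_distrib)
  also have "\<dots> \<le> C * real k / \<beta>\<^sup>2" using C(1)[of k] False by (intro divide_right_mono) auto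
  also have "\<dots> \<le> C * real N / \<beta>\<^sup>2" using assms by (intro divide_right_mono mult_left_mono) auto
  finally show ?thesis .
qed

lemma chernoff_X:
  assumes D: "(\<Sum>w\<in>W n. mass w * exp (t * X n w)) \<le> E" and t: "t \<ge> 0"
  shows "measure M {i \<in> S. prefix_word i n \<in> {w. X n w \<ge> s}} \<le> exp (- t * s) * E"
proof -
  have "measure M {i \<in> S. prefix_word i n \<in> {w. X n w \<ge> s}} = (\<Sum>w\<in>{w. X n w \<ge> s} \<inter> W n. mass w)"
    by (rule measure_prefix_set)
  also have "\<dots> \<le> (\<Sum>w\<in>{w. X n w \<ge> s} \<inter> W n. exp (- t * s) * (mass w * exp (t * X n w)))"
  proof (rule sum_mono)
    fix w assume "w \<in> {w. X n w \<ge> s} \<inter> W n"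
    then have "t * s \<le> t * X n w" using t by (intro mult_left_mono) auto
    then have "1 \<le> exp (- t * s) * exp (t * X n w)" by (simp add: exp_add[symmetric])
    then have "mass w * 1 \<le> mass w * (exp (- t * s) * exp (t * X n w))"
      by (intro mult_left_mono) auto
    then show "mass w \<le> exp (- t * s) * (mass w * exp (t * X n w))"
      by (simp add: mult_ac)
  qed
  also have "\<dots> \<le> (\<Sum>w\<in>W n. exp (- t * s) * (mass w * exp (t * X n w)))"
    by (rule sum_mono2) auto
  also have "\<dots> \<le> exp (- t * s) * E"
    unfolding sum_distrib_left[symmetric] by (intro mult_left_mono D) auto
  finally show ?thesis .
qed

text \<open>Ottaviani's maximal inequality, with independence replaced by the quasi-Bernoulli property.\<close>

lemma ottaviani:
  assumes C: "\<And>n. n \<ge> 1 \<Longrightarrow> (\<Sum>w\<in>W n. mass w * (X n w)\<^sup>2) \<le> C * real n" "C \<ge> 0"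
    and b: "\<beta> > 0" "Cg ^ 3 * (C * real N / \<beta>\<^sup>2) \<le> 1 / 2"
  shows "measure M {i \<in> S. \<exists>n\<in>{1..N}. X n (prefix_word i n) > t}
     \<le> 2 * measure M {i \<in> S. X N (prefix_word i N) \<ge> t - \<beta> - 3 * ln Cg}"
proof -
  \<comment> \<open>First passage above \<open>t\<close> at time \<open>n\<close>. It depends on the
    first \<open>n\<close> letters only, as \<open>quasi_independence\<close> requires.\<close>
  define U where "U = (\<lambda>n. {w. X n w > t \<and> (\<forall>j\<in>{1..<n}. X j (take j w) \<le> t)})"
  define D where "D = (\<lambda>n. {i \<in> S. prefix_word i n \<in> U n})"
  define G where "G = {i \<in> S. X N (prefix_word i N) \<ge> t - \<beta> - 3 * ln Cg}"
  have D_sets: "D n \<in> sets M" for n unfolding D_def by (rule prefix_set_sets)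
  have G_sets: "G \<in> sets M"
    unfolding G_def using prefix_set_sets[of N "{w. X N w \<ge> t - \<beta> - 3 * ln Cg}"] by simp
  have D_iff: "i \<in> D n \<longleftrightarrow> i \<in> S \<and> X n (prefix_word i n) > t \<and> (\<forall>j\<in>{1..<n}. X j (prefix_word i j) \<le> t)" for i n
    by (auto simp: D_def U_def take_prefix_word)
  have disj: "disjoint_family_on D {1..N}"
    unfolding disjoint_family_on_def
  proof (intro ballI impI)
    fix n m assume nm: "n \<in> {1..N}" "m \<in> {1..N}" "n \<noteq> m"
    then consider "n \<in> {1..<m}" | "m \<in> {1..<n}" by (auto simp: nat_neq_iff)
    then show "D n \<inter> D m = {}"
      by cases (force simp: D_iff)+
  qed
  have union: "{i \<in> S. \<exists>n\<in>{1..N}. X n (prefix_word i n) > t} = (\<Union>n\<in>{1..N}. D n)"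
  proof (intro equalityI subsetI)
    fix i assume "i \<in> {i \<in> S. \<exists>n\<in>{1..N}. X n (prefix_word i n) > t}"
    then have i: "i \<in> S" "\<exists>n. n \<in> {1..N} \<and> X n (prefix_word i n) > t" by auto
    define n where "n = (LEAST n. n \<in> {1..N} \<and> X n (prefix_word i n) > t)"
    have n: "n \<in> {1..N}" "X n (prefix_word i n) > t"
      using LeastI_ex[OF i(2)] unfolding n_def by auto
    have "X j (prefix_word i j) \<le> t" if j: "j \<in> {1..<n}" for j
      using not_less_Least[of j "\<lambda>n. n \<in> {1..N} \<and> X n (prefix_word i n) > t"] j n(1)
      unfolding n_def[symmetric] by auto
    then show "i \<in> (\<Union>n\<in>{1..N}. D n)" using n i(1) by (auto simp: D_iff)
  qed (auto simp: D_iff)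
  \<comment> \<open>If the level \<open>t\<close> is passed at time \<open>n\<close> and the end of
    the path is not in \<open>G\<close>, then superadditivity, with its defect
    \<open>3 * ln Cg\<close>, forces the rest of the path down to \<open>- \<beta>\<close>.
    Quasi-independence and Chebyshev's inequality bound the measure of this by half that of
    \<open>D n\<close>.\<close>
  have half: "measure M (D n) \<le> 2 * measure M (D n \<inter> G)" if n: "n \<in> {1..N}" for n
  proof -
    define V where "V = {w. X (N - n) w \<le> - \<beta>}"
    define F where "F = {i \<in> S. prefix_word i n \<in> U n \<and> prefix_word ((shift ^^ n) i) (N - n) \<in> V}"
    have F_sets: "F \<in> sets M"
    proof -
      have "take n (prefix_word i N) = prefix_word i n"
        "drop n (prefix_word i N) = prefix_word ((shift ^^ n) i) (N - n)" for i
        using n prefix_word_add[of i n "N - n"] by auto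
      then have "F = {i \<in> S. prefix_word i N \<in> {w. take n w \<in> U n \<and> drop n w \<in> V}}"
        by (simp add: F_def)
      then show ?thesis using prefix_set_sets[of N "{w. take n w \<in> U n \<and> drop n w \<in> V}"] by simp
    qed
    have "D n \<subseteq> (D n \<inter> G) \<union> F"
    proof
      fix i assume i: "i \<in> D n"
      show "i \<in> (D n \<inter> G) \<union> F"
      proof (cases "i \<in> G")
        case False
        have iS: "i \<in> S" "X n (prefix_word i n) > t" using i by (auto simp: D_iff)
        have "X N (prefix_word i N) < t - \<beta> - 3 * ln Cg" using False iS by (simp add: G_def)
        then have "X (N - n) (prefix_word ((shift ^^ n) i) (N - n)) \<le> - \<beta>"
          using X_superadditive[OF iS(1), of n "N - n"] iS(2) n by simp
        then show ?thesis using i iS by (simp add: F_def V_def D_def)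
      qed (use i in simp)
    qed
    then have "measure M (D n) \<le> measure M ((D n \<inter> G) \<union> F)"
      using D_sets G_sets F_sets by (intro finite_measure_mono) auto
    also have "\<dots> \<le> measure M (D n \<inter> G) + measure M F"
      using D_sets G_sets F_sets by (intro measure_Un_le) auto
    also have "measure M F \<le> Cg ^ 3 * (measure M (D n) * measure M {i \<in> S. prefix_word i (N - n) \<in> V})"
      unfolding F_def D_def by (rule quasi_independence)
    also have "\<dots> \<le> Cg ^ 3 * (measure M (D n) * (C * real N / \<beta>\<^sup>2))"
      using Cg unfolding V_def by (intro mult_left_mono chebyshev_X C b) auto
    also have "\<dots> = measure M (D n) * (Cg ^ 3 * (C * real N / \<beta>\<^sup>2))" by (simp add: mult_ac)
    also have "\<dots> \<le> measure M (D n) * (1 / 2)" by (intro mult_left_mono b) auto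
    finally show ?thesis by simp
  qed
  have "measure M (\<Union>n\<in>{1..N}. D n) = (\<Sum>n\<in>{1..N}. measure M (D n))"
    using D_sets disj by (intro finite_measure_finite_Union) auto
  also have "\<dots> \<le> (\<Sum>n\<in>{1..N}. 2 * measure M (D n \<inter> G))" by (intro sum_mono half)
  also have "\<dots> = 2 * (\<Sum>n\<in>{1..N}. measure M (D n \<inter> G))" by (simp add: sum_distrib_left)
  also have "(\<Sum>n\<in>{1..N}. measure M (D n \<inter> G)) = measure M (\<Union>n\<in>{1..N}. D n \<inter> G)"
    using D_sets G_sets disj by (intro finite_measure_finite_Union[symmetric]) (auto simp: disjoint_family_on_def)
  also have "\<dots> \<le> measure M G" using G_sets by (intro finite_measure_mono) auto
  finally show ?thesis unfolding union G_def by simp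
qed

text \<open>The events \<open>B k\<close> say that the threshold belonging to \<open>N k\<close> is
  passed at some time up to \<open>N (Suc k)\<close>. The maximal inequality reduces each to a
  single time, where the best tilt gives a bound of order \<open>k\<close> to the power
  \<open>- \<kappa>\<^sup>2\<close>. This is summable since \<open>\<kappa> > 1\<close>.\<close>

theorem iterated_logarithm_upper:
  assumes C: "\<And>n. n \<ge> 1 \<Longrightarrow> (\<Sum>w\<in>W n. mass w * (X n w)\<^sup>2) \<le> C * real n" "C \<ge> 0"
    and D: "\<And>n t. \<bar>t\<bar> \<le> 1 \<Longrightarrow>
      (\<Sum>w\<in>W n. mass w * exp (t * X n w)) \<le> D * exp (real n * (t\<^sup>2 * \<rho> / 2 + Q * \<bar>t\<bar> ^ 3))"
    and Q: "Q \<ge> 0" and \<rho>: "\<rho> > 0" and \<epsilon>: "\<epsilon> > 0"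
  shows "AE i in M. eventually (\<lambda>n. X n (prefix_word i n) \<le> (1 + \<epsilon>) * sqrt (2 * \<rho> * real n * ln (ln (real n)))) sequentially"
proof -
  define f where "f = (\<lambda>x::real. (1 + \<epsilon>) * sqrt (2 * \<rho> * x * ln (ln x)))"
  define \<kappa> where "\<kappa> = 1 + \<epsilon> / 4"
  define \<theta> where "\<theta> = (1 + \<epsilon>) / (1 + \<epsilon> / 2)"
  have \<theta>: "\<theta> > 1" using \<epsilon> by (simp add: \<theta>_def field_simps)
  \<comment> \<open>The square instead of \<theta> itself: the spare factor absorbs the rounding in
    \<open>N\<close>, so that \<open>N (Suc k) \<le> r * N k\<close> for large
    \<open>k\<close>.\<close>
  define r where "r = \<theta>\<^sup>2"
  define N where "N = (\<lambda>k. nat \<lceil>\<theta> ^ k\<rceil>)"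
  have N: "\<theta> ^ k \<le> real (N k)" "real (N k) < \<theta> ^ k + 1" for k
    using \<theta> zero_le_power[of \<theta> k] unfolding N_def by linarith+
  have f_mono: "f x \<le> f y" if "exp 1 \<le> x" "x \<le> y" for x y
  proof -
    have x0: "x > 0" using that by (smt (verit) exp_gt_zero)
    have "1 \<le> ln x" using that x0 by (simp add: ln_ge_iff)
    moreover have "ln x \<le> ln y" using that x0 by simp
    ultimately have "ln (ln x) \<le> ln (ln y)" "0 \<le> ln (ln x)" by auto
    then show ?thesis
      using that x0 \<rho> \<epsilon> unfolding f_def by (intro mult_left_mono real_sqrt_le_mono mult_mono) auto
  qed
  \<comment> \<open>Chosen so that a deviation of \<open>b0 * sqrt n\<close> satisfies the
    hypothesis of \<open>ottaviani\<close> for every \<open>n\<close>; it is negligible against the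
    threshold, which carries an additional iterated logarithm.\<close>
  define b0 where "b0 = sqrt (2 * Cg ^ 3 * C) + 1"
  have b0: "b0 \<ge> 1" using C Cg by (simp add: b0_def)
  have b0_sq: "Cg ^ 3 * (C * real n / (b0 * sqrt (real n))\<^sup>2) \<le> 1 / 2" if n: "n \<ge> 1" for n
  proof -
    have nn: "0 \<le> 2 * Cg ^ 3 * C" using C Cg by simp
    have "2 * Cg ^ 3 * C = (sqrt (2 * Cg ^ 3 * C))\<^sup>2" using nn by simp
    also have "\<dots> \<le> b0\<^sup>2" using nn unfolding b0_def by (intro power_mono) auto
    finally have "2 * Cg ^ 3 * C \<le> b0\<^sup>2" .
    then have "Cg ^ 3 * C / b0\<^sup>2 \<le> 1 / 2" using b0 by (simp add: divide_le_eq)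
    moreover have "Cg ^ 3 * (C * real n / (b0 * sqrt (real n))\<^sup>2) = Cg ^ 3 * C / b0\<^sup>2"
      using n by (simp add: power_mult_distrib)
    ultimately show ?thesis by simp
  qed
  define \<beta> where "\<beta> = b0 + 3 * ln Cg"
  define B where "B = (\<lambda>k. {i \<in> S. \<exists>n\<in>{1..N (Suc k)}. X n (prefix_word i n) > f (real (N k))})"
  \<comment> \<open>The tilt \<open>\<tau> x\<close> minimises
    \<open>- t * s + x * t\<^sup>2 * \<rho> / 2\<close> over \<open>t\<close>. For
    \<open>s = \<kappa> * sqrt (2 * \<rho> * x * ln (ln x))\<close> the minimiser is
    \<open>s / (\<rho> * x) = sqrt (a * ln (ln x) / x)\<close> and the minimum
    \<open>- \<kappa>\<^sup>2 * ln (ln x)\<close>.\<close>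
  define a where "a = 2 * \<kappa>\<^sup>2 / \<rho>"
  have a: "a > 0" using \<rho> \<epsilon> by (simp add: a_def \<kappa>_def)
  define \<tau> where "\<tau> = (\<lambda>x::real. sqrt (a * ln (ln x) / x))"
  have \<theta>_top: "filterlim (\<lambda>k. \<theta> ^ k) at_top sequentially"
    by (rule filterlim_at_infinity_imp_filterlim_at_top[OF filterlim_realpow_sequentially_gt1])
       (use \<theta> in auto)
  have N_top: "filterlim (\<lambda>k. real (N (Suc k))) at_top sequentially"
  proof (rule filterlim_at_top_mono)
    show "filterlim (\<lambda>k. \<theta> ^ Suc k) at_top sequentially"
      by (rule filterlim_compose[OF \<theta>_top filterlim_Suc])
    show "\<forall>\<^sub>F k in sequentially. \<theta> ^ Suc k \<le> real (N (Suc k))"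
      using N by (intro always_eventually allI)
  qed
  have "eventually (\<lambda>x. \<tau> x < 1) at_top"
    unfolding \<tau>_def using iterated_log_small(1)[OF a] by (rule order_tendstoD) simp
  then have ev1: "eventually (\<lambda>k. \<tau> (real (N (Suc k))) < 1) sequentially"
    by (rule eventually_compose_filterlim[OF _ N_top])
  \<comment> \<open>At this tilt the cubic error in the exponent tends to 0, so in the end it costs
    only a factor \<open>exp 1\<close>.\<close>
  have "((\<lambda>x. Q * (x * \<tau> x ^ 3)) \<longlongrightarrow> 0) at_top"
    unfolding \<tau>_def by (intro tendsto_mult_right_zero iterated_log_small(2) a)
  then have "eventually (\<lambda>x. Q * (x * \<tau> x ^ 3) < 1) at_top"
    by (rule order_tendstoD) simp
  then have ev2: "eventually (\<lambda>k. Q * (real (N (Suc k)) * \<tau> (real (N (Suc k))) ^ 3) < 1) sequentially"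
    by (rule eventually_compose_filterlim[OF _ N_top])
  have "eventually (\<lambda>x. (1 + \<epsilon> / 4) * sqrt (2 * \<rho> * x * ln (ln x))
     \<le> (1 + \<epsilon>) * sqrt (2 * \<rho> * (x / r) * ln (ln (x / r))) - \<beta> * sqrt x) at_top"
    by (rule lil_threshold_gap[OF \<epsilon> \<rho>]) (simp add: r_def \<theta>_def)
  then have ev3: "eventually (\<lambda>k. \<kappa> * sqrt (2 * \<rho> * real (N (Suc k)) * ln (ln (real (N (Suc k)))))
     \<le> f (real (N (Suc k)) / r) - \<beta> * sqrt (real (N (Suc k)))) sequentially"
    unfolding f_def \<kappa>_def by (rule eventually_compose_filterlim[OF _ N_top])
  have ev4: "eventually (\<lambda>k. max (exp 1 * r) (1 / (\<theta> - 1)) \<le> \<theta> ^ k) sequentially"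
    using \<theta>_top unfolding filterlim_at_top by blast
  have est: "eventually (\<lambda>k. measure M (B k) \<le> (2 * \<bar>D\<bar> * exp 1 * ln \<theta> powr (- \<kappa>\<^sup>2)) * real (Suc k) powr (- \<kappa>\<^sup>2)) sequentially"
    using ev1 ev2 ev3 ev4
  proof eventually_elim
    case (elim k)
    define x where "x = real (N (Suc k))"
    have r1: "r > 1" using \<theta> by (simp add: r_def one_less_power)
    have \<theta>k: "exp 1 * r \<le> \<theta> ^ k" "1 / (\<theta> - 1) \<le> \<theta> ^ k" using elim(4) by auto
    have xlow: "\<theta> ^ Suc k \<le> x" using N(1)[of "Suc k"] by (simp add: x_def)
    have "\<theta> ^ k \<le> \<theta> ^ Suc k" using \<theta> by (intro power_increasing) auto
    then have xe: "exp 1 * r \<le> x" using \<theta>k xlow by linarith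
    have "x < \<theta> ^ Suc k + 1" using N(2)[of "Suc k"] by (simp add: x_def)
    also have "\<dots> \<le> \<theta> ^ Suc k + (\<theta> - 1) * \<theta> ^ k" using \<theta>k(2) \<theta> by (simp add: field_simps)
    also have "\<dots> \<le> \<theta> ^ Suc k + (\<theta> - 1) * \<theta> ^ Suc k"
      using \<open>\<theta> ^ k \<le> \<theta> ^ Suc k\<close> \<theta> by (intro add_left_mono mult_left_mono) auto
    also have "\<dots> = r * \<theta> ^ k" by (simp add: r_def power2_eq_square algebra_simps)
    also have "\<dots> \<le> r * real (N k)" using N(1)[of k] r1 by (intro mult_left_mono) auto
    finally have xr: "x / r \<le> real (N k)" using r1 by (simp add: field_simps)
    have "exp 1 \<le> x / r" using xe r1 by (simp add: field_simps)
    then have fle: "f (x / r) \<le> f (real (N k))" using xr by (rule f_mono)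
    have "exp 1 * 1 \<le> exp 1 * r" using r1 by (intro mult_left_mono) auto
    then have x_e: "exp 1 \<le> x" using xe by linarith
    have x1: "x \<ge> 1" using x_e by (smt (verit) exp_ge_add_one_self)
    have N1: "N (Suc k) \<ge> 1" using x1 by (simp add: x_def)
    have lnx: "ln x \<ge> 1" using x_e x1 by (simp add: ln_ge_iff)
    define l where "l = ln (ln x)"
    have l: "l \<ge> 0" using lnx by (simp add: l_def)
    define s where "s = \<kappa> * sqrt (2 * \<rho> * x * l)"
    have \<tau>: "\<tau> x \<le> 1" "\<tau> x \<ge> 0" using elim(1) a l x1 by (auto simp: x_def[symmetric] \<tau>_def l_def)
    have \<tau>2: "(\<tau> x)\<^sup>2 = a * l / x" using a l x1 by (simp add: \<tau>_def l_def)
    have s_eq: "s = \<rho> * x * \<tau> x"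
    proof -
      have "\<rho> * x * \<tau> x = sqrt ((\<rho> * x)\<^sup>2) * sqrt (a * l / x)"
        using \<rho> x1 by (simp add: \<tau>_def l_def)
      also have "\<dots> = sqrt (\<kappa>\<^sup>2 * (2 * \<rho> * x * l))"
        using \<rho> x1 unfolding real_sqrt_mult[symmetric] by (simp add: a_def power2_eq_square field_simps)
      also have "\<dots> = s" using \<epsilon> by (simp add: s_def real_sqrt_mult \<kappa>_def)
      finally show ?thesis by simp
    qed
    have "measure M (B k) \<le> 2 * measure M {i \<in> S. X (N (Suc k)) (prefix_word i (N (Suc k)))
        \<ge> f (real (N k)) - b0 * sqrt x - 3 * ln Cg}"
      unfolding B_def x_def using b0 N1 by (intro ottaviani[OF C] b0_sq) auto
    also have "\<dots> \<le> 2 * measure M {i \<in> S. prefix_word i (N (Suc k)) \<in> {w. X (N (Suc k)) w \<ge> s}}"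
    proof (intro mult_left_mono finite_measure_mono prefix_set_sets subsetI)
      fix i assume "i \<in> {i \<in> S. X (N (Suc k)) (prefix_word i (N (Suc k))) \<ge> f (real (N k)) - b0 * sqrt x - 3 * ln Cg}"
      then have i: "i \<in> S" "X (N (Suc k)) (prefix_word i (N (Suc k))) \<ge> f (real (N k)) - b0 * sqrt x - 3 * ln Cg" by auto
      have "3 * ln Cg * 1 \<le> 3 * ln Cg * sqrt x" using x1 Cg by (intro mult_left_mono) auto
      then have "s \<le> f (real (N k)) - b0 * sqrt x - 3 * ln Cg"
        using elim(3) fle by (simp add: x_def[symmetric] s_def l_def \<beta>_def algebra_simps)
      then show "i \<in> {i \<in> S. prefix_word i (N (Suc k)) \<in> {w. X (N (Suc k)) w \<ge> s}}" using i by auto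
    qed simp
    also have "\<dots> \<le> 2 * (exp (- \<tau> x * s) * (D * exp (x * ((\<tau> x)\<^sup>2 * \<rho> / 2 + Q * \<bar>\<tau> x\<bar> ^ 3))))"
      unfolding x_def using \<tau> by (intro mult_left_mono chernoff_X D) (auto simp: x_def)
    also have "\<dots> \<le> 2 * (exp (- \<tau> x * s) * (\<bar>D\<bar> * exp (x * ((\<tau> x)\<^sup>2 * \<rho> / 2 + Q * \<bar>\<tau> x\<bar> ^ 3))))"
      by (intro mult_left_mono mult_right_mono) auto
    also have "\<dots> = 2 * \<bar>D\<bar> * exp (- \<tau> x * s + x * ((\<tau> x)\<^sup>2 * \<rho> / 2 + Q * \<bar>\<tau> x\<bar> ^ 3))"
      by (subst exp_add) (simp only: mult_ac)
    also have "- \<tau> x * s + x * ((\<tau> x)\<^sup>2 * \<rho> / 2 + Q * \<bar>\<tau> x\<bar> ^ 3)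
        = - (\<rho> * x / 2) * (\<tau> x)\<^sup>2 + Q * (x * \<tau> x ^ 3)"
      using \<tau> by (simp add: s_eq power2_eq_square field_simps)
    also have "- (\<rho> * x / 2) * (\<tau> x)\<^sup>2 = - \<kappa>\<^sup>2 * l"
      using \<rho> x1 by (simp add: \<tau>2 a_def)
    also have "2 * \<bar>D\<bar> * exp (- \<kappa>\<^sup>2 * l + Q * (x * \<tau> x ^ 3)) \<le> 2 * \<bar>D\<bar> * exp (- \<kappa>\<^sup>2 * l + 1)"
      using elim(2) by (intro mult_left_mono) (auto simp: x_def)
    also have "\<dots> = 2 * \<bar>D\<bar> * exp 1 * ln x powr (- \<kappa>\<^sup>2)"
    proof -
      have "ln x powr (- \<kappa>\<^sup>2) = exp (- \<kappa>\<^sup>2 * l)" using lnx by (simp add: powr_def l_def)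
      then show ?thesis by (subst exp_add) simp
    qed
    also have "\<dots> \<le> 2 * \<bar>D\<bar> * exp 1 * (ln \<theta> * real (Suc k)) powr (- \<kappa>\<^sup>2)"
    proof (intro mult_left_mono powr_mono2')
      \<comment> \<open>Along geometrically growing times the logarithm is linear in
        \<open>k\<close>, so a power of \<open>ln x\<close> becomes a power of
        \<open>k\<close>.\<close>
      have "ln (\<theta> ^ Suc k) \<le> ln x" using xlow \<theta> x1 by (subst ln_le_cancel_iff) auto
      then show "ln \<theta> * real (Suc k) \<le> ln x" using \<theta> by (simp add: ln_realpow mult.commute del: power_Suc)
      show "0 < ln \<theta> * real (Suc k)" using \<theta> by simp
    qed auto
    also have "\<dots> = (2 * \<bar>D\<bar> * exp 1 * ln \<theta> powr (- \<kappa>\<^sup>2)) * real (Suc k) powr (- \<kappa>\<^sup>2)"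
      using \<theta> by (simp add: powr_mult)
    finally show ?case .
  qed
  have B_sets: "B k \<in> sets M" for k
  proof -
    have "B k = (\<Union>n\<in>{1..N (Suc k)}. {i \<in> S. prefix_word i n \<in> {w. X n w > f (real (N k))}})"
      by (auto simp: B_def)
    also have "\<dots> \<in> sets M" by (intro sets.finite_UN prefix_set_sets) auto
    finally show ?thesis .
  qed
  have "summable (\<lambda>k. measure M (B k))"
  proof (rule summable_comparison_test_ev)
    show "eventually (\<lambda>k. norm (measure M (B k)) \<le>
        (2 * \<bar>D\<bar> * exp 1 * ln \<theta> powr (- \<kappa>\<^sup>2)) * real (Suc k) powr (- \<kappa>\<^sup>2)) sequentially"
      using est by simp
    have "1 < \<kappa>\<^sup>2" using \<epsilon> by (simp add: \<kappa>_def one_less_power)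
    then have "summable (\<lambda>k. real k powr (- \<kappa>\<^sup>2))" by (subst summable_real_powr_iff) simp
    then have "summable (\<lambda>k. real (Suc k) powr (- \<kappa>\<^sup>2))" by (subst summable_Suc_iff)
    then show "summable (\<lambda>k. (2 * \<bar>D\<bar> * exp 1 * ln \<theta> powr (- \<kappa>\<^sup>2)) * real (Suc k) powr (- \<kappa>\<^sup>2))"
      by (rule summable_mult)
  qed
  then have "AE i in M. eventually (\<lambda>k. i \<in> space M - B k) sequentially"
    using B_sets by (intro borel_cantelli_AE1) (auto simp: less_top[symmetric])
  then show ?thesis
    using AE_S
  proof eventually_elim
    case (elim i)
    then obtain k0 where k0: "\<And>k. k \<ge> k0 \<Longrightarrow> i \<notin> B k" by (auto simp: eventually_sequentially)
    obtain k1 where k1: "\<And>k. k \<ge> k1 \<Longrightarrow> exp 1 * r \<le> \<theta> ^ k"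
      using ev4 by (auto simp: eventually_sequentially)
    define k2 where "k2 = max k0 k1"
    have "X n (prefix_word i n) \<le> f (real n)" if n: "n > N k2" for n
    proof -
      have "\<exists>k. n \<le> N k"
      proof -
        obtain k where "real n < \<theta> ^ k" using real_arch_pow[OF \<theta>] by blast
        then have "real n \<le> real (N k)" using N(1)[of k] by linarith
        then show ?thesis by auto
      qed
      \<comment> \<open>The first index with \<open>n \<le> N k\<close>: its predecessor
        \<open>j\<close> satisfies \<open>N j \<le> n \<le> N (Suc j)\<close>, so a violation of the
        bound at time \<open>n\<close> would put \<open>i\<close> into \<open>B j\<close>.\<close>
      define k where "k = (LEAST k. n \<le> N k)"
      have nk: "n \<le> N k" using LeastI_ex[OF \<open>\<exists>k. n \<le> N k\<close>] by (simp add: k_def)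
      have mono: "N j \<le> N j'" if "j \<le> j'" for j j'
        unfolding N_def using \<theta> that by (intro nat_mono ceiling_mono power_increasing) auto
      have "k > k2"
      proof (rule ccontr)
        assume "\<not> k2 < k"
        then have "N k \<le> N k2" by (intro mono) simp
        then show False using nk n by simp
      qed
      then obtain j where j: "k = Suc j" "j \<ge> k2" by (cases k) auto
      have "\<not> n \<le> N j" using not_less_Least[of j "\<lambda>k. n \<le> N k"] j by (simp add: k_def)
      then have nj: "N j \<le> n" by simp
      have r1: "r > 1" using \<theta> by (simp add: r_def one_less_power)
      have "exp 1 * 1 \<le> exp 1 * r" using r1 by (intro mult_left_mono) auto
      moreover have "exp 1 * r \<le> \<theta> ^ j" using k1[of j] j by (simp add: k2_def)
      ultimately have "exp 1 \<le> real (N j)" using N(1)[of j] by linarith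
      then have "f (real (N j)) \<le> f (real n)" using nj by (intro f_mono) auto
      moreover have "i \<notin> B j" using k0[of j] j by (simp add: k2_def)
      moreover have "n \<in> {1..N (Suc j)}" using n nk j by auto
      ultimately show ?thesis using elim unfolding B_def by force
    qed
    then show ?case unfolding f_def by (auto simp: eventually_at_top_dense)
  qed
qed

end

subsection \<open>Normalisation and recurrence\<close>

context sft
begin

lemma holder_imp_hol:
  assumes "holder K A f"
  shows "\<exists>C \<alpha>. 0 < \<alpha> \<and> \<alpha> < 1 \<and> hol \<alpha> C f"
proof -
  obtain C \<alpha> where h: "C > 0" "0 < \<alpha>" "\<alpha> < 1"
    "\<And>x y. x \<in> S \<Longrightarrow> y \<in> S \<Longrightarrow> x \<noteq> y \<Longrightarrow> \<bar>f x - f y\<bar> \<le> C * \<alpha> ^ agree_len x y"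
    using assms unfolding holder_def by blast
  have "hol \<alpha> C f"
  proof (rule holI)
    fix n x y assume xy: "x \<in> S" "y \<in> S" "agree n x y"
    show "\<bar>f x - f y\<bar> \<le> C * \<alpha> ^ n"
    proof (cases "x = y")
      case False
      then have "\<exists>n. x n \<noteq> y n" by auto
      then have "x (agree_len x y) \<noteq> y (agree_len x y)" unfolding agree_len_def by (rule LeastI_ex)
      then have "n \<le> agree_len x y" using xy(3) by (force simp: agree_def not_le[symmetric])
      then have "C * \<alpha> ^ agree_len x y \<le> C * \<alpha> ^ n"
        using h by (intro mult_left_mono power_decreasing) auto
      then show ?thesis using h(4)[OF xy(1,2) False] by linarith
    qed (use h in simp)
  qed (use h in simp)
  then show ?thesis using h by blast
qed

text \<open>Needed as an equality to bound a sum of cylinder measures from below in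
  \<open>normalisation\<close>. With a witness \<open>Y\<close> in place of the set of all
  preimages, finiteness comes out of the induction.\<close>

lemma Ln_eq_sum_preimages:
  assumes "x \<in> S"
  shows "\<exists>Y. finite Y \<and> Y \<subseteq> {y \<in> S. (shift ^^ n) y = x} \<and>
    (L g ^^ n) F x = (\<Sum>y\<in>Y. exp (birkhoff g n y) * F y)"
proof (induction n arbitrary: F)
  case 0
  then show ?case using assms by (intro exI[of _ "{x}"]) simp
next
  case (Suc n)
  obtain Y where Y: "finite Y" "Y \<subseteq> {y \<in> S. (shift ^^ n) y = x}"
    "(L g ^^ n) (L g F) x = (\<Sum>z\<in>Y. exp (birkhoff g n z) * L g F z)"
    using Suc[of "L g F"] by blast
  define T where "T = (SIGMA z:Y. pred_letters (z 0))"
  have inj: "inj_on (\<lambda>(z, a). scons a z) T"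
    by (rule inj_onI) (auto, (metis shift_scons scons_0)+)
  have "(L g ^^ Suc n) F x = (\<Sum>z\<in>Y. \<Sum>a\<in>pred_letters (z 0). exp (birkhoff g (Suc n) (scons a z)) * F (scons a z))"
    using Y(3) by (simp add: funpow_swap1 transfer_eq sum_distrib_left birkhoff_Suc exp_add mult_ac)
  also have "\<dots> = (\<Sum>(z, a)\<in>T. exp (birkhoff g (Suc n) (scons a z)) * F (scons a z))"
    unfolding T_def using Y(1) by (intro sum.Sigma) auto
  also have "\<dots> = (\<Sum>y\<in>(\<lambda>(z, a). scons a z) ` T. exp (birkhoff g (Suc n) y) * F y)"
    by (subst sum.reindex[OF inj]) (simp add: split_def)
  finally have "(L g ^^ Suc n) F x = (\<Sum>y\<in>(\<lambda>(z, a). scons a z) ` T. exp (birkhoff g (Suc n) y) * F y)" .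
  moreover have "(\<lambda>(z, a). scons a z) ` T \<subseteq> {y \<in> S. (shift ^^ Suc n) y = x}"
    using Y(2) scons_pred_in_S by (auto simp: T_def funpow_Suc_right simp del: funpow.simps(2))
  moreover have "finite T" using Y(1) by (simp add: T_def)
  ultimately show ?case by (intro exI[of _ "(\<lambda>(z, a). scons a z) ` T"]) auto
qed

text \<open>Passing from \<open>f\<close> to \<open>g\<close> changes Birkhoff sums by a bounded
  coboundary and by \<open>n * ln \<kappa>\<close>, so the Gibbs inequality carries over up to a
  factor \<open>exp (n * d)\<close>, where \<open>d\<close> is \<open>ln \<kappa>\<close> minus the
  pressure. Comparing the total cylinder measure 1 with sums of weights
  \<open>exp (birkhoff g n y)\<close>, which \<open>L 1 = 1\<close> controls, shows that
  \<open>n * d\<close> is bounded. Hence \<open>d = 0\<close>, without an evaluation of the limit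
  that defines the pressure.\<close>

lemma normalisation:
  assumes hf: "hol \<alpha> C f" and \<alpha>: "0 < \<alpha>" "\<alpha> < 1" and gM: "gibbs_measure K A f M"
  shows "\<exists>g b Cg a Ca \<kappa>. gibbs_normalised K A p g b \<alpha> M Cg \<and> hol \<alpha> Ca a \<and>
    (\<forall>x. g x = f x + a x - a (shift x) - ln \<kappa>)"
proof -
  interpret pot: potential K A p f C \<alpha> using \<alpha> hf by unfold_locales
  obtain a \<kappa> Ca where \<kappa>: "\<kappa> > 0" and ha: "hol \<alpha> Ca a"
    and L1: "\<And>x. x \<in> S \<Longrightarrow> L (\<lambda>y. f y + a y - a (shift y) - ln \<kappa>) (\<lambda>_. 1) x = 1"
    using pot.eigenfunction by blast
  define g where "g = (\<lambda>y. f y + a y - a (shift y) - ln \<kappa>)"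
  have hg: "hol \<alpha> (C + Ca + Ca / \<alpha> + 0) g"
    unfolding g_def by (intro hol_diff hol_add hol_const hf ha hol_shift[OF ha \<alpha>])
  interpret N: normalised K A p g "C + Ca + Ca / \<alpha> + 0" \<alpha>
  proof unfold_locales
    show "0 < \<alpha>" "\<alpha> < 1" using \<alpha> by auto
    show "hol \<alpha> (C + Ca + Ca / \<alpha> + 0) g" by (rule hg)
    show "L g (\<lambda>_. 1) x = 1" if "x \<in> S" for x unfolding g_def by (rule L1[OF that])
  qed
  interpret IM: invariant_measure K A p M
    using gM
    by (intro invariant_measure.intro invariant_measure_axioms.intro sft_axioms) (auto simp: gibbs_measure_def)
  obtain C' where C': "C' > 1"
    and G: "\<And>i n. i \<in> S \<Longrightarrow> n \<ge> 1 \<Longrightarrow>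
        1 / C' \<le> measure M (Cyl (prefix_word i n)) / exp (- real n * pressure K A f + birkhoff f n i) \<and>
        measure M (Cyl (prefix_word i n)) / exp (- real n * pressure K A f + birkhoff f n i) \<le> C'"
    using gM unfolding gibbs_measure_def by blast
  define A0 where "A0 = \<bar>a origin\<bar> + Ca"
  have A0: "\<bar>a x\<bar> \<le> A0" if "x \<in> S" for x unfolding A0_def by (rule hol_bounded[OF ha that])
  define d where "d = ln \<kappa> - pressure K A f"
  define E where "E = C' * exp (2 * A0)"
  have A0_nn: "A0 \<ge> 0" using A0[OF origin_in_S] by linarith
  have E1: "E \<ge> 1" using C' A0_nn mult_mono[of 1 C' 1 "exp (2 * A0)"] by (simp add: E_def)
  have Gg: "exp (real n * d) * exp (birkhoff g n i) / E \<le> measure M (Cyl (prefix_word i n)) \<and>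
      measure M (Cyl (prefix_word i n)) \<le> E * (exp (real n * d) * exp (birkhoff g n i))"
    if i: "i \<in> S" and n: "n \<ge> 1" for i n
  proof -
    define c where "c = a ((shift ^^ n) i) - a i"
    have c: "\<bar>c\<bar> \<le> 2 * A0"
      using A0[OF i] A0[OF funpow_shift_in_S[OF i], of n] unfolding c_def by linarith
    have "birkhoff g n i - real n * (- ln \<kappa>) = birkhoff f n i + (- a ((shift ^^ n) i)) - (- a i)"
      by (rule N.birkhoff_coboundary[OF _ i]) (simp add: g_def)
    then have "- real n * pressure K A f + birkhoff f n i = real n * d + birkhoff g n i + c"
      by (simp add: d_def c_def algebra_simps)
    then have e: "exp (- real n * pressure K A f + birkhoff f n i) = exp (real n * d) * exp (birkhoff g n i) * exp c"
      by (simp add: exp_add)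
    define Z where "Z = exp (real n * d) * exp (birkhoff g n i)"
    have Z: "Z > 0" by (simp add: Z_def)
    define \<mu> where "\<mu> = measure M (Cyl (prefix_word i n))"
    have 1: "Z * exp c / C' \<le> \<mu>" "\<mu> \<le> C' * (Z * exp c)"
      using G[OF i n] C' unfolding e Z_def[symmetric] \<mu>_def[symmetric]
      using Z by (auto simp: field_simps)
    have "\<mu> \<le> C' * (Z * exp (2 * A0))"
      using 1(2) c C' Z by (smt (verit) exp_le_cancel_iff mult_left_mono)
    moreover have "Z / E \<le> \<mu>"
    proof -
      have "Z / E = Z * exp (- 2 * A0) / C'" by (simp add: E_def exp_minus field_simps)
      also have "\<dots> \<le> Z * exp c / C'"
        using c C' Z by (intro divide_right_mono mult_left_mono) auto
      finally show ?thesis using 1(1) by linarith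
    qed
    ultimately show ?thesis by (simp add: Z_def \<mu>_def E_def mult_ac)
  qed
  have low: "1 \<le> E * real K * exp (real n * d)" if n: "n \<ge> 1" for n
  proof -
    have "1 = (\<Sum>w\<in>W n. measure M (Cyl w))" by (simp add: IM.sum_cyl)
    also have "\<dots> \<le> (\<Sum>w\<in>W n. E * exp (real n * d) * (exp (birkhoff g n (ext n w)) * 1))"
    proof (rule sum_mono)
      fix w assume w: "w \<in> W n"
      show "measure M (Cyl w) \<le> E * exp (real n * d) * (exp (birkhoff g n (ext n w)) * 1)"
        using Gg[OF ext_in_S[OF w] n] prefix_ext[OF w] by (simp add: mult_ac)
    qed
    also have "\<dots> = E * exp (real n * d) * (\<Sum>w\<in>W n. exp (birkhoff g n (ext n w)) * 1)"
      by (simp add: sum_distrib_left)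
    also have "\<dots> \<le> E * exp (real n * d) * (\<Sum>c\<in>{1..K}. (L g ^^ n) (\<lambda>_. 1) (base_point c))"
      using E1 by (intro mult_left_mono sum_words_le_Ln) auto
    also have "(\<Sum>c\<in>{1..K}. (L g ^^ n) (\<lambda>_. 1) (base_point c)) = (\<Sum>c\<in>{1..K}. 1)"
      by (intro sum.cong refl N.Ln_const base_point_in_S)
    finally show ?thesis by (simp add: mult_ac)
  qed
  have up: "exp (real n * d) \<le> E" if n: "n \<ge> 1" for n
  proof -
    obtain Y where Y: "finite Y" "Y \<subseteq> {y \<in> S. (shift ^^ n) y = origin}"
      "(L g ^^ n) (\<lambda>_. 1) origin = (\<Sum>y\<in>Y. exp (birkhoff g n y) * 1)"
      using Ln_eq_sum_preimages[OF origin_in_S, of n g "\<lambda>_. 1"] by blast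
    \<comment> \<open>Distinct n-th preimages of one point differ among their first \<open>n\<close>
      letters, so their cylinders are disjoint and the measures sum to at most 1.\<close>
    have inj: "inj_on (\<lambda>y. prefix_word y n) Y"
    proof (rule inj_onI)
      fix y z assume yz: "y \<in> Y" "z \<in> Y" "prefix_word y n = prefix_word z n"
      have "y l = z l" for l
      proof (cases "l < n")
        case True
        then show ?thesis using yz(3) unfolding prefix_word_eq_iff agree_def by blast
      next
        case False
        have "(shift ^^ n) y = origin" "(shift ^^ n) z = origin" using yz(1,2) Y(2) by blast+
        then have "(\<lambda>k. y (n + k)) = (\<lambda>k. z (n + k))" by (simp add: funpow_shift)
        then show ?thesis using False by (metis le_add_diff_inverse not_le)
      qed
      then show "y = z" by auto
    qed
    have "exp (real n * d) = exp (real n * d) * (\<Sum>y\<in>Y. exp (birkhoff g n y) * 1)"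
      using N.Ln_const[OF origin_in_S, of n 1] Y(3) by simp
    also have "\<dots> = (\<Sum>y\<in>Y. exp (real n * d) * exp (birkhoff g n y))"
      by (simp add: sum_distrib_left)
    also have "\<dots> \<le> (\<Sum>y\<in>Y. E * measure M (Cyl (prefix_word y n)))"
    proof (rule sum_mono)
      fix y assume "y \<in> Y"
      then have "y \<in> S" using Y by auto
      then show "exp (real n * d) * exp (birkhoff g n y) \<le> E * measure M (Cyl (prefix_word y n))"
        using Gg[OF _ n, of y] E1 by (simp add: field_simps)
    qed
    also have "\<dots> = E * (\<Sum>w\<in>(\<lambda>y. prefix_word y n) ` Y. measure M (Cyl w))"
      by (subst sum.reindex[OF inj]) (simp add: sum_distrib_left)
    also have "\<dots> \<le> E * (\<Sum>w\<in>W n. measure M (Cyl w))"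
      using E1 Y prefix_word_in_words by (intro mult_left_mono sum_mono2) auto
    finally show ?thesis by (simp add: IM.sum_cyl)
  qed
  have d0: "d = 0"
  proof -
    define q where "q = ln E + ln (E * real K)"
    have "1 \<le> real K" using K2 by simp
    then have EK: "1 \<le> E * real K" using mult_mono[OF E1, of 1 "real K"] E1 by simp
    have le: "real n * \<bar>d\<bar> \<le> q" if n: "n \<ge> 1" for n
    proof -
      have 1: "real n * d \<le> ln E" using up[OF n] E1 by (simp add: ln_ge_iff)
      have "exp (- (real n * d)) \<le> E * real K"
        using low[OF n] by (simp add: exp_minus field_simps)
      then have 2: "- (real n * d) \<le> ln (E * real K)" using EK by (simp add: ln_ge_iff)
      have "0 \<le> ln E" "0 \<le> ln (E * real K)" using E1 EK by simp_all
      then show ?thesis using 1 2 unfolding q_def by (cases "d \<ge> 0") (simp_all add: abs_if)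
    qed
    have q: "0 \<le> q" using E1 EK by (simp add: q_def)
    show ?thesis
    proof (rule ccontr)
      assume "d \<noteq> 0"
      then obtain n where n: "q < real n * \<bar>d\<bar>" using reals_Archimedean3[of "\<bar>d\<bar>"] by auto
      then have "n \<ge> 1" using q by (cases n) auto
      then show False using le n by force
    qed
  qed
  have "gibbs_normalised K A p g (C + Ca + Ca / \<alpha> + 0) \<alpha> M E"
  proof unfold_locales
    fix i n assume i: "i \<in> S"
    \<comment> \<open>The definition of a Gibbs measure starts at \<open>n = 1\<close>; for
      \<open>n = 0\<close> the cylinder is all of \<open>S\<close> and \<open>E \<ge> 1\<close>
      suffices.\<close>
    have "Cyl (prefix_word i 0) = S" by (auto simp: cyl_def prefix_word_def)
    then have 0: "measure M (Cyl (prefix_word i 0)) = 1" using IM.M_S by simp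
    show "exp (birkhoff g n i) / E \<le> measure M (Cyl (prefix_word i n))"
      using Gg[OF i, of n] 0 E1 by (cases "n = 0") (auto simp: d0)
    show "measure M (Cyl (prefix_word i n)) \<le> E * exp (birkhoff g n i)"
      using Gg[OF i, of n] 0 E1 by (cases "n = 0") (auto simp: d0)
  qed (rule E1)
  then show ?thesis using ha by (intro exI conjI) (auto simp: g_def)
qed

end

section \<open>Entropy and the Borel-Cantelli argument for recurrence\<close>

context gibbs_normalised
begin

text \<open>The sum over words is the integral of the logarithm of the cylinder measure. Its
  integrand differs by at most \<open>ln Cg\<close> from the Birkhoff sum of \<open>g\<close>, whose
  mean is \<open>n * nu g\<close>.\<close>

lemma entropy_eq: "entropy_of K A M = - nu g"
proof -
  define T where "T = (\<lambda>n. \<Sum>w\<in>W n. mass w * ln (mass w))"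
  have T: "\<bar>T n - real n * nu g\<bar> \<le> ln Cg" for n
  proof -
    define H where "H = (\<lambda>w. ln (mass w))"
    obtain D where D: "hol \<alpha> D (birkhoff g n)" using hol_birkhoff[OF hol_g \<alpha>] by blast
    have IT: "T n = I (\<lambda>i. H (prefix_word i n))" unfolding T_def H_def by (rule integral_prefix[symmetric])
    have iH: "integrable M (\<lambda>i. indicator S i * H (prefix_word i n))" by (rule integrable_prefix)
    have diff: "I (\<lambda>i. H (prefix_word i n) - birkhoff g n i) = T n - real n * nu g"
      using I_diff[OF iH hol_int[OF D]] I_birkhoff[OF hol_g, of n] I_eq_nu[OF hol_g] IT by simp
    have int: "integrable M (\<lambda>i. indicator S i * (H (prefix_word i n) - birkhoff g n i))"
      using iH hol_int[OF D] by (simp add: right_diff_distrib)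
    have diff': "I (\<lambda>i. birkhoff g n i - H (prefix_word i n)) = real n * nu g - T n"
      using I_diff[OF hol_int[OF D] iH] I_birkhoff[OF hol_g, of n] I_eq_nu[OF hol_g] IT by simp
    have int': "integrable M (\<lambda>i. indicator S i * (birkhoff g n i - H (prefix_word i n)))"
      using iH hol_int[OF D] by (simp add: right_diff_distrib)
    have c: "integrable M (\<lambda>i. indicator S i * ln Cg)" by (rule hol_int[OF hol_const])
    have ptw: "\<bar>H (prefix_word i n) - birkhoff g n i\<bar> \<le> ln Cg" if "i \<in> S" for i
      unfolding H_def by (rule ln_cyl_close[OF that])
    have "I (\<lambda>i. H (prefix_word i n) - birkhoff g n i) \<le> I (\<lambda>_. ln Cg)"
      using ptw by (intro I_mono int c) force
    moreover have "I (\<lambda>i. birkhoff g n i - H (prefix_word i n)) \<le> I (\<lambda>_. ln Cg)"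
      using ptw by (intro I_mono int' c) force
    ultimately show ?thesis unfolding I_const diff diff' by linarith
  qed
  have "(\<lambda>n. - (1 / real n) * T n - (- nu g)) \<longlonglongrightarrow> 0"
  proof (rule Lim_null_comparison)
    show "\<forall>\<^sub>F n in sequentially. norm (- (1 / real n) * T n - (- nu g)) \<le> ln Cg / real n"
    proof (rule eventually_sequentiallyI[of 1])
      fix n :: nat assume n: "1 \<le> n"
      have "- (1 / real n) * T n - (- nu g) = - ((T n - real n * nu g) / real n)"
        using n by (simp add: field_simps)
      then have "norm (- (1 / real n) * T n - (- nu g)) = \<bar>T n - real n * nu g\<bar> / real n" by simp
      also have "\<dots> \<le> ln Cg / real n" by (intro divide_right_mono T) simp
      finally show "norm (- (1 / real n) * T n - (- nu g)) \<le> ln Cg / real n" .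
    qed
    show "(\<lambda>n. ln Cg / real n) \<longlonglongrightarrow> 0" by (rule lim_const_over_n)
  qed
  then have "(\<lambda>n. - (1 / real n) * T n) \<longlonglongrightarrow> - nu g" by (rule LIM_zero_cancel)
  then show ?thesis unfolding entropy_of_def T_def by (rule limI)
qed

text \<open>A point of the first set is determined by its first \<^term>\<open>n\<close> letters up to position
  \<^term>\<open>n + m\<close>, also when \<^term>\<open>m > n\<close>; hence every word of length \<^term>\<open>n\<close> contributes
  a single cylinder, whose measure the quasi-Bernoulli property estimates.\<close>

lemma recurrence_measure:
  assumes n: "n \<ge> 1"
  shows "measure M {i \<in> S. agree m ((shift ^^ n) i) i \<and> X m (prefix_word i m) \<le> c}
    \<le> Cg ^ 3 * exp (c + real m * nu g)"
    and "{i \<in> S. agree m ((shift ^^ n) i) i \<and> X m (prefix_word i m) \<le> c} \<in> sets M"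
proof -
  define Z where "Z = {w. drop n w = take m w \<and> X m (take m w) \<le> c}"
  have pre: "take n (prefix_word i (n + m)) = prefix_word i n"
    "drop n (prefix_word i (n + m)) = prefix_word ((shift ^^ n) i) m" for i
    by (simp_all add: prefix_word_add)
  have eq: "{i \<in> S. agree m ((shift ^^ n) i) i \<and> X m (prefix_word i m) \<le> c} = {i \<in> S. prefix_word i (n + m) \<in> Z}"
    by (simp add: Z_def pre take_prefix_word prefix_word_eq_iff)
  show "{i \<in> S. agree m ((shift ^^ n) i) i \<and> X m (prefix_word i m) \<le> c} \<in> sets M"
    unfolding eq by (rule prefix_set_sets)
  have inj: "inj_on (take n) (Z \<inter> W (n + m))"
  proof (rule inj_onI)
    fix w w' assume w: "w \<in> Z \<inter> W (n + m)" "w' \<in> Z \<inter> W (n + m)" and t: "take n w = take n w'"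
    have per: "u ! (n + l) = u ! l" if u: "u \<in> Z \<inter> W (n + m)" and l: "l < m" for u l
    proof -
      have "drop n u ! l = take m u ! l" using u by (simp add: Z_def)
      then show ?thesis using l u words_length[of u "n + m"] by simp
    qed
    have "w ! l = w' ! l" if "l < n + m" for l
      using that
    proof (induction l rule: less_induct)
      case (less l)
      show ?case
      proof (cases "l < n")
        case True
        then show ?thesis using t by (metis nth_take)
      next
        case False
        then have l: "l = n + (l - n)" "l - n < m" "l - n < l" using less.prems n by auto
        have "w ! (l - n) = w' ! (l - n)" using less.IH[OF l(3)] l(2) by simp
        then show ?thesis using per[OF w(1) l(2)] per[OF w(2) l(2)] l(1) by simp
      qed
    qed
    then show "w = w'" using w words_length by (intro nth_equalityI) auto
  qed
  have "measure M {i \<in> S. prefix_word i (n + m) \<in> Z} = (\<Sum>w\<in>Z \<inter> W (n + m). mass w)"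
    by (rule measure_prefix_set)
  also have "\<dots> \<le> (\<Sum>w\<in>Z \<inter> W (n + m). Cg ^ 3 * exp (c + real m * nu g) * mass (take n w))"
  proof (rule sum_mono)
    fix w assume w: "w \<in> Z \<inter> W (n + m)"
    define y where "y = ext (n + m) w"
    have y: "y \<in> S" "prefix_word y (n + m) = w" unfolding y_def using w ext_in_S prefix_ext by auto
    have d: "take n w = prefix_word y n" "drop n w = prefix_word ((shift ^^ n) y) m"
      using pre[of y] y by auto
    \<comment> \<open>The recurrence makes the second block \<open>drop n w\<close> equal to the
      prefix \<open>take m w\<close>, the word whose measure the bound on \<open>X\<close>
      controls.\<close>
    have "X m (drop n w) \<le> c" using w by (simp add: Z_def)
    then have "ln (mass (drop n w)) \<le> c + real m * nu g" by (simp add: X_def)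
    moreover have "mass (drop n w) > 0"
      unfolding d by (rule cyl_pos[OF funpow_shift_in_S[OF y(1)]])
    ultimately have "mass (drop n w) \<le> exp (c + real m * nu g)"
      by (metis exp_le_cancel_iff exp_ln)
    then have "Cg ^ 3 * (mass (take n w) * mass (drop n w))
        \<le> Cg ^ 3 * (mass (take n w) * exp (c + real m * nu g))"
      using Cg by (intro mult_left_mono) auto
    then show "mass w \<le> Cg ^ 3 * exp (c + real m * nu g) * mass (take n w)"
      using quasi_bernoulli[OF y(1), of n m] unfolding d y by (simp add: mult_ac)
  qed
  also have "\<dots> = Cg ^ 3 * exp (c + real m * nu g) * (\<Sum>u\<in>take n ` (Z \<inter> W (n + m)). mass u)"
    by (subst sum.reindex[OF inj]) (simp add: sum_distrib_left)
  also have "\<dots> \<le> Cg ^ 3 * exp (c + real m * nu g) * (\<Sum>u\<in>W n. mass u)"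
  proof (intro mult_left_mono sum_mono2 image_subsetI)
    fix w assume "w \<in> Z \<inter> W (n + m)"
    then have "ext (n + m) w \<in> S" "prefix_word (ext (n + m) w) (n + m) = w"
      using ext_in_S prefix_ext by auto
    then show "take n w \<in> W n" using pre(1)[of "ext (n + m) w"] prefix_word_in_words by metis
  qed (use Cg in auto)
  finally show "measure M {i \<in> S. agree m ((shift ^^ n) i) i \<and> X m (prefix_word i m) \<le> c}
    \<le> Cg ^ 3 * exp (c + real m * nu g)"
    unfolding eq by (simp add: sum_cyl)
qed

theorem recurrence_null:
  assumes F: "AE i in M. eventually (\<lambda>n. X n (prefix_word i n) \<le> F n) sequentially"
    and sm: "summable (\<lambda>n. exp (F (\<psi> (Suc n)) + real (\<psi> (Suc n)) * nu g))"
  shows "measure M (recurrence_set K A \<psi>) = 0"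
proof -
  \<comment> \<open>A value of \<psi> contributes the same positive term each time it is taken, so
    summability allows it only finitely often. That \<psi> tends to infinity makes the almost sure
    bound, valid for large lengths, applicable at length \<open>\<psi> n\<close>.\<close>
  have \<psi>_top: "filterlim (\<lambda>n. \<psi> (Suc n)) at_top sequentially"
    unfolding filterlim_at_top
  proof (intro allI)
    fix z :: nat
    define e where "e = Min ((\<lambda>v. exp (F v + real v * nu g)) ` {..z})"
    have e: "e > 0" "\<And>v. v < z \<Longrightarrow> e \<le> exp (F v + real v * nu g)"
      by (auto simp: e_def Min_gr_iff)
    have "eventually (\<lambda>n. exp (F (\<psi> (Suc n)) + real (\<psi> (Suc n)) * nu g) < e) sequentially"
      using summable_LIMSEQ_zero[OF sm] e(1) by (rule order_tendstoD)
    then show "eventually (\<lambda>n. z \<le> \<psi> (Suc n)) sequentially"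
      by eventually_elim (use e(2) in \<open>force simp: not_le[symmetric]\<close>)
  qed
  define V where "V = (\<lambda>n. {i \<in> S. agree (\<psi> (Suc n)) ((shift ^^ Suc n) i) i \<and>
      X (\<psi> (Suc n)) (prefix_word i (\<psi> (Suc n))) \<le> F (\<psi> (Suc n))})"
  have V_sets: "V n \<in> sets M" for n unfolding V_def by (rule recurrence_measure) simp
  have V_le: "measure M (V n) \<le> Cg ^ 3 * exp (F (\<psi> (Suc n)) + real (\<psi> (Suc n)) * nu g)" for n
    unfolding V_def by (rule recurrence_measure) simp
  have "summable (\<lambda>n. measure M (V n))"
    by (rule summable_comparison_test'[OF summable_mult[OF sm, of "Cg ^ 3"]]) (use V_le in auto)
  then have "AE i in M. eventually (\<lambda>n. i \<in> space M - V n) sequentially"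
    using V_sets by (intro borel_cantelli_AE1) (auto simp: less_top[symmetric])
  then have ae: "AE i in M. i \<notin> recurrence_set K A \<psi>"
    using F AE_S
  proof eventually_elim
    case (elim i)
    have "eventually (\<lambda>n. X (\<psi> (Suc n)) (prefix_word i (\<psi> (Suc n))) \<le> F (\<psi> (Suc n))) sequentially"
      using eventually_compose_filterlim[OF elim(2) \<psi>_top] .
    with elim(1) have "eventually (\<lambda>n. \<not> agree (\<psi> (Suc n)) ((shift ^^ Suc n) i) i) sequentially"
      by eventually_elim (use elim(3) in \<open>auto simp: V_def\<close>)
    then have ev: "eventually (\<lambda>n. \<not> agree (\<psi> n) ((shift ^^ n) i) i) sequentially"
      by (simp only: eventually_sequentially_Suc[of "\<lambda>n. \<not> agree (\<psi> n) ((shift ^^ n) i) i"])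
    have "agree (\<psi> n) ((shift ^^ n) i) i" if d: "seq_dist K ((shift ^^ n) i) i \<le> real K powr - real (\<psi> n)" for n
    proof (cases "(shift ^^ n) i = i")
      case False
      then have "real K powr (- real (agree_len ((shift ^^ n) i) i)) \<le> real K powr - real (\<psi> n)"
        using d by (simp add: seq_dist_def)
      then have le: "\<psi> n \<le> agree_len ((shift ^^ n) i) i" using K2 by (simp add: powr_le_cancel_iff)
      show ?thesis
        unfolding agree_def
      proof (intro allI impI)
        fix l assume "l < \<psi> n"
        then have "l < (LEAST k. ((shift ^^ n) i) k \<noteq> i k)" using le by (simp add: agree_len_def)
        then show "((shift ^^ n) i) l = i l" using not_less_Least by blast
      qed
    qed (simp add: agree_def)
    then have "eventually (\<lambda>n. \<not> seq_dist K ((shift ^^ n) i) i \<le> real K powr - real (\<psi> n)) sequentially"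
      using ev by (auto elim: eventually_mono)
    then show ?case
      by (auto simp: recurrence_set_def INFM_iff_infinite frequently_def cofinite_eq_sequentially)
  qed
  show ?thesis
  \<comment> \<open>Outside \<open>sets M\<close> the value of \<open>measure\<close> is 0 by
    default; inside, the almost sure statement decides.\<close>
  proof (cases "recurrence_set K A \<psi> \<in> sets M")
    case True
    then show ?thesis using ae prob_eq_0[of "recurrence_set K A \<psi>"] by simp
  qed (rule measure_notin_sets)
qed

end

section \<open>Mean, variance and cohomology of the given potential\<close>

theorem theorem2p1:
  fixes K :: nat and A :: "nat \<Rightarrow> nat \<Rightarrow> nat" and f :: "seq \<Rightarrow> real"
    and M :: "seq measure" and \<psi> :: "nat \<Rightarrow> nat"
  assumes "K \<ge> 2"
    and "\<forall>i\<in>{1..K}. \<forall>j\<in>{1..K}. A i j \<in> {0, 1}"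
    and "\<exists>m. \<forall>i\<in>{1..K}. \<forall>j\<in>{1..K}. mat_pow K A m i j > 0"
    and "holder K A f"
    and "gibbs_measure K A f M"
    and "\<not> cohomologous_const K A f"
    and "\<exists>\<epsilon>>0. summable (\<lambda>n. exp (- entropy_of K A M * real (\<psi> (Suc n)) +
            (1 + \<epsilon>) * sqrt (2 * variance_of K A f M * real (\<psi> (Suc n)) *
                              log0 (log0 (real (\<psi> (Suc n)))))))"
  shows "measure M (recurrence_set K A \<psi>) = 0"
proof -
  obtain p where p: "\<forall>i\<in>{1..K}. \<forall>j\<in>{1..K}. mat_pow K A p i j > 0" using assms(3) by blast
  interpret sft K A p
    using assms(1,2) p by unfold_locales auto
  obtain C \<alpha> where \<alpha>: "0 < \<alpha>" "\<alpha> < 1" and hf: "hol \<alpha> C f"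
    using holder_imp_hol[OF assms(4)] by blast
  obtain g b Cg a Ca \<kappa> where gn: "gibbs_normalised K A p g b \<alpha> M Cg" and ha: "hol \<alpha> Ca a"
    and g: "\<And>x. g x = f x + a x - a (shift x) - ln \<kappa>"
    using normalisation[OF hf \<alpha> assms(5)] by blast
  interpret gibbs_normalised K A p g b \<alpha> M Cg by (rule gn)
  obtain m v Cm Cv where hm: "hol \<alpha> Cm m" and hv: "hol \<alpha> Cv v" and m0: "\<And>x. x \<in> S \<Longrightarrow> L g m x = 0"
    and eq: "\<And>x. x \<in> S \<Longrightarrow> g x - nu g = m x + v (shift x) - v x"
    using martingale_decomposition[OF hol_g] by blast
  define \<rho> where "\<rho> = nu (\<lambda>x. (m x)\<^sup>2)"
  \<comment> \<open>Two coboundaries add up: \<open>v\<close> from the martingale decomposition of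
    \<open>g\<close> and \<open>a\<close> from the normalisation of \<open>f\<close>.\<close>
  define u where "u = (\<lambda>x. v x + a x)"
  have hu: "hol \<alpha> (Cv + Ca) u" unfolding u_def by (rule hol_add[OF hv ha])
  have If: "I f = nu g + ln \<kappa>"
  proof -
    have "f = (\<lambda>x. (g x + ln \<kappa>) + (a (shift x) - a x))" by (auto simp: g)
    then have "I f = I (\<lambda>x. (g x + ln \<kappa>) + (a (shift x) - a x))" by simp
    also have "\<dots> = I g + I (\<lambda>_. ln \<kappa>) + (I (\<lambda>x. a (shift x)) - I a)"
      using I_add[OF hol_int[OF hol_add[OF hol_g hol_const[of _ "ln \<kappa>"]]]
          hol_int[OF hol_diff[OF hol_shift[OF ha \<alpha>] ha]]]
        I_add[OF hol_int[OF hol_g] hol_int[OF hol_const[of _ "ln \<kappa>"]]]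
        I_diff[OF hol_int[OF hol_shift[OF ha \<alpha>]] hol_int[OF ha]] by simp
    finally show ?thesis using I_shift[OF hol_int[OF ha]] I_eq_nu[OF hol_g] I_const[of "ln \<kappa>"] by simp
  qed
  have f_eq: "f x - I f = m x + u (shift x) - u x" if "x \<in> S" for x
    using eq[OF that] by (simp add: If u_def g)
  have var: "variance_of K A f M = \<rho>"
  proof -
    define U where "U = \<bar>u origin\<bar> + (Cv + Ca)"
    define F where "F = (\<lambda>n x. birkhoff f n x - real n * I f)"
    have "(\<lambda>n. (1 / real n) * I (\<lambda>x. (F n x)\<^sup>2)) \<longlonglongrightarrow> \<rho>"
      unfolding \<rho>_def
    proof (rule variance_limit[OF hm m0])
      show "\<exists>C. hol \<alpha> C (F n)" for n
      proof -
        obtain D where "hol \<alpha> D (birkhoff f n)" using hol_birkhoff[OF hf \<alpha>] by blast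
        then show ?thesis unfolding F_def using hol_diff[OF _ hol_const] by blast
      qed
      fix n x assume x: "x \<in> S"
      have "F n x = birkhoff m n x + u ((shift ^^ n) x) - u x"
        unfolding F_def using f_eq x by (rule birkhoff_coboundary)
      moreover have "\<bar>u x\<bar> \<le> U" "\<bar>u ((shift ^^ n) x)\<bar> \<le> U"
        unfolding U_def by (rule hol_bounded[OF hu x], rule hol_bounded[OF hu funpow_shift_in_S[OF x]])
      ultimately show "\<bar>F n x - birkhoff m n x\<bar> \<le> 2 * U" by (simp add: abs_le_iff)
    qed auto
    then show ?thesis unfolding variance_of_def F_def by (rule limI)
  qed
  have "\<rho> \<noteq> 0"
  proof
    assume "\<rho> = 0"
    then have "m x = 0" if "x \<in> S" for x using zero_variance[OF hm _ that] by (simp add: \<rho>_def)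
    then have "\<forall>x\<in>S. f x = u (shift x) - u x + I f" using f_eq by force
    moreover have "continuous_on S u" by (rule hol_continuous[OF hu \<alpha>])
    ultimately show False using assms(6) unfolding cohomologous_const_def by blast
  qed
  moreover have "\<rho> \<ge> 0"
  proof -
    obtain E where "hol \<alpha> E (\<lambda>x. (m x)\<^sup>2)"
      using hol_mult[OF hm hm] \<alpha> by (auto simp: power2_eq_square)
    then have "\<rho> = I (\<lambda>x. (m x)\<^sup>2)" unfolding \<rho>_def by (rule I_eq_nu[symmetric])
    then show ?thesis by (simp add: integral_nonneg)
  qed
  ultimately have \<rho>: "\<rho> > 0" by simp
  obtain \<epsilon> where \<epsilon>: "\<epsilon> > 0" and sm: "summable (\<lambda>n. exp (- entropy_of K A M * real (\<psi> (Suc n)) +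
            (1 + \<epsilon>) * sqrt (2 * variance_of K A f M * real (\<psi> (Suc n)) *
                              log0 (log0 (real (\<psi> (Suc n)))))))"
    using assms(7) by blast
  obtain C2 where C2: "C2 \<ge> 0" "\<And>n. n \<ge> 1 \<Longrightarrow> (\<Sum>w\<in>W n. mass w * (X n w)\<^sup>2) \<le> C2 * real n"
    using X_second_moment[OF hm hv m0 eq] by blast
  obtain Q D where Q: "Q \<ge> 0" and D: "\<And>n t. \<bar>t\<bar> \<le> 1 \<Longrightarrow>
      (\<Sum>w\<in>W n. mass w * exp (t * X n w)) \<le> D * exp (real n * (t\<^sup>2 * \<rho> / 2 + Q * \<bar>t\<bar> ^ 3))"
    using X_exponential_moment[OF hm hv m0 eq] unfolding \<rho>_def by blast
  \<comment> \<open>Written with \<open>log0\<close> to match the summability hypothesis; for large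
    \<open>n\<close> this is the same as the \<open>ln (ln n)\<close> of the law of the iterated
    logarithm.\<close>
  define F where "F = (\<lambda>n. (1 + \<epsilon>) * sqrt (2 * \<rho> * real n * log0 (log0 (real n))))"
  have log0_eq: "eventually (\<lambda>n. log0 (log0 (real n)) = ln (ln (real n))) sequentially"
  proof -
    have "eventually (\<lambda>n. exp (exp 1) < real n) sequentially"
      using filterlim_real_sequentially unfolding filterlim_at_top_dense by blast
    then show ?thesis
    proof eventually_elim
      case (elim n)
      have n: "1 < real n" using elim by (smt (verit) exp_gt_zero one_less_exp_iff)
      have "exp 1 < ln (real n)" using elim n by (metis exp_less_cancel_iff exp_ln less_trans zero_less_one)
      then have "1 < ln (real n)" by (smt (verit) exp_ge_add_one_self)
      then show ?case using n by (simp add: log0_def)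
    qed
  qed
  have "AE i in M. eventually (\<lambda>n. X n (prefix_word i n) \<le>
      (1 + \<epsilon>) * sqrt (2 * \<rho> * real n * ln (ln (real n)))) sequentially"
    by (rule iterated_logarithm_upper[OF C2(2) C2(1) D Q \<rho> \<epsilon>])
  then have "AE i in M. eventually (\<lambda>n. X n (prefix_word i n) \<le> F n) sequentially"
  proof eventually_elim
    case (elim i)
    show ?case using elim log0_eq by eventually_elim (simp add: F_def)
  qed
  moreover have "summable (\<lambda>n. exp (F (\<psi> (Suc n)) + real (\<psi> (Suc n)) * nu g))"
    using sm by (simp add: F_def var entropy_eq algebra_simps)
  ultimately show ?thesis by (rule recurrence_null)
qed

end
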